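(* Let $G$ be an icc group that admits a finite abelian subgroup $G_0<G$ such that $H^2(\widehat{G_0},\mathbb{T})\neq1$, where $\widehat{G_0}$ denotes the Pontryagin dual of $G_0$ and $\mathbb{T}$ is the trivial $\widehat{G_0}$-module. Then $G$ is not quantum W$^*$-superrigid: there exists a Kac type compact quantum group $(B,\Delta)$ such that $B\cong L(G)$ as von Neumann algebras, but $(B,\Delta)\not\cong(L(G),\Delta_G)$ as compact quantum groups.
   Context: A compact quantum group is a pair $(A,\Delta)$ where $A$ is a von Neumann algebra and $\Delta:A\to A\overline{\otimes}A$ is a faithful normal unital $*$-homomorphism with $(\Delta\otimes\mathrm{id})\Delta=(\mathrm{id}\otimes\Delta)\Delta$, such that there is a faithful normal state $\varphi$ on $A$ with $(\mathrm{id}\otimes\varphi)\Delta(a)=\varphi(a)1=(\varphi\otimes\mathrm{id})\Delta(a)$ for all $a\in A$. The state $\varphi$ is unique (Haar state); $(A,\Delta)$ is of Kac type if $\varphi$ is a trace. An isomorphism $(A,\Delta_A)\cong(B,\Delta_B)$ is a $*$-isomorphism $\pi:A\to B$ with $\Delta_B\circ\pi=(\pi\otimes\pi)\circ\Delta_A$. For a discrete group $G$, $L(G)$ is its group von Neumann algebra and $\Delta_G(u_g)=u_g\otimes u_g$. The group $G$ is quantum W$^*$-superrigid if every compact quantum group $(B,\Delta_B)$ with $B\cong L(G)$ as von Neumann algebras satisfies $(B,\Delta_B)\cong(L(G),\Delta_G)$. Icc means that all nontrivial conjugacy classes are infinite. *)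

theory Defs
  imports "HOL-Analysis.Analysis" "HOL-Algebra.Coset"
begin

text \<open>
  Every complex Hilbert space has an orthonormal basis, so Hilbert spaces are taken in the form
  \<open>\<ell>\<^sup>2(I)\<close>, and the Hilbert space tensor product of \<open>\<ell>\<^sup>2(I)\<close> and \<open>\<ell>\<^sup>2(J)\<close> is \<open>\<ell>\<^sup>2(I \<times> J)\<close>.
  An operator is a function on all families \<open>'i \<Rightarrow> complex\<close>; it is required to
  vanish outside \<open>ell2\<close>, so that bounded operators are equal iff they are equal as functions.
\<close>

definition ell2 :: "('i \<Rightarrow> complex) set" where
  "ell2 = {x. (\<lambda>i. (cmod (x i))\<^sup>2) summable_on UNIV}"

definition ell2_norm :: "('i \<Rightarrow> complex) \<Rightarrow> real" where
  "ell2_norm x = sqrt (\<Sum>\<^sub>\<infinity>i. (cmod (x i))\<^sup>2)"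

definition ell2_inner :: "('i \<Rightarrow> complex) \<Rightarrow> ('i \<Rightarrow> complex) \<Rightarrow> complex" where
  "ell2_inner x y = (\<Sum>\<^sub>\<infinity>i. cnj (x i) * y i)"

type_synonym 'i oper = "('i \<Rightarrow> complex) \<Rightarrow> 'i \<Rightarrow> complex"

definition bounded_ops :: "'i oper set" where
  "bounded_ops = {T.
     (\<forall>x\<in>ell2. T x \<in> ell2) \<and>
     (\<forall>x. x \<notin> ell2 \<longrightarrow> T x = (\<lambda>_. 0)) \<and>
     (\<forall>x\<in>ell2. \<forall>y\<in>ell2. T (\<lambda>i. x i + y i) = (\<lambda>i. T x i + T y i)) \<and>
     (\<forall>c. \<forall>x\<in>ell2. T (\<lambda>i. c * x i) = (\<lambda>i. c * T x i)) \<and>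
     (\<exists>C. \<forall>x\<in>ell2. ell2_norm (T x) \<le> C * ell2_norm x)}"

definition op_add :: "'i oper \<Rightarrow> 'i oper \<Rightarrow> 'i oper" where
  "op_add S T = (\<lambda>x i. S x i + T x i)"

definition op_scale :: "complex \<Rightarrow> 'i oper \<Rightarrow> 'i oper" where
  "op_scale c T = (\<lambda>x i. c * T x i)"

definition op_adj :: "'i oper \<Rightarrow> 'i oper" where
  "op_adj T = (THE T'. T' \<in> bounded_ops \<and>
     (\<forall>x\<in>ell2. \<forall>y\<in>ell2. ell2_inner (T' x) y = ell2_inner x (T y)))"

text \<open>
  The elementary tensor \<open>a \<otimes> b\<close>: apply \<open>b\<close> in the second variable, then \<open>a\<close> in the first;
  on product vectors \<open>(a \<otimes> b) (x \<otimes> y) = a x \<otimes> b y\<close>.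
\<close>

definition op_tensor :: "'i oper \<Rightarrow> 'j oper \<Rightarrow> ('i \<times> 'j) oper" where
  "op_tensor a b = (\<lambda>z. if z \<in> ell2
     then (\<lambda>(i, j). a (\<lambda>i'. b (\<lambda>j'. z (i', j')) j) i) else (\<lambda>_. 0))"

text \<open>The canonical identification of operators on \<open>\<ell>\<^sup>2((I \<times> J) \<times> K)\<close> and \<open>\<ell>\<^sup>2(I \<times> (J \<times> K))\<close>.\<close>

definition op_assoc :: "(('i \<times> 'j) \<times> 'k) oper \<Rightarrow> ('i \<times> 'j \<times> 'k) oper" where
  "op_assoc T = (\<lambda>z (i, j, k). T (\<lambda>((i', j'), k'). z (i', j', k')) ((i, j), k))"

definition ultraweak_functionals :: "('i oper \<Rightarrow> complex) set" where
  "ultraweak_functionals = {(\<lambda>T. \<Sum>\<^sub>\<infinity>n. ell2_inner (x n) (T (y n))) | x y :: nat \<Rightarrow> 'i \<Rightarrow> complex.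
     range x \<subseteq> ell2 \<and> range y \<subseteq> ell2 \<and>
     (\<lambda>n. (ell2_norm (x n))\<^sup>2) summable_on UNIV \<and> (\<lambda>n. (ell2_norm (y n))\<^sup>2) summable_on UNIV}"

definition ultraweak :: "'i oper topology" where
  "ultraweak = topology_generated_by
     {{T \<in> bounded_ops. f T \<in> U} | f U. f \<in> ultraweak_functionals \<and> open U}"

text \<open>
  The unit \<open>e\<close> of \<open>M\<close> need not be the identity of \<open>\<ell>\<^sup>2(I)\<close>: \<open>M\<close> is a (unital) von Neumann
  algebra on the closed subspace \<open>e \<ell>\<^sup>2(I)\<close>, extended by zero on the orthogonal complement. This
  allows \<open>\<ell>\<^sup>2\<close> of a subset of the index type, in particular of the carrier of a group.
\<close>

definition von_neumann_algebra :: "'i oper set \<Rightarrow> bool" where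
  "von_neumann_algebra M \<longleftrightarrow>
     M \<subseteq> bounded_ops \<and>
     (\<exists>e\<in>M. \<forall>a\<in>M. e \<circ> a = a \<and> a \<circ> e = a) \<and>
     (\<forall>a\<in>M. \<forall>b\<in>M. op_add a b \<in> M \<and> a \<circ> b \<in> M) \<and>
     (\<forall>c. \<forall>a\<in>M. op_scale c a \<in> M) \<and>
     (\<forall>a\<in>M. op_adj a \<in> M) \<and>
     closedin ultraweak M"

definition vn_unit :: "'i oper set \<Rightarrow> 'i oper" where
  "vn_unit M = (THE e. e \<in> M \<and> (\<forall>a\<in>M. e \<circ> a = a \<and> a \<circ> e = a))"

definition vn_generated :: "'i oper set \<Rightarrow> 'i oper set" where
  "vn_generated X = \<Inter>{M. von_neumann_algebra M \<and> X \<subseteq> M}"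

definition vn_tensor :: "'i oper set \<Rightarrow> 'j oper set \<Rightarrow> ('i \<times> 'j) oper set" where
  "vn_tensor M N = vn_generated {op_tensor a b | a b. a \<in> M \<and> b \<in> N}"

definition linear_map :: "'i oper set \<Rightarrow> 'j oper set \<Rightarrow> ('i oper \<Rightarrow> 'j oper) \<Rightarrow> bool" where
  "linear_map M N f \<longleftrightarrow> f \<in> M \<rightarrow> N \<and>
     (\<forall>a\<in>M. \<forall>b\<in>M. f (op_add a b) = op_add (f a) (f b)) \<and>
     (\<forall>c. \<forall>a\<in>M. f (op_scale c a) = op_scale c (f a))"

definition normal_map :: "'i oper set \<Rightarrow> 'j oper set \<Rightarrow> ('i oper \<Rightarrow> 'j oper) \<Rightarrow> bool" where
  "normal_map M N f \<longleftrightarrow>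
     continuous_map (subtopology ultraweak M) (subtopology ultraweak N) f"

definition star_hom :: "'i oper set \<Rightarrow> 'j oper set \<Rightarrow> ('i oper \<Rightarrow> 'j oper) \<Rightarrow> bool" where
  "star_hom M N f \<longleftrightarrow> linear_map M N f \<and>
     (\<forall>a\<in>M. \<forall>b\<in>M. f (a \<circ> b) = f a \<circ> f b) \<and>
     (\<forall>a\<in>M. f (op_adj a) = op_adj (f a))"

definition star_iso :: "'i oper set \<Rightarrow> 'j oper set \<Rightarrow> ('i oper \<Rightarrow> 'j oper) \<Rightarrow> bool" where
  "star_iso M N f \<longleftrightarrow> star_hom M N f \<and> bij_betw f M N"

definition vn_isomorphic :: "'i oper set \<Rightarrow> 'j oper set \<Rightarrow> bool" where
  "vn_isomorphic M N \<longleftrightarrow> (\<exists>f. star_iso M N f)"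

text \<open>
  \<open>is_map_tensor M1 M2 N1 N2 f g h\<close>: on \<open>vn_tensor M1 M2\<close>, \<open>h\<close> is the tensor product \<open>f \<otimes> g\<close> of
  \<open>f : M1 \<rightarrow> N1\<close> and \<open>g : M2 \<rightarrow> N2\<close>, i.e. the normal linear extension of
  \<open>a \<otimes> b \<mapsto> f a \<otimes> g b\<close>. It is unique because elementary tensors span an ultraweakly dense
  subspace, and it exists whenever \<open>f\<close> and \<open>g\<close> are normal \<open>*\<close>-homomorphisms (in particular
  \<open>*\<close>-isomorphisms, which are automatically normal).
\<close>

definition is_map_tensor ::
  "'i oper set \<Rightarrow> 'j oper set \<Rightarrow> 'k oper set \<Rightarrow> 'l oper set \<Rightarrow>
   ('i oper \<Rightarrow> 'k oper) \<Rightarrow> ('j oper \<Rightarrow> 'l oper) \<Rightarrow>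
   (('i \<times> 'j) oper \<Rightarrow> ('k \<times> 'l) oper) \<Rightarrow> bool" where
  "is_map_tensor M1 M2 N1 N2 f g h \<longleftrightarrow>
     linear_map (vn_tensor M1 M2) (vn_tensor N1 N2) h \<and>
     normal_map (vn_tensor M1 M2) (vn_tensor N1 N2) h \<and>
     (\<forall>a\<in>M1. \<forall>b\<in>M2. h (op_tensor a b) = op_tensor (f a) (g b))"

text \<open>The slice maps \<open>id \<otimes> \<phi>\<close> and \<open>\<phi> \<otimes> id\<close> on \<open>vn_tensor M M\<close>, characterised in the same way.\<close>

definition is_slice_right :: "'i oper set \<Rightarrow> ('i oper \<Rightarrow> complex) \<Rightarrow> (('i \<times> 'i) oper \<Rightarrow> 'i oper) \<Rightarrow> bool" where
  "is_slice_right M \<phi> h \<longleftrightarrow>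
     linear_map (vn_tensor M M) M h \<and> normal_map (vn_tensor M M) M h \<and>
     (\<forall>a\<in>M. \<forall>b\<in>M. h (op_tensor a b) = op_scale (\<phi> b) a)"

definition is_slice_left :: "'i oper set \<Rightarrow> ('i oper \<Rightarrow> complex) \<Rightarrow> (('i \<times> 'i) oper \<Rightarrow> 'i oper) \<Rightarrow> bool" where
  "is_slice_left M \<phi> h \<longleftrightarrow>
     linear_map (vn_tensor M M) M h \<and> normal_map (vn_tensor M M) M h \<and>
     (\<forall>a\<in>M. \<forall>b\<in>M. h (op_tensor a b) = op_scale (\<phi> a) b)"

definition faithful_normal_state :: "'i oper set \<Rightarrow> ('i oper \<Rightarrow> complex) \<Rightarrow> bool" where
  "faithful_normal_state M \<phi> \<longleftrightarrow>
     (\<forall>a\<in>M. \<forall>b\<in>M. \<phi> (op_add a b) = \<phi> a + \<phi> b) \<and>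
     (\<forall>c. \<forall>a\<in>M. \<phi> (op_scale c a) = c * \<phi> a) \<and>
     (\<forall>a\<in>M. \<phi> (op_adj a \<circ> a) \<in> \<real>\<^sub>\<ge>\<^sub>0) \<and>
     \<phi> (vn_unit M) = 1 \<and>
     (\<forall>a\<in>M. \<phi> (op_adj a \<circ> a) = 0 \<longrightarrow> a = (\<lambda>_ _. 0)) \<and>
     continuous_map (subtopology ultraweak M) euclidean \<phi>"

definition haar_state ::
  "'i oper set \<Rightarrow> ('i oper \<Rightarrow> ('i \<times> 'i) oper) \<Rightarrow> ('i oper \<Rightarrow> complex) \<Rightarrow> bool" where
  "haar_state M \<Delta> \<phi> \<longleftrightarrow> faithful_normal_state M \<phi> \<and>
     (\<exists>h. is_slice_right M \<phi> h \<and> (\<forall>a\<in>M. h (\<Delta> a) = op_scale (\<phi> a) (vn_unit M))) \<and>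
     (\<exists>h. is_slice_left M \<phi> h \<and> (\<forall>a\<in>M. h (\<Delta> a) = op_scale (\<phi> a) (vn_unit M)))"

definition coassociative :: "'i oper set \<Rightarrow> ('i oper \<Rightarrow> ('i \<times> 'i) oper) \<Rightarrow> bool" where
  "coassociative M \<Delta> \<longleftrightarrow>
     (\<exists>h h'. is_map_tensor M M (vn_tensor M M) M \<Delta> id h \<and>
             is_map_tensor M M M (vn_tensor M M) id \<Delta> h' \<and>
             (\<forall>a\<in>M. op_assoc (h (\<Delta> a)) = h' (\<Delta> a)))"

definition compact_quantum_group ::
  "'i oper set \<Rightarrow> ('i oper \<Rightarrow> ('i \<times> 'i) oper) \<Rightarrow> bool" where
  "compact_quantum_group M \<Delta> \<longleftrightarrow>
     von_neumann_algebra M \<and>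
     star_hom M (vn_tensor M M) \<Delta> \<and> normal_map M (vn_tensor M M) \<Delta> \<and> inj_on \<Delta> M \<and>
     \<Delta> (vn_unit M) = vn_unit (vn_tensor M M) \<and>
     coassociative M \<Delta> \<and>
     (\<exists>\<phi>. haar_state M \<Delta> \<phi>)"

definition kac_type :: "'i oper set \<Rightarrow> ('i oper \<Rightarrow> ('i \<times> 'i) oper) \<Rightarrow> bool" where
  "kac_type M \<Delta> \<longleftrightarrow> (\<exists>\<phi>. haar_state M \<Delta> \<phi> \<and> (\<forall>a\<in>M. \<forall>b\<in>M. \<phi> (a \<circ> b) = \<phi> (b \<circ> a)))"

definition cqg_isomorphic ::
  "'i oper set \<Rightarrow> ('i oper \<Rightarrow> ('i \<times> 'i) oper) \<Rightarrow>
   'j oper set \<Rightarrow> ('j oper \<Rightarrow> ('j \<times> 'j) oper) \<Rightarrow> bool" where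
  "cqg_isomorphic A \<Delta>A B \<Delta>B \<longleftrightarrow>
     (\<exists>\<pi> h. star_iso A B \<pi> \<and> is_map_tensor A A B B \<pi> \<pi> h \<and>
            (\<forall>a\<in>A. \<Delta>B (\<pi> a) = h (\<Delta>A a)))"

definition left_regular :: "('g, 'm) monoid_scheme \<Rightarrow> 'g \<Rightarrow> 'g oper" where
  "left_regular G g = (\<lambda>x. if x \<in> ell2
     then (\<lambda>k. if k \<in> carrier G then x (inv\<^bsub>G\<^esub> g \<otimes>\<^bsub>G\<^esub> k) else 0) else (\<lambda>_. 0))"

definition group_vn :: "('g, 'm) monoid_scheme \<Rightarrow> 'g oper set" where
  "group_vn G = vn_generated (left_regular G ` carrier G)"

definition group_comult :: "('g, 'm) monoid_scheme \<Rightarrow> 'g oper \<Rightarrow> ('g \<times> 'g) oper" where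
  "group_comult G = (THE D. D \<in> extensional (group_vn G) \<and>
     star_hom (group_vn G) (vn_tensor (group_vn G) (group_vn G)) D \<and>
     normal_map (group_vn G) (vn_tensor (group_vn G) (group_vn G)) D \<and>
     (\<forall>g\<in>carrier G. D (left_regular G g) = op_tensor (left_regular G g) (left_regular G g)))"

text \<open>
  Since \<open>B\<close> is isomorphic to \<open>L(G)\<close>, a quantum group structure on \<open>B\<close> transports to \<open>L(G)\<close>; so it
  is no restriction that \<open>B\<close> ranges over von Neumann algebras represented in \<open>\<ell>\<^sup>2('g)\<close>.
\<close>

definition quantum_Wstar_superrigid :: "('g, 'm) monoid_scheme \<Rightarrow> bool" where
  "quantum_Wstar_superrigid G \<longleftrightarrow>
     (\<forall>(B :: 'g oper set) \<Delta>. compact_quantum_group B \<Delta> \<and> vn_isomorphic B (group_vn G) \<longrightarrow>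
        cqg_isomorphic B \<Delta> (group_vn G) (group_comult G))"

definition icc :: "('g, 'm) monoid_scheme \<Rightarrow> bool" where
  "icc G \<longleftrightarrow> (\<forall>g\<in>carrier G - {\<one>\<^bsub>G\<^esub>}.
     infinite ((\<lambda>k. k \<otimes>\<^bsub>G\<^esub> g \<otimes>\<^bsub>G\<^esub> inv\<^bsub>G\<^esub> k) ` carrier G))"

definition circle_group :: "complex monoid" where
  "circle_group = \<lparr>carrier = {z. cmod z = 1}, mult = (*), one = 1\<rparr>"

text \<open>The dual of a discrete group: every homomorphism to the circle is continuous.\<close>

definition pontryagin_dual :: "('g, 'm) monoid_scheme \<Rightarrow> ('g \<Rightarrow> complex) monoid" where
  "pontryagin_dual G = \<lparr>carrier = hom G circle_group \<inter> extensional (carrier G),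
     mult = (\<lambda>\<xi> \<eta>. \<lambda>g\<in>carrier G. \<xi> g * \<eta> g), one = (\<lambda>g\<in>carrier G. 1)\<rparr>"

text \<open>Group cohomology in degree 2, with coefficients in the trivial module \<open>A\<close>.\<close>

definition two_cocycles ::
  "('g, 'm) monoid_scheme \<Rightarrow> ('a, 'n) monoid_scheme \<Rightarrow> ('g \<times> 'g \<Rightarrow> 'a) monoid" where
  "two_cocycles G A = \<lparr>
     carrier = {\<omega> \<in> carrier G \<times> carrier G \<rightarrow>\<^sub>E carrier A.
       \<forall>a\<in>carrier G. \<forall>b\<in>carrier G. \<forall>c\<in>carrier G.
         \<omega> (a, b) \<otimes>\<^bsub>A\<^esub> \<omega> (a \<otimes>\<^bsub>G\<^esub> b, c) = \<omega> (b, c) \<otimes>\<^bsub>A\<^esub> \<omega> (a, b \<otimes>\<^bsub>G\<^esub> c)},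
     mult = (\<lambda>\<omega> \<eta>. \<lambda>p\<in>carrier G \<times> carrier G. \<omega> p \<otimes>\<^bsub>A\<^esub> \<eta> p),
     one = (\<lambda>p\<in>carrier G \<times> carrier G. \<one>\<^bsub>A\<^esub>)\<rparr>"

definition two_coboundaries ::
  "('g, 'm) monoid_scheme \<Rightarrow> ('a, 'n) monoid_scheme \<Rightarrow> ('g \<times> 'g \<Rightarrow> 'a) set" where
  "two_coboundaries G A =
     {(\<lambda>(a, b)\<in>carrier G \<times> carrier G. f a \<otimes>\<^bsub>A\<^esub> f b \<otimes>\<^bsub>A\<^esub> inv\<^bsub>A\<^esub> f (a \<otimes>\<^bsub>G\<^esub> b)) | f.
        f \<in> carrier G \<rightarrow> carrier A}"

definition H2 ::
  "('g, 'm) monoid_scheme \<Rightarrow> ('a, 'n) monoid_scheme \<Rightarrow> ('g \<times> 'g \<Rightarrow> 'a) set monoid" where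
  "H2 G A = two_cocycles G A Mod two_coboundaries G A"

end

theory Submission
  imports Defs "HOL-Algebra.Multiplicative_Group"
begin

text \<open>
  A 2-cocycle \<open>\<omega>\<close> on the dual of \<open>G0\<close> becomes, through the minimal projections \<open>P \<xi>\<close> of \<open>L(G0)\<close>, a unitary
  \<open>\<Omega> = \<Sum> \<omega>(\<xi>, \<eta>) P \<xi> \<otimes> P \<eta>\<close>, and \<open>tw a = \<Omega> \<Delta>(a) \<Omega>*\<close> is again a coassociative comultiplication on \<open>L(G)\<close>.
  The canonical trace stays its Haar state, because \<open>\<Omega>\<close> commutes with \<open>u g \<otimes> u g\<close> for \<open>g \<in> G0\<close> and moves it
  only inside \<open>G0 g G0\<close> for other \<open>g\<close>. Were \<open>tw\<close> isomorphic to the cocommutative \<open>\<Delta>\<close>, it would be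
  flip-invariant, so \<open>\<Omega>\<^sub>2\<^sub>1* \<Omega>\<close> would commute with all \<open>u g \<otimes> u g\<close>; being supported on the finite set
  \<open>G0 \<times> G0\<close>, it would be a scalar by the icc condition. Then \<open>\<omega>\<close> is symmetric, and symmetric 2-cocycles of
  finite abelian groups with values in the circle are coboundaries.
\<close>

subsection \<open>Square-summable families\<close>

text \<open>The obstacle is that \<Delta>, its extensions \<Delta> \<otimes> id and id \<otimes>
  \<Delta>, the flip and the slices live on von Neumann tensor products, where a map is
  characterised only as a normal extension. All of them are therefore given by formulas on all
  bounded operators: amplification along an injection of index sets, or compression to a coordinate
  subspace. Such maps are normal, so identities between them on \<open>L(G)\<close> need only be
  checked on group elements. An abstract isomorphism \<pi> has no such formula; but \<Omega> is a
  finite sum, hence so is \<open>tw (u g)\<close>, and on finite sums of elementary tensors \<pi>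
  \<otimes> \<pi> is explicit and injective. Coassociativity comes from (\<Omega> \<otimes>
  1)(\<Delta> \<otimes> id)(\<Omega>) = (1 \<otimes> \<Omega>)(id \<otimes> \<Delta>)(\<Omega>).
  This is the cocycle identity of \<omega>, because \<Delta>(P \<mu>) is the sum of P \<xi>
  \<otimes> P \<eta> over \<xi>\<eta> = \<mu>: seen on the dual, \<Delta> is multiplication of
  characters.\<close>

definition delta :: "'i \<Rightarrow> 'i \<Rightarrow> complex" where
  "delta i = (\<lambda>j. of_bool (j = i))"

lemma delta_apply: "delta i j = of_bool (j = i)"
  by (simp add: delta_def)

lemma ell2_summable: "x \<in> ell2 \<Longrightarrow> (\<lambda>i. (cmod (x i))\<^sup>2) summable_on A"
  unfolding ell2_def by (metis mem_Collect_eq summable_on_subset_banach subset_UNIV)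

lemma ell2_zero [simp]: "(\<lambda>_. 0) \<in> ell2"
  by (simp add: ell2_def)

lemma ell2_norm_nonneg [simp]: "0 \<le> ell2_norm x"
  by (simp add: ell2_norm_def infsum_nonneg)

lemma ell2_norm_sq: "(ell2_norm x)\<^sup>2 = (\<Sum>\<^sub>\<infinity>i. (cmod (x i))\<^sup>2)"
  by (simp add: ell2_norm_def infsum_nonneg)

lemma ell2_norm_zero [simp]: "ell2_norm (\<lambda>_. 0) = 0"
  by (simp add: ell2_norm_def)

lemma ell2_dominated:
  assumes "y \<in> ell2" "\<And>i. cmod (x i) \<le> cmod (y i)"
  shows "x \<in> ell2"
  using assms unfolding ell2_def
  by (auto intro!: summable_on_comparison_test[where f="\<lambda>i. (cmod (y i))\<^sup>2"] power_mono)

text \<open>A uniform bound on finite partial sums yields membership and the norm estimate together.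
  This is the route to boundedness of adjoints, amplifications and translations.\<close>

lemma ell2_boundedI:
  assumes "0 \<le> C" and b: "\<And>F. finite F \<Longrightarrow> (\<Sum>i\<in>F. (cmod (x i))\<^sup>2) \<le> C\<^sup>2"
  shows "x \<in> ell2" "ell2_norm x \<le> C"
proof -
  have s: "(\<lambda>i. (cmod (x i))\<^sup>2) summable_on UNIV"
    by (rule nonneg_bdd_above_summable_on) (auto intro!: bdd_aboveI2[where M="C\<^sup>2"] b)
  then show "x \<in> ell2" by (simp add: ell2_def)
  have "(\<Sum>\<^sub>\<infinity>i. (cmod (x i))\<^sup>2) \<le> C\<^sup>2"
    by (rule infsum_le_finite_sums[OF s]) (use b in auto)
  then show "ell2_norm x \<le> C"
    unfolding ell2_norm_def using assms(1) real_le_lsqrt by auto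
qed

lemma ell2_sum_le: "x \<in> ell2 \<Longrightarrow> finite F \<Longrightarrow> (\<Sum>i\<in>F. (cmod (x i))\<^sup>2) \<le> (ell2_norm x)\<^sup>2"
  unfolding ell2_norm_sq by (rule finite_sum_le_infsum) (auto simp: ell2_summable)

lemma ell2_L2_set_le: "x \<in> ell2 \<Longrightarrow> finite F \<Longrightarrow> L2_set (\<lambda>i. cmod (x i)) F \<le> ell2_norm x"
  unfolding L2_set_def by (rule real_le_lsqrt) (auto simp: ell2_sum_le)

lemma ell2_coeff_le: "x \<in> ell2 \<Longrightarrow> cmod (x i) \<le> ell2_norm x"
  using ell2_L2_set_le[of x "{i}"] by (simp add: L2_set_def)

text \<open>Minkowski's inequality on finite index sets, passed to the limit.\<close>

lemma ell2_add_aux: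
  assumes "x \<in> ell2" "y \<in> ell2"
  shows "(\<lambda>i. x i + y i) \<in> ell2" "ell2_norm (\<lambda>i. x i + y i) \<le> ell2_norm x + ell2_norm y"
proof -
  have "(\<Sum>i\<in>F. (cmod (x i + y i))\<^sup>2) \<le> (ell2_norm x + ell2_norm y)\<^sup>2" if "finite F" for F
  proof -
    have "L2_set (\<lambda>i. cmod (x i + y i)) F \<le> L2_set (\<lambda>i. cmod (x i) + cmod (y i)) F"
      by (rule L2_set_mono) (auto simp: norm_triangle_ineq)
    also have "\<dots> \<le> L2_set (\<lambda>i. cmod (x i)) F + L2_set (\<lambda>i. cmod (y i)) F"
      by (rule L2_set_triangle_ineq)
    also have "\<dots> \<le> ell2_norm x + ell2_norm y"
      using assms that by (intro add_mono ell2_L2_set_le)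
    finally have "L2_set (\<lambda>i. cmod (x i + y i)) F \<le> ell2_norm x + ell2_norm y" .
    then show ?thesis
      unfolding L2_set_def by (simp add: sqrt_le_D)
  qed
  from ell2_boundedI[OF _ this] 
  show "(\<lambda>i. x i + y i) \<in> ell2" "ell2_norm (\<lambda>i. x i + y i) \<le> ell2_norm x + ell2_norm y"
    by auto
qed

lemmas ell2_add = ell2_add_aux(1)
lemmas ell2_norm_triangle = ell2_add_aux(2)

lemma ell2_scale: "x \<in> ell2 \<Longrightarrow> (\<lambda>i. c * x i) \<in> ell2"
  by (simp add: ell2_def norm_mult power_mult_distrib summable_on_cmult_right)

lemma ell2_norm_scale: "ell2_norm (\<lambda>i. c * x i) = cmod c * ell2_norm x"
  by (simp add: ell2_norm_def norm_mult power_mult_distrib infsum_cmult_right' real_sqrt_mult)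

lemma ell2_finite_support: "finite A \<Longrightarrow> (\<And>i. i \<notin> A \<Longrightarrow> x i = 0) \<Longrightarrow> x \<in> ell2"
  unfolding ell2_def mem_Collect_eq
  by (rule finite_nonzero_values_imp_summable_on) (auto elim!: rev_finite_subset)

lemma delta_ell2 [simp]: "delta i \<in> ell2"
  by (rule ell2_finite_support[of "{i}"]) (auto simp: delta_def)

lemma ell2_sum: "finite A \<Longrightarrow> (\<And>a. a \<in> A \<Longrightarrow> x a \<in> ell2) \<Longrightarrow> (\<lambda>i. \<Sum>a\<in>A. x a i) \<in> ell2"
  by (induction A rule: finite_induct) (auto intro!: ell2_add)

section \<open>The inner product and the Cauchy-Schwarz inequality\<close>

lemma ell2_mult_abs_summable:
  assumes "x \<in> ell2" "y \<in> ell2"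
  shows "(\<lambda>i. cmod (x i) * cmod (y i)) summable_on A"
proof (rule summable_on_comparison_test)
  show "(\<lambda>i. (cmod (x i))\<^sup>2 + (cmod (y i))\<^sup>2) summable_on A"
    using assms by (intro summable_on_add ell2_summable)
  fix i
  have "2 * (cmod (x i) * cmod (y i)) \<le> (cmod (x i))\<^sup>2 + (cmod (y i))\<^sup>2"
    using sum_squares_bound[of "cmod (x i)" "cmod (y i)"] by (simp add: mult.assoc)
  moreover have "0 \<le> cmod (x i) * cmod (y i)" by simp
  ultimately show "cmod (x i) * cmod (y i) \<le> (cmod (x i))\<^sup>2 + (cmod (y i))\<^sup>2"
    by linarith
qed auto

lemma ell2_inner_summable:
  assumes "x \<in> ell2" "y \<in> ell2"
  shows "(\<lambda>i. cnj (x i) * y i) summable_on A"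
  by (rule abs_summable_summable) (use ell2_mult_abs_summable[OF assms] in \<open>simp add: norm_mult\<close>)

lemma ell2_inner_CS:
  assumes "x \<in> ell2" "y \<in> ell2"
  shows "cmod (ell2_inner x y) \<le> ell2_norm x * ell2_norm y"
proof -
  have s: "(\<lambda>i. cmod (x i) * cmod (y i)) summable_on UNIV"
    by (rule ell2_mult_abs_summable[OF assms])
  have "cmod (ell2_inner x y) \<le> (\<Sum>\<^sub>\<infinity>i. cmod (cnj (x i) * y i))"
    unfolding ell2_inner_def by (rule norm_infsum_bound) (use s in \<open>simp add: norm_mult\<close>)
  also have "\<dots> = (\<Sum>\<^sub>\<infinity>i. cmod (x i) * cmod (y i))" by (simp add: norm_mult)
  also have "\<dots> \<le> ell2_norm x * ell2_norm y"
  proof (rule infsum_le_finite_sums[OF s])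
    fix F :: "'a set" assume F: "finite F"
    have "(\<Sum>i\<in>F. cmod (x i) * cmod (y i)) = (\<Sum>i\<in>F. \<bar>cmod (x i)\<bar> * \<bar>cmod (y i)\<bar>)" by simp
    also have "\<dots> \<le> L2_set (\<lambda>i. cmod (x i)) F * L2_set (\<lambda>i. cmod (y i)) F"
      by (rule L2_set_mult_ineq)
    also have "\<dots> \<le> ell2_norm x * ell2_norm y"
      using F assms by (intro mult_mono ell2_L2_set_le) auto
    finally show "(\<Sum>i\<in>F. cmod (x i) * cmod (y i)) \<le> ell2_norm x * ell2_norm y" .
  qed
  finally show ?thesis .
qed

lemma ell2_inner_add_right:
  "x \<in> ell2 \<Longrightarrow> y \<in> ell2 \<Longrightarrow> z \<in> ell2 \<Longrightarrow>
   ell2_inner x (\<lambda>i. y i + z i) = ell2_inner x y + ell2_inner x z"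
  by (simp add: ell2_inner_def distrib_left infsum_add ell2_inner_summable)

lemma ell2_inner_scale_right: "ell2_inner x (\<lambda>i. c * y i) = c * ell2_inner x y"
proof -
  have "ell2_inner x (\<lambda>i. c * y i) = (\<Sum>\<^sub>\<infinity>i. c * (cnj (x i) * y i))"
    by (simp add: ell2_inner_def mult_ac)
  then show ?thesis by (simp add: ell2_inner_def infsum_cmult_right')
qed

lemma ell2_inner_commute: "cnj (ell2_inner x y) = ell2_inner y x"
  by (simp add: ell2_inner_def mult.commute flip: infsum_cnj)

lemma ell2_inner_zero [simp]: "ell2_inner (\<lambda>_. 0) x = 0" "ell2_inner x (\<lambda>_. 0) = 0"
  by (simp_all add: ell2_inner_def)

lemma ell2_inner_delta_left [simp]: "ell2_inner (delta i) x = x i"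
proof -
  have "ell2_inner (delta i) x = (\<Sum>\<^sub>\<infinity>j\<in>{i}. cnj (delta i j) * x j)"
    unfolding ell2_inner_def by (rule infsum_cong_neutral) (auto simp: delta_def)
  then show ?thesis by (simp add: delta_def)
qed

lemma ell2_inner_delta_right [simp]: "ell2_inner x (delta i) = cnj (x i)"
  by (metis ell2_inner_commute ell2_inner_delta_left)

lemma ell2_inner_self:
  assumes x: "x \<in> ell2"
  shows "ell2_inner x x = of_real ((ell2_norm x)\<^sup>2)"
proof -
  have "ell2_inner x x = (\<Sum>\<^sub>\<infinity>i. of_real ((cmod (x i))\<^sup>2))"
    by (simp add: ell2_inner_def complex_norm_square mult.commute del: of_real_power)
  also have "\<dots> = of_real (\<Sum>\<^sub>\<infinity>i. (cmod (x i))\<^sup>2)" using has_sum_of_real[OF has_sum_infsum[OF ell2_summable[OF x]]] by (rule infsumI)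
  finally show ?thesis by (simp add: ell2_norm_sq)
qed

text \<open>Split \<open>x\<close> into its restriction to a finite set and a tail: the error of the
  partial sum is \<open>f\<close> of the tail, whose norm tends to zero. Applied to matrix
  coefficients this recovers an operator from its values on the basis \<open>delta\<close>.\<close>

lemma ell2_functional_has_sum:
  fixes f :: "('i \<Rightarrow> complex) \<Rightarrow> complex"
  assumes add: "\<And>x y. x \<in> ell2 \<Longrightarrow> y \<in> ell2 \<Longrightarrow> f (\<lambda>i. x i + y i) = f x + f y"
    and scale: "\<And>c x. x \<in> ell2 \<Longrightarrow> f (\<lambda>i. c * x i) = c * f x"
    and bound: "\<And>x. x \<in> ell2 \<Longrightarrow> cmod (f x) \<le> C * ell2_norm x"
    and x: "x \<in> ell2"
  shows "((\<lambda>j. x j * f (delta j)) has_sum f x) UNIV"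
proof -
  define cut where "cut F = (\<lambda>i. if i \<in> F then x i else 0)" for F
  have cut: "cut F \<in> ell2" for F
    by (rule ell2_dominated[OF x]) (simp add: cut_def)
  have fsum: "(\<Sum>j\<in>F. x j * f (delta j)) = f (cut F)" if "finite F" for F
    using that
  proof (induction F rule: finite_induct)
    case empty
    then show ?case using scale[OF ell2_zero, of 0] by (simp add: cut_def)
  next
    case (insert a F)
    have "cut (insert a F) = (\<lambda>i. x a * delta a i + cut F i)"
      using insert by (auto simp: cut_def delta_def)
    then have "f (cut (insert a F)) = x a * f (delta a) + f (cut F)"
      by (simp add: add scale cut ell2_scale)
    with insert show ?case by simp
  qed
  have rest: "f x = f (cut F) + f (cut (-F))" for F
  proof -
    have "x = (\<lambda>i. cut F i + cut (-F) i)" by (auto simp: cut_def)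
    then show ?thesis by (metis add cut)
  qed
  have nrm: "ell2_norm (cut (-F)) = sqrt ((ell2_norm x)\<^sup>2 - (\<Sum>i\<in>F. (cmod (x i))\<^sup>2))" if "finite F" for F
  proof -
    have "(\<Sum>\<^sub>\<infinity>i. (cmod (cut (-F) i))\<^sup>2) = (\<Sum>\<^sub>\<infinity>i\<in>-F. (cmod (x i))\<^sup>2)"
      by (rule infsum_cong_neutral) (auto simp: cut_def)
    also have "\<dots> = (\<Sum>\<^sub>\<infinity>i\<in>UNIV - F. (cmod (x i))\<^sup>2)" by (simp add: Compl_eq_Diff_UNIV)
    also have "\<dots> = (ell2_norm x)\<^sup>2 - (\<Sum>i\<in>F. (cmod (x i))\<^sup>2)"
      unfolding ell2_norm_sq using that
      by (subst infsum_Diff) (auto simp: ell2_summable x)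
    finally show ?thesis by (simp add: ell2_norm_def)
  qed
  have "((\<lambda>F. f x - (\<Sum>j\<in>F. x j * f (delta j))) \<longlongrightarrow> 0) (finite_subsets_at_top UNIV)"
  proof (rule Lim_null_comparison)
    show "\<forall>\<^sub>F F in finite_subsets_at_top UNIV. norm (f x - (\<Sum>j\<in>F. x j * f (delta j)))
            \<le> C * sqrt ((ell2_norm x)\<^sup>2 - (\<Sum>i\<in>F. (cmod (x i))\<^sup>2))"
    proof (rule eventually_finite_subsets_at_top_weakI)
      fix F :: "'i set" assume F: "finite F"
      have "f x - (\<Sum>j\<in>F. x j * f (delta j)) = f (cut (-F))"
        using rest[of F] fsum[OF F] by simp
      then show "norm (f x - (\<Sum>j\<in>F. x j * f (delta j)))
            \<le> C * sqrt ((ell2_norm x)\<^sup>2 - (\<Sum>i\<in>F. (cmod (x i))\<^sup>2))"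
        using bound[OF cut, of "-F"] nrm[OF F] by simp
    qed
    have "((\<lambda>F. \<Sum>i\<in>F. (cmod (x i))\<^sup>2) \<longlongrightarrow> (ell2_norm x)\<^sup>2) (finite_subsets_at_top UNIV)"
      unfolding ell2_norm_sq by (rule infsum_tendsto) (simp add: ell2_summable x)
    then have "((\<lambda>F. C * sqrt ((ell2_norm x)\<^sup>2 - (\<Sum>i\<in>F. (cmod (x i))\<^sup>2)))
            \<longlongrightarrow> C * sqrt ((ell2_norm x)\<^sup>2 - (ell2_norm x)\<^sup>2)) (finite_subsets_at_top UNIV)"
      by (intro tendsto_intros)
    then show "((\<lambda>F. C * sqrt ((ell2_norm x)\<^sup>2 - (\<Sum>i\<in>F. (cmod (x i))\<^sup>2)))
            \<longlongrightarrow> 0) (finite_subsets_at_top UNIV)" by simp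
  qed
  from tendsto_diff[OF tendsto_const[of "f x"] this] show ?thesis
    unfolding has_sum_def by simp
qed

subsection \<open>Bounded operators and adjoints\<close>

lemma bounded_opsI':
  assumes "\<And>x. x \<notin> ell2 \<Longrightarrow> T x = (\<lambda>_. 0)"
    and "\<And>x y. x \<in> ell2 \<Longrightarrow> y \<in> ell2 \<Longrightarrow> T (\<lambda>i. x i + y i) = (\<lambda>i. T x i + T y i)"
    and "\<And>c x. x \<in> ell2 \<Longrightarrow> T (\<lambda>i. c * x i) = (\<lambda>i. c * T x i)"
    and "\<And>x. x \<in> ell2 \<Longrightarrow> T x \<in> ell2"
    and "\<And>x. x \<in> ell2 \<Longrightarrow> ell2_norm (T x) \<le> C * ell2_norm x"
  shows "T \<in> bounded_ops"
  using assms unfolding bounded_ops_def by blast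

lemma bounded_opsI:
  assumes "\<And>x. x \<notin> ell2 \<Longrightarrow> T x = (\<lambda>_. 0)"
    and "\<And>x y. x \<in> ell2 \<Longrightarrow> y \<in> ell2 \<Longrightarrow> T (\<lambda>i. x i + y i) = (\<lambda>i. T x i + T y i)"
    and "\<And>c x. x \<in> ell2 \<Longrightarrow> T (\<lambda>i. c * x i) = (\<lambda>i. c * T x i)"
    and "0 \<le> C"
    and "\<And>x F. x \<in> ell2 \<Longrightarrow> finite F \<Longrightarrow> (\<Sum>i\<in>F. (cmod (T x i))\<^sup>2) \<le> (C * ell2_norm x)\<^sup>2"
  shows "T \<in> bounded_ops"
proof -
  have "T x \<in> ell2" "ell2_norm (T x) \<le> C * ell2_norm x" if "x \<in> ell2" for x
    using ell2_boundedI[of "C * ell2_norm x" "T x"] assms(4,5) that by auto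
  with assms(1-3) show ?thesis by (intro bounded_opsI'[where C=C])
qed

lemma bops_ell2: "T \<in> bounded_ops \<Longrightarrow> T x \<in> ell2"
  unfolding bounded_ops_def by (cases "x \<in> ell2") auto

lemma bops_out: "T \<in> bounded_ops \<Longrightarrow> x \<notin> ell2 \<Longrightarrow> T x = (\<lambda>_. 0)"
  unfolding bounded_ops_def by auto

lemma bops_add: "T \<in> bounded_ops \<Longrightarrow> x \<in> ell2 \<Longrightarrow> y \<in> ell2 \<Longrightarrow> T (\<lambda>i. x i + y i) = (\<lambda>i. T x i + T y i)"
  unfolding bounded_ops_def by auto

lemma bops_scale: "T \<in> bounded_ops \<Longrightarrow> x \<in> ell2 \<Longrightarrow> T (\<lambda>i. c * x i) = (\<lambda>i. c * T x i)"
  unfolding bounded_ops_def by auto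

lemma bops_zero: "T \<in> bounded_ops \<Longrightarrow> T (\<lambda>_. 0) = (\<lambda>_. 0)"
  using bops_scale[of T "\<lambda>_. 0" 0] by (simp del: ell2_zero) (simp)

lemma bops_sum:
  assumes "T \<in> bounded_ops" "finite A" "\<And>a. a \<in> A \<Longrightarrow> x a \<in> ell2"
  shows "T (\<lambda>i. \<Sum>a\<in>A. c a * x a i) = (\<lambda>i. \<Sum>a\<in>A. c a * T (x a) i)"
  using assms(2,3)
proof (induction A rule: finite_induct)
  case (insert a A)
  have "(\<lambda>i. \<Sum>a\<in>A. c a * x a i) \<in> ell2"
    using insert by (intro ell2_sum ell2_scale) auto
  with insert show ?case
    by (simp add: bops_add[OF assms(1)] bops_scale[OF assms(1)] ell2_scale)
qed (simp add: bops_zero[OF assms(1)])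

lemma bops_bound:
  assumes "T \<in> bounded_ops"
  obtains C where "0 \<le> C" "\<And>x. x \<in> ell2 \<Longrightarrow> ell2_norm (T x) \<le> C * ell2_norm x"
proof -
  obtain C where C: "\<And>x. x \<in> ell2 \<Longrightarrow> ell2_norm (T x) \<le> C * ell2_norm x"
    using assms unfolding bounded_ops_def by blast
  have "ell2_norm (T x) \<le> \<bar>C\<bar> * ell2_norm x" if "x \<in> ell2" for x
    by (rule order_trans[OF C[OF that] mult_right_mono]) auto
  then show thesis using that[of "\<bar>C\<bar>"] by auto
qed

lemma bops_inner_has_sum:
  assumes T: "T \<in> bounded_ops" and x: "x \<in> ell2" and y: "y \<in> ell2"
  shows "((\<lambda>j. x j * ell2_inner y (T (delta j))) has_sum ell2_inner y (T x)) UNIV"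
proof -
  obtain C where C: "0 \<le> C" "\<And>x. x \<in> ell2 \<Longrightarrow> ell2_norm (T x) \<le> C * ell2_norm x"
    using bops_bound[OF T] by blast
  show ?thesis
  proof (rule ell2_functional_has_sum[where C="ell2_norm y * C"])
    fix x :: "'a \<Rightarrow> complex" assume x: "x \<in> ell2"
    have "cmod (ell2_inner y (T x)) \<le> ell2_norm y * ell2_norm (T x)"
      by (intro ell2_inner_CS y bops_ell2[OF T])
    also have "\<dots> \<le> ell2_norm y * (C * ell2_norm x)"
      by (intro mult_left_mono C x) auto
    finally show "cmod (ell2_inner y (T x)) \<le> ell2_norm y * C * ell2_norm x"
      by (simp add: mult.assoc)
  qed (simp_all add: x y bops_add[OF T] bops_scale[OF T] bops_ell2[OF T] ell2_inner_add_right ell2_inner_scale_right)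
qed

lemma bops_has_sum:
  assumes "T \<in> bounded_ops" "x \<in> ell2"
  shows "((\<lambda>j. x j * T (delta j) i) has_sum T x i) UNIV"
  using bops_inner_has_sum[OF assms, of "delta i"] by simp

text \<open>The basis expansion determines both operators on \<open>ell2\<close>, and outside
  \<open>ell2\<close> both vanish by convention. Operator identities thereby reduce to matrix
  entries.\<close>

lemma bops_eqI:
  assumes "S \<in> bounded_ops" "T \<in> bounded_ops" "\<And>i j. S (delta j) i = T (delta j) i"
  shows "S = T"
proof (intro ext)
  fix x i
  show "S x i = T x i"
  proof (cases "x \<in> ell2")
    case True
    have "((\<lambda>j. x j * S (delta j) i) has_sum S x i) UNIV"
      by (rule bops_has_sum[OF assms(1) True])
    moreover have "((\<lambda>j. x j * S (delta j) i) has_sum T x i) UNIV"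
      unfolding assms(3) by (rule bops_has_sum[OF assms(2) True])
    ultimately show ?thesis by (rule has_sum_unique)
  qed (use assms in \<open>auto simp: bops_out\<close>)
qed

lemma bops_add_op:
  assumes S: "S \<in> bounded_ops" and T: "T \<in> bounded_ops" shows "op_add S T \<in> bounded_ops"
proof -
  obtain C where C: "\<And>x. x \<in> ell2 \<Longrightarrow> ell2_norm (S x) \<le> C * ell2_norm x"
    using bops_bound[OF S] by blast
  obtain D where D: "\<And>x. x \<in> ell2 \<Longrightarrow> ell2_norm (T x) \<le> D * ell2_norm x"
    using bops_bound[OF T] by blast
  have *: "ell2_norm (\<lambda>i. S x i + T x i) \<le> (C + D) * ell2_norm x" if "x \<in> ell2" for x
    using ell2_norm_triangle[of "S x" "T x"] C[OF that] D[OF that]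
    by (simp add: distrib_right bops_ell2[OF S] bops_ell2[OF T])
  show ?thesis
    by (rule bounded_opsI'[where C="C + D"])
      (use S T * in \<open>simp_all add: op_add_def bops_out[OF S] bops_out[OF T] bops_add[OF S] bops_add[OF T] bops_scale[OF S] bops_scale[OF T] bops_ell2[OF S] bops_ell2[OF T] ell2_add algebra_simps\<close>)
qed

lemma bops_scale_op:
  assumes T: "T \<in> bounded_ops" shows "op_scale c T \<in> bounded_ops"
proof -
  obtain D where D: "\<And>x. x \<in> ell2 \<Longrightarrow> ell2_norm (T x) \<le> D * ell2_norm x"
    using bops_bound[OF T] by blast
  have *: "ell2_norm (\<lambda>i. c * T x i) \<le> (cmod c * D) * ell2_norm x" if "x \<in> ell2" for x
    using D[OF that] by (simp add: ell2_norm_scale mult_left_mono mult.assoc)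
  show ?thesis
    by (rule bounded_opsI'[where C="cmod c * D"])
      (use T * in \<open>simp_all add: op_scale_def bops_out[OF T] bops_add[OF T] bops_scale[OF T] bops_ell2[OF T] ell2_scale algebra_simps\<close>)
qed

lemma bops_comp:
  assumes S: "S \<in> bounded_ops" and T: "T \<in> bounded_ops" shows "S \<circ> T \<in> bounded_ops"
proof -
  obtain C where C: "0 \<le> C" "\<And>x. x \<in> ell2 \<Longrightarrow> ell2_norm (S x) \<le> C * ell2_norm x"
    using bops_bound[OF S] by blast
  obtain D where D: "\<And>x. x \<in> ell2 \<Longrightarrow> ell2_norm (T x) \<le> D * ell2_norm x"
    using bops_bound[OF T] by blast
  have *: "ell2_norm (S (T x)) \<le> (C * D) * ell2_norm x" if "x \<in> ell2" for x
    using C(2)[of "T x"] bops_ell2[OF T] mult_left_mono[OF D[OF that] C(1)] by (simp add: mult.assoc)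
  show ?thesis
    by (rule bounded_opsI'[where C="C * D"])
      (use S T * in \<open>simp_all add: bops_out[OF S] bops_out[OF T] bops_add[OF S] bops_add[OF T] bops_scale[OF S] bops_scale[OF T] bops_ell2[OF S] bops_ell2[OF T] bops_zero[OF S]\<close>)
qed

lemma bops_zero_op [simp]: "(\<lambda>_ _. 0) \<in> bounded_ops"
  by (rule bounded_opsI[where C=0]) auto

lemma op_add_apply: "op_add S T x i = S x i + T x i"
  by (simp add: op_add_def)

lemma op_scale_apply: "op_scale c T x i = c * T x i"
  by (simp add: op_scale_def)

text \<open>The \<open>i\<close>-th coordinate of the adjoint at \<open>x\<close> can only be the
  inner product of \<open>T (delta i)\<close> with \<open>x\<close>. For boundedness let
  \<open>v\<close> be the truncation of this family to a finite set: its squared norm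
  \<open>N\<close> equals the modulus of the inner product of \<open>T v\<close> with
  \<open>x\<close>, so it is at most \<open>C * ell2_norm v * ell2_norm x\<close>, and one factor
  \<open>ell2_norm v\<close> cancels.\<close>

lemma op_adj_exists:
  assumes T: "T \<in> bounded_ops"
  shows "\<exists>T'\<in>bounded_ops. \<forall>x\<in>ell2. \<forall>y\<in>ell2. ell2_inner (T' x) y = ell2_inner x (T y)"
proof -
  define T' where "T' x = (if x \<in> ell2 then (\<lambda>i. ell2_inner (T (delta i)) x) else (\<lambda>_. 0))" for x
  obtain C where C: "0 \<le> C" "\<And>x. x \<in> ell2 \<Longrightarrow> ell2_norm (T x) \<le> C * ell2_norm x"
    using bops_bound[OF T] by blast
  have "T' \<in> bounded_ops"
  proof (rule bounded_opsI[where C=C])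
    fix x :: "'a \<Rightarrow> complex" and F :: "'a set" assume x: "x \<in> ell2" and F: "finite F"
    define v where "v = (\<lambda>j. \<Sum>i\<in>F. T' x i * delta i j)"
    have v: "v \<in> ell2" unfolding v_def using F by (intro ell2_sum ell2_scale) auto
    have vi: "v j = (if j \<in> F then T' x j else 0)" for j
      using F by (simp add: v_def delta_def if_distrib[where f="\<lambda>z. _ * z"] of_bool_def eq_commute[of j] cong: if_cong)
    define N where "N = (\<Sum>i\<in>F. (cmod (T' x i))\<^sup>2)"
    have "(ell2_norm v)\<^sup>2 = (\<Sum>\<^sub>\<infinity>i\<in>F. (cmod (T' x i))\<^sup>2)"
      unfolding ell2_norm_sq by (rule infsum_cong_neutral) (auto simp: vi)
    then have nv: "(ell2_norm v)\<^sup>2 = N" using F by (simp add: N_def)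
    have "cnj (ell2_inner (T v) x) = ell2_inner x (T v)" by (simp add: ell2_inner_commute)
    also have "\<dots> = (\<Sum>i\<in>F. T' x i * ell2_inner x (T (delta i)))"
    proof -
      have "((\<lambda>j. v j * ell2_inner x (T (delta j))) has_sum ell2_inner x (T v)) UNIV"
        by (rule bops_inner_has_sum[OF T v x])
      moreover have "((\<lambda>j. v j * ell2_inner x (T (delta j))) has_sum (\<Sum>i\<in>F. T' x i * ell2_inner x (T (delta i)))) UNIV"
        by (rule has_sum_finite_neutralI[where B=F]) (auto simp: vi F intro!: sum.cong)
      ultimately show ?thesis by (rule has_sum_unique)
    qed
    also have "\<dots> = (\<Sum>i\<in>F. of_real ((cmod (T' x i))\<^sup>2))"
      by (intro sum.cong refl)
        (simp add: T'_def x complex_norm_square ell2_inner_commute[symmetric, of _ x] del: of_real_power)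
    also have "\<dots> = of_real N" by (simp add: N_def)
    finally have "cmod (ell2_inner (T v) x) = N"
      by (metis complex_mod_cnj norm_of_real abs_of_nonneg nv zero_le_power2)
    then have "N \<le> ell2_norm (T v) * ell2_norm x"
      using ell2_inner_CS[OF bops_ell2[OF T] x, of v] by simp
    also have "\<dots> \<le> C * ell2_norm v * ell2_norm x"
      using C(2)[OF v] by (intro mult_right_mono) auto
    finally have *: "ell2_norm v * ell2_norm v \<le> (C * ell2_norm x) * ell2_norm v"
      unfolding nv[symmetric] by (simp add: power2_eq_square mult_ac)
    then have "ell2_norm v \<le> C * ell2_norm x"
    proof (cases "ell2_norm v = 0")
      case False
      then have "0 < ell2_norm v" using ell2_norm_nonneg[of v] by linarith
      then show ?thesis using * by simp
    qed (use C(1) in simp)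
    then have "N \<le> (C * ell2_norm x)\<^sup>2"
      unfolding nv[symmetric] by (rule power_mono) simp
    then show "(\<Sum>i\<in>F. (cmod (T' x i))\<^sup>2) \<le> (C * ell2_norm x)\<^sup>2" by (simp add: N_def)
  qed (use C(1) in \<open>simp_all add: T'_def ell2_add ell2_scale ell2_inner_add_right ell2_inner_scale_right bops_ell2[OF T]\<close>)
  moreover have "ell2_inner (T' x) y = ell2_inner x (T y)" if "x \<in> ell2" "y \<in> ell2" for x y
  proof -
    have "ell2_inner (T' x) y = (\<Sum>\<^sub>\<infinity>j. y j * ell2_inner x (T (delta j)))"
      unfolding ell2_inner_def[of "T' x"] using that
      by (simp add: T'_def ell2_inner_commute mult.commute)
    also have "\<dots> = ell2_inner x (T y)"
      by (rule infsumI[OF bops_inner_has_sum[OF T that(2,1)]])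
    finally show ?thesis .
  qed
  ultimately show ?thesis by blast
qed

lemma op_adj_unique:
  assumes "T' \<in> bounded_ops" "\<And>x y. x \<in> ell2 \<Longrightarrow> y \<in> ell2 \<Longrightarrow> ell2_inner (T' x) y = ell2_inner x (T y)"
  shows "op_adj T = T'"
  unfolding op_adj_def
proof (rule the_equality)
  fix S assume S: "S \<in> bounded_ops \<and> (\<forall>x\<in>ell2. \<forall>y\<in>ell2. ell2_inner (S x) y = ell2_inner x (T y))"
  show "S = T'"
  proof (rule bops_eqI)
    fix i j
    have "ell2_inner (S (delta j)) (delta i) = ell2_inner (T' (delta j)) (delta i)"
      using S assms(2) delta_ell2 by metis
    then show "S (delta j) i = T' (delta j) i" by simp
  qed (use S assms in auto)
qed (use assms in auto)

lemma op_adj_bops [simp]: "T \<in> bounded_ops \<Longrightarrow> op_adj T \<in> bounded_ops"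
  and op_adj_inner: "T \<in> bounded_ops \<Longrightarrow> x \<in> ell2 \<Longrightarrow> y \<in> ell2 \<Longrightarrow>
    ell2_inner (op_adj T x) y = ell2_inner x (T y)"
  using op_adj_exists[of T] op_adj_unique[of _ T] by metis+

lemma op_adj_inner':
  "T \<in> bounded_ops \<Longrightarrow> x \<in> ell2 \<Longrightarrow> y \<in> ell2 \<Longrightarrow> ell2_inner x (op_adj T y) = ell2_inner (T x) y"
  by (metis ell2_inner_commute op_adj_inner)

lemma op_adj_matrix: "T \<in> bounded_ops \<Longrightarrow> op_adj T (delta j) i = cnj (T (delta i) j)"
  using op_adj_inner'[of T "delta i" "delta j"] by simp

lemma op_adj_eqI:
  assumes "S \<in> bounded_ops" "T \<in> bounded_ops" "\<And>i j. S (delta j) i = cnj (T (delta i) j)"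
  shows "op_adj T = S"
  by (rule bops_eqI) (use assms in \<open>auto simp: op_adj_matrix\<close>)

lemma op_adj_adj: "T \<in> bounded_ops \<Longrightarrow> op_adj (op_adj T) = T"
  by (rule op_adj_eqI) (auto simp: op_adj_matrix)

lemma op_adj_comp:
  assumes "S \<in> bounded_ops" "T \<in> bounded_ops"
  shows "op_adj (S \<circ> T) = op_adj T \<circ> op_adj S"
  by (rule op_adj_unique)
    (simp_all add: bops_comp assms op_adj_inner[OF assms(1)] op_adj_inner[OF assms(2)] bops_ell2[OF assms(2)] bops_ell2[OF op_adj_bops[OF assms(1)]])

lemma op_adj_add:
  "S \<in> bounded_ops \<Longrightarrow> T \<in> bounded_ops \<Longrightarrow> op_adj (op_add S T) = op_add (op_adj S) (op_adj T)"
  by (rule op_adj_eqI) (auto simp: bops_add_op op_adj_matrix op_add_apply)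

lemma op_adj_scale: "T \<in> bounded_ops \<Longrightarrow> op_adj (op_scale c T) = op_scale (cnj c) (op_adj T)"
  by (rule op_adj_eqI) (auto simp: bops_scale_op op_adj_matrix op_scale_apply)

lemma comp_op_add_left: "op_add S T \<circ> R = op_add (S \<circ> R) (T \<circ> R)"
  by (simp add: op_add_def fun_eq_iff)

lemma comp_op_scale_left: "op_scale c S \<circ> R = op_scale c (S \<circ> R)"
  by (simp add: op_scale_def fun_eq_iff)

lemma comp_op_add_right:
  assumes R: "R \<in> bounded_ops" and S: "S \<in> bounded_ops" and T: "T \<in> bounded_ops"
  shows "R \<circ> op_add S T = op_add (R \<circ> S) (R \<circ> T)"
  by (simp add: op_add_def fun_eq_iff bops_add[OF R] bops_ell2[OF S] bops_ell2[OF T])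

lemma comp_op_scale_right:
  assumes R: "R \<in> bounded_ops" and S: "S \<in> bounded_ops"
  shows "R \<circ> op_scale c S = op_scale c (R \<circ> S)"
  by (simp add: op_scale_def fun_eq_iff bops_scale[OF R] bops_ell2[OF S])

subsection \<open>Amplification and compression along an injection of index sets\<close>

lemma ell2_reindex:
  assumes "inj \<tau>" "z \<in> ell2"
  shows "(\<lambda>i. z (\<tau> i)) \<in> ell2" "ell2_norm (\<lambda>i. z (\<tau> i)) \<le> ell2_norm z"
proof -
  have "(\<Sum>i\<in>F. (cmod (z (\<tau> i)))\<^sup>2) \<le> (ell2_norm z)\<^sup>2" if "finite F" for F
  proof -
    have "(\<Sum>i\<in>F. (cmod (z (\<tau> i)))\<^sup>2) = (\<Sum>l\<in>\<tau> ` F. (cmod (z l))\<^sup>2)"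
      by (subst sum.reindex) (use assms(1) in \<open>auto simp: inj_on_def\<close>)
    also have "\<dots> \<le> (ell2_norm z)\<^sup>2" by (rule ell2_sum_le) (use assms(2) that in auto)
    finally show ?thesis .
  qed
  from ell2_boundedI[OF _ this] 
  show "(\<lambda>i. z (\<tau> i)) \<in> ell2" "ell2_norm (\<lambda>i. z (\<tau> i)) \<le> ell2_norm z" by auto
qed

lemma amp_slice_inj: "inj_on \<sigma> (S \<times> UNIV) \<Longrightarrow> s \<in> S \<Longrightarrow> inj (\<lambda>i. \<sigma> (s, i))"
  by (auto simp: inj_on_def)

lemma ell2_slice:
  "inj_on \<sigma> (S \<times> UNIV) \<Longrightarrow> s \<in> S \<Longrightarrow> z \<in> ell2 \<Longrightarrow> (\<lambda>i. z (\<sigma> (s, i))) \<in> ell2"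
  using ell2_reindex(1)[OF amp_slice_inj] by fast

text \<open>The slices of \<open>z\<close> sit on disjoint parts of the index set, so this is
  Bessel's inequality; it may be strict when \<sigma> misses part of the index set.\<close>

lemma ell2_slices:
  assumes inj: "inj_on \<sigma> (S \<times> UNIV)" and z: "z \<in> ell2"
  shows "(\<lambda>s. (ell2_norm (\<lambda>i. z (\<sigma> (s, i))))\<^sup>2) summable_on S"
    and "(\<Sum>\<^sub>\<infinity>s\<in>S. (ell2_norm (\<lambda>i. z (\<sigma> (s, i))))\<^sup>2) \<le> (ell2_norm z)\<^sup>2"
proof -
  have "(\<lambda>l. (cmod (z l))\<^sup>2) summable_on \<sigma> ` (S \<times> UNIV)"
    by (rule ell2_summable[OF z])
  then have s: "(\<lambda>(s, i). (cmod (z (\<sigma> (s, i))))\<^sup>2) summable_on S \<times> UNIV"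
    unfolding summable_on_reindex[OF inj] by (simp add: o_def case_prod_unfold)
  show "(\<lambda>s. (ell2_norm (\<lambda>i. z (\<sigma> (s, i))))\<^sup>2) summable_on S"
    unfolding ell2_norm_sq by (rule summable_on_Sigma_banach[OF s])
  have "(\<Sum>\<^sub>\<infinity>s\<in>S. (ell2_norm (\<lambda>i. z (\<sigma> (s, i))))\<^sup>2)
      = infsum (\<lambda>(s, i). (cmod (z (\<sigma> (s, i))))\<^sup>2) (S \<times> UNIV)"
    unfolding ell2_norm_sq by (rule infsum_Sigma'_banach[OF s])
  also have "\<dots> = infsum (\<lambda>l. (cmod (z l))\<^sup>2) (\<sigma> ` (S \<times> UNIV))"
    unfolding infsum_reindex[OF inj] by (simp add: o_def case_prod_unfold)
  also have "\<dots> \<le> (ell2_norm z)\<^sup>2"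
    unfolding ell2_norm_sq by (rule infsum_mono2) (auto simp: ell2_summable z)
  finally show "(\<Sum>\<^sub>\<infinity>s\<in>S. (ell2_norm (\<lambda>i. z (\<sigma> (s, i))))\<^sup>2) \<le> (ell2_norm z)\<^sup>2" .
qed

text \<open>For \<sigma> injective on \<open>S \<times> UNIV\<close> this is 1 \<otimes> T on the
  square-summable families over \<open>S \<times> UNIV\<close>, carried along \<sigma> and extended
  by zero to the families supported off its image. Both legs of a tensor product, the flip,
  reassociation and \<Delta> are instances, so multiplicativity, compatibility with adjoints and
  normality are proved once for all of them.\<close>

definition amp :: "('s \<times> 'i \<Rightarrow> 'l) \<Rightarrow> 's set \<Rightarrow> 'i oper \<Rightarrow> 'l oper" where
  "amp \<sigma> S T z l = (if z \<in> ell2 \<and> l \<in> \<sigma> ` (S \<times> UNIV)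
     then (case inv_into (S \<times> UNIV) \<sigma> l of (s, i) \<Rightarrow> T (\<lambda>i'. z (\<sigma> (s, i'))) i) else 0)"

lemma amp_apply:
  "inj_on \<sigma> (S \<times> UNIV) \<Longrightarrow> s \<in> S \<Longrightarrow> z \<in> ell2 \<Longrightarrow>
    amp \<sigma> S T z (\<sigma> (s, i)) = T (\<lambda>i'. z (\<sigma> (s, i'))) i"
  by (auto simp: amp_def inv_into_f_f)

lemma amp_out: "l \<notin> \<sigma> ` (S \<times> UNIV) \<Longrightarrow> amp \<sigma> S T z l = 0"
  by (simp add: amp_def)

lemma amp_not_ell2: "z \<notin> ell2 \<Longrightarrow> amp \<sigma> S T z = (\<lambda>_. 0)"
  by (simp add: amp_def fun_eq_iff)

lemma amp_eqI:
  assumes "inj_on \<sigma> (S \<times> UNIV)" "z \<in> ell2"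
    and "\<And>s i. s \<in> S \<Longrightarrow> w (\<sigma> (s, i)) = T (\<lambda>i'. z (\<sigma> (s, i'))) i"
    and "\<And>l. l \<notin> \<sigma> ` (S \<times> UNIV) \<Longrightarrow> w l = 0"
  shows "amp \<sigma> S T z = w"
proof
  fix l
  show "amp \<sigma> S T z l = w l"
  proof (cases "l \<in> \<sigma> ` (S \<times> UNIV)")
    case True
    then obtain s i where "s \<in> S" "l = \<sigma> (s, i)" by auto
    then show ?thesis using assms by (simp add: amp_apply)
  qed (simp add: amp_out assms(4))
qed

lemma amp_bops [simp]:
  fixes \<sigma> :: "'s \<times> 'i \<Rightarrow> 'b"
  assumes inj: "inj_on \<sigma> (S \<times> UNIV)" and T: "T \<in> bounded_ops"
  shows "amp \<sigma> S T \<in> bounded_ops"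
proof -
  obtain C where C: "0 \<le> C" "\<And>x. x \<in> ell2 \<Longrightarrow> ell2_norm (T x) \<le> C * ell2_norm x"
    using bops_bound[OF T] by blast
  show ?thesis
  proof (rule bounded_opsI[where C=C])
    fix x y :: "'b \<Rightarrow> complex" assume x: "x \<in> ell2" and y: "y \<in> ell2"
    show "amp \<sigma> S T (\<lambda>i. x i + y i) = (\<lambda>i. amp \<sigma> S T x i + amp \<sigma> S T y i)"
      by (rule amp_eqI[OF inj])
        (simp_all add: x y ell2_add amp_apply[OF inj] amp_out bops_add[OF T] ell2_slice[OF inj])
  next
    fix c and x :: "'b \<Rightarrow> complex" assume x: "x \<in> ell2"
    show "amp \<sigma> S T (\<lambda>i. c * x i) = (\<lambda>i. c * amp \<sigma> S T x i)"
      by (rule amp_eqI[OF inj])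
        (simp_all add: x ell2_scale amp_apply[OF inj] amp_out bops_scale[OF T] ell2_slice[OF inj])
  next
    fix x :: "'b \<Rightarrow> complex" and F assume x: "x \<in> ell2" and F: "finite (F :: 'b set)"
    define D where "D = inv_into (S \<times> UNIV) \<sigma> ` (F \<inter> \<sigma> ` (S \<times> UNIV))"
    have D: "finite D" "D \<subseteq> S \<times> UNIV"
      using F inv_into_into[of _ \<sigma> "S \<times> UNIV"] unfolding D_def by (blast, blast)
    have FD: "F \<inter> \<sigma> ` (S \<times> UNIV) = \<sigma> ` D"
      unfolding D_def image_image by (force simp: f_inv_into_f)
    have D2: "D \<subseteq> fst ` D \<times> snd ` D" by force
    have "(\<Sum>l\<in>F. (cmod (amp \<sigma> S T x l))\<^sup>2) = (\<Sum>l\<in>\<sigma> ` D. (cmod (amp \<sigma> S T x l))\<^sup>2)"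
      unfolding FD[symmetric] by (rule sum.mono_neutral_right) (use F amp_out[of _ \<sigma> S T x] in auto)
    also have "\<dots> = (\<Sum>p\<in>D. (cmod (amp \<sigma> S T x (\<sigma> p)))\<^sup>2)"
      by (subst sum.reindex) (use inj D inj_on_subset in auto)
    also have "\<dots> = (\<Sum>(s,i)\<in>D. (cmod (T (\<lambda>i'. x (\<sigma> (s, i'))) i))\<^sup>2)"
      by (rule sum.cong) (use D x in \<open>auto simp: amp_apply[OF inj]\<close>)
    \<comment> \<open>Enlarging \<open>D\<close> to a product set only adds nonnegative terms and
      lets the sum be taken slice by slice.\<close>
    also have "\<dots> \<le> (\<Sum>(s,i)\<in>fst ` D \<times> snd ` D. (cmod (T (\<lambda>i'. x (\<sigma> (s, i'))) i))\<^sup>2)"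
      by (rule sum_mono2) (use D D2 in auto)
    also have "\<dots> = (\<Sum>s\<in>fst ` D. \<Sum>i\<in>snd ` D. (cmod (T (\<lambda>i'. x (\<sigma> (s, i'))) i))\<^sup>2)"
      by (simp add: sum.cartesian_product)
    also have "\<dots> \<le> (\<Sum>s\<in>fst ` D. C\<^sup>2 * (ell2_norm (\<lambda>i'. x (\<sigma> (s, i'))))\<^sup>2)"
    proof (rule sum_mono)
      fix s assume "s \<in> fst ` D"
      then have s: "s \<in> S" using D by auto
      have "(\<Sum>i\<in>snd ` D. (cmod (T (\<lambda>i'. x (\<sigma> (s, i'))) i))\<^sup>2) \<le> (ell2_norm (T (\<lambda>i'. x (\<sigma> (s, i')))))\<^sup>2"
        by (rule ell2_sum_le) (use D bops_ell2[OF T] in auto)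
      also have "\<dots> \<le> (C * ell2_norm (\<lambda>i'. x (\<sigma> (s, i'))))\<^sup>2"
        by (intro power_mono C ell2_slice[OF inj s x]) auto
      finally show "(\<Sum>i\<in>snd ` D. (cmod (T (\<lambda>i'. x (\<sigma> (s, i'))) i))\<^sup>2)
          \<le> C\<^sup>2 * (ell2_norm (\<lambda>i'. x (\<sigma> (s, i'))))\<^sup>2" by (simp add: power_mult_distrib)
    qed
    also have "\<dots> = C\<^sup>2 * (\<Sum>s\<in>fst ` D. (ell2_norm (\<lambda>i'. x (\<sigma> (s, i'))))\<^sup>2)"
      by (simp add: sum_distrib_left)
    also have "\<dots> \<le> C\<^sup>2 * (ell2_norm x)\<^sup>2"
    proof (rule mult_left_mono)
      have "(\<Sum>s\<in>fst ` D. (ell2_norm (\<lambda>i'. x (\<sigma> (s, i'))))\<^sup>2)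
          \<le> (\<Sum>\<^sub>\<infinity>s\<in>S. (ell2_norm (\<lambda>i. x (\<sigma> (s, i))))\<^sup>2)"
        by (rule finite_sum_le_infsum) (use D ell2_slices(1)[OF inj x] in auto)
      also have "\<dots> \<le> (ell2_norm x)\<^sup>2" by (rule ell2_slices(2)[OF inj x])
      finally show "(\<Sum>s\<in>fst ` D. (ell2_norm (\<lambda>i'. x (\<sigma> (s, i'))))\<^sup>2) \<le> (ell2_norm x)\<^sup>2" .
    qed simp
    finally show "(\<Sum>l\<in>F. (cmod (amp \<sigma> S T x l))\<^sup>2) \<le> (C * ell2_norm x)\<^sup>2"
      by (simp add: power_mult_distrib)
  qed (use C(1) in \<open>simp_all add: amp_not_ell2\<close>)
qed

lemma amp_comp:
  assumes inj: "inj_on \<sigma> (S \<times> UNIV)" and T: "T \<in> bounded_ops" and R: "R \<in> bounded_ops"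
  shows "amp \<sigma> S (R \<circ> T) = amp \<sigma> S R \<circ> amp \<sigma> S T"
proof (rule ext)
  fix z
  show "amp \<sigma> S (R \<circ> T) z = (amp \<sigma> S R \<circ> amp \<sigma> S T) z"
  proof (cases "z \<in> ell2")
    case z: True
    show ?thesis
      by (rule amp_eqI[OF inj z])
        (simp_all add: amp_apply[OF inj] bops_ell2[OF amp_bops[OF inj T]] z amp_out)
  next
    case False
    then show ?thesis using bops_zero[OF amp_bops[OF inj R]] by (simp add: amp_not_ell2)
  qed
qed

lemma amp_add:
  assumes "inj_on \<sigma> (S \<times> UNIV)"
  shows "amp \<sigma> S (op_add R T) = op_add (amp \<sigma> S R) (amp \<sigma> S T)"
  by (simp add: fun_eq_iff amp_def op_add_def case_prod_unfold)

lemma amp_scale: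
  assumes "inj_on \<sigma> (S \<times> UNIV)"
  shows "amp \<sigma> S (op_scale c T) = op_scale c (amp \<sigma> S T)"
  by (simp add: fun_eq_iff amp_def op_scale_def case_prod_unfold)

text \<open>The sum has at most one term, since \<sigma> is injective on the slice of
  \<open>s\<close>; it expresses the push-forward of \<open>T (delta i)\<close> along that slice
  without a case distinction.\<close>

lemma amp_delta:
  assumes inj: "inj_on \<sigma> (S \<times> UNIV)" and T: "T \<in> bounded_ops" and s: "s \<in> S"
  shows "amp \<sigma> S T (delta (\<sigma> (s, i))) = (\<lambda>l. \<Sum>j\<in>{j. l = \<sigma> (s, j)}. T (delta i) j)"
proof (rule amp_eqI[OF inj])
  fix s' j assume s': "s' \<in> S"
  have "(\<lambda>i'. delta (\<sigma> (s, i)) (\<sigma> (s', i'))) = (if s = s' then delta i else (\<lambda>_. 0))"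
    using inj s s' by (auto simp: delta_def inj_on_def fun_eq_iff)
  moreover have "{j'. \<sigma> (s', j) = \<sigma> (s, j')} = (if s = s' then {j} else {})"
    using inj s s' by (auto simp: inj_on_def)
  ultimately show "(\<Sum>j\<in>{j'. \<sigma> (s', j) = \<sigma> (s, j')}. T (delta i) j) =
         T (\<lambda>i'. delta (\<sigma> (s, i)) (\<sigma> (s', i'))) j"
    using bops_zero[OF T] by auto
next
  fix l assume l: "l \<notin> \<sigma> ` (S \<times> UNIV)"
  have "{j. l = \<sigma> (s, j)} = {}" using l s by auto
  then show "(\<Sum>j\<in>{j. l = \<sigma> (s, j)}. T (delta i) j) = 0" by simp
qed simp

lemma amp_delta_out:
  assumes inj: "inj_on \<sigma> (S \<times> UNIV)" and T: "T \<in> bounded_ops" and l: "l \<notin> \<sigma> ` (S \<times> UNIV)"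
  shows "amp \<sigma> S T (delta l) = (\<lambda>_. 0)"
proof (rule amp_eqI[OF inj])
  fix s i assume s: "s \<in> S"
  have "(\<lambda>i'. delta l (\<sigma> (s, i'))) = (\<lambda>_. 0)" using l s by (auto simp: delta_def fun_eq_iff)
  then show "0 = T (\<lambda>i'. delta l (\<sigma> (s, i'))) i" using bops_zero[OF T] by simp
qed auto

lemma amp_delta_apply:
  assumes inj: "inj_on \<sigma> (S \<times> UNIV)" and T: "T \<in> bounded_ops" and s: "s \<in> S" "s' \<in> S"
  shows "amp \<sigma> S T (delta (\<sigma> (s, i))) (\<sigma> (s', j)) = (if s = s' then T (delta i) j else 0)"
proof -
  have "{j'. \<sigma> (s', j) = \<sigma> (s, j')} = (if s = s' then {j} else {})"
    using inj s by (auto simp: inj_on_def)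
  then show ?thesis by (simp add: amp_delta[OF inj T s(1)])
qed

lemma amp_adj:
  assumes inj: "inj_on \<sigma> (S \<times> UNIV)" and T: "T \<in> bounded_ops"
  shows "amp \<sigma> S (op_adj T) = op_adj (amp \<sigma> S T)"
proof (rule op_adj_eqI[symmetric])
  fix l m
  have T': "op_adj T \<in> bounded_ops" using T by simp
  show "amp \<sigma> S (op_adj T) (delta m) l = cnj (amp \<sigma> S T (delta l) m)"
  proof (cases "l \<in> \<sigma> ` (S \<times> UNIV) \<and> m \<in> \<sigma> ` (S \<times> UNIV)")
    case True
    then obtain s i s' j where "s \<in> S" "s' \<in> S" "l = \<sigma> (s, i)" "m = \<sigma> (s', j)" by auto
    then show ?thesis
      by (simp add: amp_delta_apply[OF inj T] amp_delta_apply[OF inj T'] op_adj_matrix[OF T])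
  next
    case False
    then consider "l \<notin> \<sigma> ` (S \<times> UNIV)" | "m \<notin> \<sigma> ` (S \<times> UNIV)" by blast
    then show ?thesis
      by cases (simp_all add: amp_out amp_delta_out[OF inj T] amp_delta_out[OF inj T'])
  qed
qed (use assms in auto)

lemma amp_injective:
  assumes inj: "inj_on \<sigma> (S \<times> UNIV)" and T: "T \<in> bounded_ops" "R \<in> bounded_ops" and s: "S \<noteq> {}"
    and eq: "amp \<sigma> S T = amp \<sigma> S R"
  shows "T = R"
proof (rule bops_eqI[OF T])
  fix i j
  obtain s where s: "s \<in> S" using s by auto
  show "T (delta j) i = R (delta j) i"
    using amp_delta_apply[OF inj T(1) s s, of j i] amp_delta_apply[OF inj T(2) s s, of j i] eq
    by simp
qed

text \<open>This is what makes \<open>amp\<close> normal: a vector functional of the amplification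
  is a sum of vector functionals of \<open>T\<close>, one for each slice.\<close>

lemma amp_inner:
  assumes inj: "inj_on \<sigma> (S \<times> UNIV)" and T: "T \<in> bounded_ops" and x: "x \<in> ell2" and y: "y \<in> ell2"
  shows "ell2_inner x (amp \<sigma> S T y) =
    (\<Sum>\<^sub>\<infinity>s\<in>S. ell2_inner (\<lambda>i. x (\<sigma> (s, i))) (T (\<lambda>i. y (\<sigma> (s, i)))))"
proof -
  have "(\<lambda>l. cnj (x l) * amp \<sigma> S T y l) summable_on \<sigma> ` (S \<times> UNIV)"
    by (rule ell2_inner_summable[OF x bops_ell2[OF amp_bops[OF inj T]]])
  then have "(\<lambda>p. cnj (x (\<sigma> p)) * amp \<sigma> S T y (\<sigma> p)) summable_on (S \<times> UNIV)"
    unfolding summable_on_reindex[OF inj] by (simp add: o_def)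
  then have s: "(\<lambda>(s, i). cnj (x (\<sigma> (s, i))) * T (\<lambda>i. y (\<sigma> (s, i))) i) summable_on (S \<times> UNIV)"
    by (rule summable_on_cong[THEN iffD1, rotated]) (auto simp: amp_apply[OF inj] y)
  have "ell2_inner x (amp \<sigma> S T y) = infsum (\<lambda>l. cnj (x l) * amp \<sigma> S T y l) (\<sigma> ` (S \<times> UNIV))"
    unfolding ell2_inner_def by (rule infsum_cong_neutral) (auto simp: amp_out)
  also have "\<dots> = infsum (\<lambda>(s, i). cnj (x (\<sigma> (s, i))) * T (\<lambda>i. y (\<sigma> (s, i))) i) (S \<times> UNIV)"
    unfolding infsum_reindex[OF inj] by (rule infsum_cong) (auto simp: amp_apply[OF inj] y)
  also have "\<dots> = (\<Sum>\<^sub>\<infinity>s\<in>S. ell2_inner (\<lambda>i. x (\<sigma> (s, i))) (T (\<lambda>i. y (\<sigma> (s, i)))))"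
    unfolding ell2_inner_def by (rule infsum_Sigma'_banach[OF s, symmetric])
  finally show ?thesis .
qed

section \<open>Isometric inclusions and compressions\<close>

definition push :: "('i \<Rightarrow> 'l) \<Rightarrow> ('i \<Rightarrow> complex) \<Rightarrow> 'l \<Rightarrow> complex" where
  "push \<tau> x l = (if l \<in> range \<tau> then x (inv_into UNIV \<tau> l) else 0)"

lemma push_apply: "inj \<tau> \<Longrightarrow> push \<tau> x (\<tau> i) = x i"
  by (simp add: push_def)

lemma push_add: "push \<tau> (\<lambda>i. x i + y i) = (\<lambda>l. push \<tau> x l + push \<tau> y l)"
  by (simp add: push_def fun_eq_iff)

lemma push_scale: "push \<tau> (\<lambda>i. c * x i) = (\<lambda>l. c * push \<tau> x l)"
  by (simp add: push_def fun_eq_iff)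

lemma push_inner:
  assumes "inj \<tau>" shows "ell2_inner (push \<tau> x) z = ell2_inner x (\<lambda>i. z (\<tau> i))"
proof -
  have "ell2_inner (push \<tau> x) z = infsum (\<lambda>l. cnj (push \<tau> x l) * z l) (range \<tau>)"
    unfolding ell2_inner_def by (rule infsum_cong_neutral) (auto simp: push_def)
  then show ?thesis
    unfolding infsum_reindex[OF assms] by (simp add: ell2_inner_def o_def push_apply[OF assms])
qed

lemma push_ell2:
  assumes "inj \<tau>" and x: "x \<in> ell2"
  shows "push \<tau> x \<in> ell2" "ell2_norm (push \<tau> x) = ell2_norm x"
proof -
  have "(\<lambda>l. (cmod (push \<tau> x l))\<^sup>2) summable_on range \<tau>"
    unfolding summable_on_reindex[OF assms(1)] 
    using ell2_summable[OF x] by (simp add: o_def push_apply[OF assms(1)])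
  then show "push \<tau> x \<in> ell2" unfolding ell2_def mem_Collect_eq
    by (rule summable_on_cong_neutral[THEN iffD1, rotated -1]) (auto simp: push_def)
  have "(\<Sum>\<^sub>\<infinity>l. (cmod (push \<tau> x l))\<^sup>2) = infsum (\<lambda>l. (cmod (push \<tau> x l))\<^sup>2) (range \<tau>)"
    by (rule infsum_cong_neutral) (auto simp: push_def)
  then show "ell2_norm (push \<tau> x) = ell2_norm x"
    unfolding infsum_reindex[OF assms(1)] by (simp add: ell2_norm_def o_def push_apply[OF assms(1)])
qed

lemma push_delta: "inj \<tau> \<Longrightarrow> push \<tau> (delta i) = delta (\<tau> i)"
  by (auto simp: push_def delta_def fun_eq_iff)

text \<open>With \<open>V = push \<tau>\<close> the isometry sending \<open>delta i\<close> to
  \<open>delta (\<tau> i)\<close>, this is the compression of \<open>T\<close> by \<open>V\<close>,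
  that is, the adjoint of \<open>V\<close> after \<open>T\<close> after \<open>V\<close>. For \<tau>
  fixing one coordinate of a pair it becomes the slice by a vector functional, defined on all
  bounded operators.\<close>

definition compress :: "('i \<Rightarrow> 'l) \<Rightarrow> 'l oper \<Rightarrow> 'i oper" where
  "compress \<tau> T x i = (if x \<in> ell2 then T (push \<tau> x) (\<tau> i) else 0)"

lemma compress_ell2: "x \<in> ell2 \<Longrightarrow> compress \<tau> T x = (\<lambda>i. T (push \<tau> x) (\<tau> i))"
  by (simp add: compress_def fun_eq_iff)

lemma compress_bops [simp]:
  fixes \<tau> :: "'a \<Rightarrow> 'b"
  assumes inj: "inj \<tau>" and T: "T \<in> bounded_ops"
  shows "compress \<tau> T \<in> bounded_ops"
proof -
  obtain C where C: "0 \<le> C" "\<And>x. x \<in> ell2 \<Longrightarrow> ell2_norm (T x) \<le> C * ell2_norm x"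
    using bops_bound[OF T] by blast
  show ?thesis
  proof (rule bounded_opsI'[where C=C])
    fix x :: "'a \<Rightarrow> complex" assume x: "x \<in> ell2"
    have [simp]: "compress \<tau> T x = (\<lambda>i. T (push \<tau> x) (\<tau> i))"
      using x by (simp add: compress_def fun_eq_iff)
    show "compress \<tau> T x \<in> ell2" by (simp add: ell2_reindex(1)[OF inj bops_ell2[OF T]])
    have "ell2_norm (compress \<tau> T x) \<le> ell2_norm (T (push \<tau> x))"
      by (simp add: ell2_reindex(2)[OF inj bops_ell2[OF T]])
    also have "\<dots> \<le> C * ell2_norm x"
      using C(2)[OF push_ell2(1)[OF inj x]] by (simp add: push_ell2(2)[OF inj x])
    finally show "ell2_norm (compress \<tau> T x) \<le> C * ell2_norm x" .
  qed (simp_all add: compress_def fun_eq_iff ell2_add ell2_scale push_add push_scale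
      bops_add[OF T] bops_scale[OF T] push_ell2[OF inj])
qed

lemma compress_add: "compress \<tau> (op_add R T) = op_add (compress \<tau> R) (compress \<tau> T)"
  by (simp add: compress_def op_add_def fun_eq_iff)

lemma compress_scale: "compress \<tau> (op_scale c T) = op_scale c (compress \<tau> T)"
  by (simp add: compress_def op_scale_def fun_eq_iff)

subsection \<open>Normal linear maps\<close>

lemma topspace_ultraweak [simp]: "topspace ultraweak = bounded_ops"
proof -
  \<comment> \<open>Some functional must exist for the generating sets to cover
    \<open>bounded_ops\<close>; the zero functional serves.\<close>
  have "(\<lambda>T. \<Sum>\<^sub>\<infinity>n. ell2_inner ((\<lambda>_ _. 0) n) (T ((\<lambda>_ _. 0) n))) \<in> ultraweak_functionals"
    unfolding ultraweak_functionals_def mem_Collect_eq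
    by (rule exI[of _ "\<lambda>_ _. 0"], rule exI[of _ "\<lambda>_ _. 0"]) auto
  then have "\<exists>f. f \<in> ultraweak_functionals" by blast
  then show ?thesis
    unfolding ultraweak_def topology_generated_by_topspace by blast
qed

lemma uw_functional_continuous:
  assumes "f \<in> ultraweak_functionals"
  shows "continuous_map ultraweak euclidean f"
  unfolding continuous_map_def
proof (intro conjI allI impI)
  fix U assume "openin euclidean (U :: complex set)"
  then have "{T \<in> bounded_ops. f T \<in> U} \<in> {{T \<in> bounded_ops. f T \<in> U} | f U. f \<in> ultraweak_functionals \<and> open U}"
    using assms by auto
  then show "openin ultraweak {T \<in> topspace ultraweak. f T \<in> U}"
    unfolding topspace_ultraweak unfolding ultraweak_def by (rule topology_generated_by_Basis)
qed auto

definition ell2_family :: "'a set \<Rightarrow> ('a \<Rightarrow> 'i \<Rightarrow> complex) \<Rightarrow> bool" where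
  "ell2_family A x \<longleftrightarrow> (\<forall>a\<in>A. x a \<in> ell2) \<and> (\<lambda>a. (ell2_norm (x a))\<^sup>2) summable_on A"

lemma ell2_familyD:
  assumes "ell2_family A x"
  shows "a \<in> A \<Longrightarrow> x a \<in> ell2" "(\<lambda>a. (ell2_norm (x a))\<^sup>2) summable_on A"
  using assms by (auto simp: ell2_family_def)

lemma ell2_family_bops:
  assumes T: "T \<in> bounded_ops" and x: "ell2_family A x"
  shows "ell2_family A (\<lambda>a. T (x a))"
proof -
  obtain C where C: "\<And>x. x \<in> ell2 \<Longrightarrow> ell2_norm (T x) \<le> C * ell2_norm x"
    using bops_bound[OF T] by blast
  have "(\<lambda>a. (ell2_norm (T (x a)))\<^sup>2) summable_on A"
  proof (rule summable_on_comparison_test)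
    show "(\<lambda>a. C\<^sup>2 * (ell2_norm (x a))\<^sup>2) summable_on A"
      by (rule summable_on_cmult_right[OF ell2_familyD(2)[OF x]])
    show "(ell2_norm (T (x a)))\<^sup>2 \<le> C\<^sup>2 * (ell2_norm (x a))\<^sup>2" if "a \<in> A" for a
      using power_mono[OF C[OF ell2_familyD(1)[OF x that]], of 2] by (simp add: power_mult_distrib)
  qed simp
  then show ?thesis by (simp add: ell2_family_def bops_ell2[OF T])
qed

text \<open>
  Summation over an arbitrary index set costs nothing: square-summable families have countable support.
  Tensor slices are indexed by possibly uncountable sets.
\<close>

lemma uw_family_functional:
  fixes x y :: "'a \<Rightarrow> 'b \<Rightarrow> complex"
  assumes fx: "ell2_family A x" and fy: "ell2_family A y"
  shows "continuous_map ultraweak euclidean (\<lambda>T. \<Sum>\<^sub>\<infinity>a\<in>A. ell2_inner (x a) (T (y a)))"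
proof -
  note x = ell2_familyD(1)[OF fx] and y = ell2_familyD(1)[OF fy]
    and sx = ell2_familyD(2)[OF fx] and sy = ell2_familyD(2)[OF fy]
  \<comment> \<open>The support of \<open>x\<close> alone is enough: by Cauchy-Schwarz the terms
    outside \<open>B\<close> vanish whatever \<open>y\<close> is.\<close>
  define B where "B = {a \<in> A. ell2_norm (x a) \<noteq> 0}"
  have BA: "B \<subseteq> A" by (auto simp: B_def)
  have "countable B" using summable_countable_real[OF sx] by (simp add: B_def)
  then obtain g :: "'a \<Rightarrow> nat" where g: "inj_on g B" by (rule countableE)
  define x' where "x' n = (if n \<in> g ` B then x (inv_into B g n) else (\<lambda>_. 0))" for n
  define y' where "y' n = (if n \<in> g ` B then y (inv_into B g n) else (\<lambda>_. 0))" for n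
  have x'g: "x' (g b) = x b" and y'g: "y' (g b) = y b" if "b \<in> B" for b
    using that g by (simp_all add: x'_def y'_def)
  have "(\<lambda>n. (ell2_norm (x' n))\<^sup>2) summable_on g ` B"
    unfolding summable_on_reindex[OF g]
    by (rule summable_on_cong[THEN iffD1, OF _ summable_on_subset_banach[OF sx BA]]) (simp add: x'g)
  then have sx': "(\<lambda>n. (ell2_norm (x' n))\<^sup>2) summable_on UNIV"
    by (rule summable_on_cong_neutral[THEN iffD1, rotated -1]) (auto simp: x'_def)
  have "(\<lambda>n. (ell2_norm (y' n))\<^sup>2) summable_on g ` B"
    unfolding summable_on_reindex[OF g]
    by (rule summable_on_cong[THEN iffD1, OF _ summable_on_subset_banach[OF sy BA]]) (simp add: y'g)
  then have sy': "(\<lambda>n. (ell2_norm (y' n))\<^sup>2) summable_on UNIV"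
    by (rule summable_on_cong_neutral[THEN iffD1, rotated -1]) (auto simp: y'_def)
  have rx: "range x' \<subseteq> ell2"
    unfolding x'_def using x inv_into_into[of _ g B] BA by (auto simp: subset_iff)
  have ry: "range y' \<subseteq> ell2"
    unfolding y'_def using y inv_into_into[of _ g B] BA by (auto simp: subset_iff)
  have "(\<lambda>T. \<Sum>\<^sub>\<infinity>n. ell2_inner (x' n) (T (y' n))) \<in> ultraweak_functionals"
    unfolding ultraweak_functionals_def mem_Collect_eq
    by (intro exI[of _ x'] exI[of _ y'] conjI refl rx ry sx' sy')
  then have "continuous_map ultraweak euclidean (\<lambda>T. \<Sum>\<^sub>\<infinity>n. ell2_inner (x' n) (T (y' n)))"
    by (rule uw_functional_continuous)
  then show ?thesis
  proof (rule continuous_map_eq)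
    fix T :: "'b oper" assume "T \<in> topspace ultraweak"
    then have T: "T \<in> bounded_ops" by simp
    have "(\<Sum>\<^sub>\<infinity>n. ell2_inner (x' n) (T (y' n))) = (\<Sum>\<^sub>\<infinity>n\<in>g ` B. ell2_inner (x' n) (T (y' n)))"
      by (rule infsum_cong_neutral) (auto simp: x'_def)
    also have "\<dots> = (\<Sum>\<^sub>\<infinity>b\<in>B. ell2_inner (x b) (T (y b)))"
      unfolding infsum_reindex[OF g] by (rule infsum_cong) (simp add: x'g y'g)
    also have "\<dots> = (\<Sum>\<^sub>\<infinity>a\<in>A. ell2_inner (x a) (T (y a)))"
    proof (rule infsum_cong_neutral)
      fix a assume "a \<in> A - B"
      then have "ell2_norm (x a) = 0" "a \<in> A" by (auto simp: B_def)
      then show "ell2_inner (x a) (T (y a)) = 0"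
        using ell2_inner_CS[OF x bops_ell2[OF T], of a "y a"] by simp
    qed (use BA in auto)
    finally show "(\<Sum>\<^sub>\<infinity>n. ell2_inner (x' n) (T (y' n))) = (\<Sum>\<^sub>\<infinity>a\<in>A. ell2_inner (x a) (T (y a)))" .
  qed
qed

lemma uw_inner_continuous:
  assumes "x \<in> ell2" "y \<in> ell2"
  shows "continuous_map ultraweak euclidean (\<lambda>T. ell2_inner x (T y))"
  using uw_family_functional[of "{()}" "\<lambda>_. x" "\<lambda>_. y"] assms by (simp add: ell2_family_def)

lemma uw_apply_continuous:
  assumes "y \<in> ell2"
  shows "continuous_map ultraweak euclidean (\<lambda>T. T y i)"
  using uw_inner_continuous[OF delta_ell2 assms, of i] by simp

lemma uw_continuousI:
  fixes \<Phi> :: "'a oper \<Rightarrow> 'c oper"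
  assumes "\<And>T. T \<in> bounded_ops \<Longrightarrow> \<Phi> T \<in> bounded_ops"
    and "\<And>x y. ell2_family UNIV x \<Longrightarrow> ell2_family UNIV y \<Longrightarrow>
      continuous_map ultraweak euclidean (\<lambda>T. \<Sum>\<^sub>\<infinity>n :: nat. ell2_inner (x n) (\<Phi> T (y n)))"
  shows "continuous_map ultraweak ultraweak \<Phi>"
proof -
  have "continuous_map ultraweak (topology_generated_by
     {{T \<in> bounded_ops. f T \<in> U} | f U. f \<in> ultraweak_functionals \<and> open U}) \<Phi>"
  proof (rule continuous_on_generated_topo)
    fix V :: "'c oper set" assume "V \<in> {{T \<in> bounded_ops. f T \<in> U} | f U. f \<in> ultraweak_functionals \<and> open (U :: complex set)}"
    then obtain f and U :: "complex set" where f: "f \<in> ultraweak_functionals" and U: "open U"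
      and V: "V = {T \<in> bounded_ops. f T \<in> U}" by blast
    from f obtain x y :: "nat \<Rightarrow> 'c \<Rightarrow> complex" where eq: "f = (\<lambda>T. \<Sum>\<^sub>\<infinity>n. ell2_inner (x n) (T (y n)))"
      and fam: "ell2_family UNIV x" "ell2_family UNIV y"
      proof -
      from f obtain x y :: "nat \<Rightarrow> 'c \<Rightarrow> complex" where "f = (\<lambda>T. \<Sum>\<^sub>\<infinity>n. ell2_inner (x n) (T (y n)))"
        "range x \<subseteq> ell2" "range y \<subseteq> ell2" "(\<lambda>n. (ell2_norm (x n))\<^sup>2) summable_on UNIV"
        "(\<lambda>n. (ell2_norm (y n))\<^sup>2) summable_on UNIV"
        unfolding ultraweak_functionals_def by auto
      then show thesis by (intro that[of x y]) (auto simp: ell2_family_def)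
    qed
    from assms(2)[OF fam] eq have "continuous_map ultraweak euclidean (\<lambda>T. f (\<Phi> T))" by simp
    then have "openin ultraweak {T \<in> topspace ultraweak. f (\<Phi> T) \<in> U}"
      by (rule openin_continuous_map_preimage) (simp add: U)
    moreover have "\<Phi> -` V \<inter> topspace ultraweak = {T \<in> topspace ultraweak. f (\<Phi> T) \<in> U}"
      unfolding V using assms(1) by auto
    ultimately show "openin ultraweak (\<Phi> -` V \<inter> topspace ultraweak)" by simp
  next
    show "\<Phi> ` topspace ultraweak \<subseteq> \<Union> {{T \<in> bounded_ops. f T \<in> U} |f U. f \<in> ultraweak_functionals \<and> open (U :: complex set)}"
      using assms(1) topspace_ultraweak unfolding ultraweak_def topology_generated_by_topspace by blast
  qed
  then show ?thesis by (simp add: ultraweak_def)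
qed

lemma uw_summable_inner:
  assumes T: "T \<in> bounded_ops" and x: "ell2_family A x" and y: "ell2_family A y"
  shows "(\<lambda>a. ell2_inner (x a) (T (y a))) summable_on A"
proof -
  note Ty = ell2_family_bops[OF T y]
  have "(\<lambda>a. cmod (ell2_inner (x a) (T (y a)))) summable_on A"
  proof (rule summable_on_comparison_test)
    show "(\<lambda>a. (ell2_norm (x a))\<^sup>2 + (ell2_norm (T (y a)))\<^sup>2) summable_on A"
      by (intro summable_on_add ell2_familyD(2)[OF x] ell2_familyD(2)[OF Ty])
    fix a assume a: "a \<in> A"
    have "cmod (ell2_inner (x a) (T (y a))) \<le> ell2_norm (x a) * ell2_norm (T (y a))"
      by (rule ell2_inner_CS[OF ell2_familyD(1)[OF x a] bops_ell2[OF T]])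
    moreover have "0 \<le> ell2_norm (x a) * ell2_norm (T (y a))" by simp
    ultimately show "cmod (ell2_inner (x a) (T (y a))) \<le> (ell2_norm (x a))\<^sup>2 + (ell2_norm (T (y a)))\<^sup>2"
      using sum_squares_bound[of "ell2_norm (x a)" "ell2_norm (T (y a))"] by linarith
  qed simp
  then show ?thesis by (rule abs_summable_summable)
qed

text \<open>Pulled back along \<open>amp\<close>, a functional given by two sequences of vectors is
  given by their slices, indexed by pairs of a natural number and an element of \<open>S\<close>.
  The slices are square-summable over all pairs by the Bessel estimate.\<close>

lemma uw_continuous_amp:
  fixes \<sigma> :: "'s \<times> 'i \<Rightarrow> 'b"
  assumes inj: "inj_on \<sigma> (S \<times> UNIV)"
  shows "continuous_map ultraweak ultraweak (amp \<sigma> S)"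
proof (rule uw_continuousI)
  fix x y :: "nat \<Rightarrow> 'b \<Rightarrow> complex"
  assume x: "ell2_family UNIV x" and y: "ell2_family UNIV y"
  define xs where "xs z = (\<lambda>(n :: nat, s) i. z n (\<sigma> (s, i)) :: complex)" for z
  have xs: "ell2_family (UNIV \<times> S) (xs z)" if z: "ell2_family UNIV z" for z
    unfolding ell2_family_def
  proof
    have zn: "z n \<in> ell2" for n using ell2_familyD(1)[OF z] by simp
    show "\<forall>p\<in>UNIV \<times> S. xs z p \<in> ell2"
      using ell2_slice[OF inj _ zn] by (auto simp: xs_def)
    show "(\<lambda>p. (ell2_norm (xs z p))\<^sup>2) summable_on UNIV \<times> S"
    proof (rule summable_on_SigmaI)
      fix n
      show "((\<lambda>s. (ell2_norm (xs z (n, s)))\<^sup>2) has_sum (\<Sum>\<^sub>\<infinity>s\<in>S. (ell2_norm (xs z (n, s)))\<^sup>2)) S"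
        using has_sum_infsum[OF ell2_slices(1)[OF inj zn[of n]]] by (simp add: xs_def)
    next
      show "(\<lambda>n. \<Sum>\<^sub>\<infinity>s\<in>S. (ell2_norm (xs z (n, s)))\<^sup>2) summable_on UNIV"
        by (rule summable_on_comparison_test[OF ell2_familyD(2)[OF z]])
          (use ell2_slices(2)[OF inj zn] in \<open>auto simp: xs_def intro!: infsum_nonneg\<close>)
    qed simp
  qed
  have "continuous_map ultraweak euclidean (\<lambda>T. \<Sum>\<^sub>\<infinity>p\<in>UNIV \<times> S. ell2_inner (xs x p) (T (xs y p)))"
    by (intro uw_family_functional xs x y)
  then show "continuous_map ultraweak euclidean (\<lambda>T. \<Sum>\<^sub>\<infinity>n. ell2_inner (x n) (amp \<sigma> S T (y n)))"
  proof (rule continuous_map_eq)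
    fix T :: "'i oper" assume "T \<in> topspace ultraweak"
    then have T: "T \<in> bounded_ops" by simp
    have "(\<Sum>\<^sub>\<infinity>p\<in>UNIV \<times> S. ell2_inner (xs x p) (T (xs y p)))
        = (\<Sum>\<^sub>\<infinity>n. \<Sum>\<^sub>\<infinity>s\<in>S. ell2_inner (xs x (n, s)) (T (xs y (n, s))))"
      by (rule infsum_Sigma_banach[symmetric, OF uw_summable_inner[OF T xs[OF x] xs[OF y]]])
    also have "\<dots> = (\<Sum>\<^sub>\<infinity>n. ell2_inner (x n) (amp \<sigma> S T (y n)))"
      by (rule infsum_cong) (simp add: amp_inner[OF inj T] xs_def ell2_familyD(1)[OF x] ell2_familyD(1)[OF y])
    finally show "(\<Sum>\<^sub>\<infinity>p\<in>UNIV \<times> S. ell2_inner (xs x p) (T (xs y p)))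
        = (\<Sum>\<^sub>\<infinity>n. ell2_inner (x n) (amp \<sigma> S T (y n)))" .
  qed
qed (use inj in simp)

lemma uw_continuous_compress:
  fixes \<tau> :: "'a \<Rightarrow> 'b"
  assumes inj: "inj \<tau>"
  shows "continuous_map ultraweak ultraweak (compress \<tau>)"
proof (rule uw_continuousI)
  fix x y :: "nat \<Rightarrow> 'a \<Rightarrow> complex"
  assume x: "ell2_family UNIV x" and y: "ell2_family UNIV y"
  have push: "ell2_family UNIV (\<lambda>n. push \<tau> (z n))" if "ell2_family UNIV z" for z :: "nat \<Rightarrow> 'a \<Rightarrow> complex"
    using that by (simp add: ell2_family_def push_ell2[OF inj])
  show "continuous_map ultraweak euclidean (\<lambda>T. \<Sum>\<^sub>\<infinity>n. ell2_inner (x n) (compress \<tau> T (y n)))"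
    by (rule continuous_map_eq[OF uw_family_functional[OF push[OF x] push[OF y]]])
      (simp add: push_inner[OF inj] compress_ell2 ell2_familyD(1)[OF y])
qed (use inj in simp)

text \<open>Multiplication is treated one factor at a time: a fixed left factor moves to the left
  vectors of a functional as its adjoint, a fixed right factor acts on the right vectors.\<close>

lemma uw_continuous_mult_left:
  assumes a: "a \<in> bounded_ops"
  shows "continuous_map ultraweak ultraweak (\<lambda>T. a \<circ> T)"
proof (rule uw_continuousI)
  fix x y :: "nat \<Rightarrow> 'a \<Rightarrow> complex"
  assume x: "ell2_family UNIV x" and y: "ell2_family UNIV y"
  show "continuous_map ultraweak euclidean (\<lambda>T. \<Sum>\<^sub>\<infinity>n. ell2_inner (x n) ((a \<circ> T) (y n)))"
    by (rule continuous_map_eq[OF uw_family_functional[OF ell2_family_bops[OF op_adj_bops[OF a] x] y]])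
      (simp add: op_adj_inner[OF a] ell2_familyD(1)[OF x] bops_ell2)
qed (use a in \<open>simp add: bops_comp\<close>)

lemma uw_continuous_mult_right:
  assumes a: "a \<in> bounded_ops"
  shows "continuous_map ultraweak ultraweak (\<lambda>T. T \<circ> a)"
  by (rule uw_continuousI) (simp_all add: a bops_comp uw_family_functional ell2_family_bops)

lemma uw_continuous_adj: "continuous_map ultraweak ultraweak op_adj"
proof (rule uw_continuousI)
  fix x y :: "nat \<Rightarrow> 'a \<Rightarrow> complex"
  assume x: "ell2_family UNIV x" and y: "ell2_family UNIV y"
  have "continuous_map euclidean euclidean cnj"
    by (simp add: continuous_on_cnj continuous_on_id)
  with uw_family_functional[OF y x]
  have "continuous_map ultraweak euclidean (cnj \<circ> (\<lambda>T. \<Sum>\<^sub>\<infinity>n. ell2_inner (y n) (T (x n))))"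
    by (rule continuous_map_compose)
  then show "continuous_map ultraweak euclidean (\<lambda>T. \<Sum>\<^sub>\<infinity>n. ell2_inner (x n) (op_adj T (y n)))"
    by (rule continuous_map_eq)
      (simp add: op_adj_inner' ell2_familyD(1)[OF x] ell2_familyD(1)[OF y] ell2_inner_commute flip: infsum_cnj)
qed simp

text \<open>Matrix entries are continuous and separate points. This makes the set where two normal
  maps agree closed.\<close>

lemma Hausdorff_ultraweak: "Hausdorff_space ultraweak"
  unfolding Hausdorff_space_def
proof (intro allI impI)
  fix S T :: "'a oper" assume *: "S \<in> topspace ultraweak \<and> T \<in> topspace ultraweak \<and> S \<noteq> T"
  then obtain i j where ij: "S (delta j) i \<noteq> T (delta j) i"
    using bops_eqI[of S T] by auto
  then obtain U V where UV: "open U" "open V" "S (delta j) i \<in> U" "T (delta j) i \<in> V" "U \<inter> V = {}"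
    using hausdorff[OF ij] by blast
  have c: "continuous_map ultraweak euclidean (\<lambda>T. T (delta j) i)"
    by (rule uw_apply_continuous) simp
  show "\<exists>U V. openin ultraweak U \<and> openin ultraweak V \<and> S \<in> U \<and> T \<in> V \<and> disjnt U V"
  proof (intro exI conjI)
    show "openin ultraweak {R \<in> topspace ultraweak. R (delta j) i \<in> U}"
      by (rule openin_continuous_map_preimage[OF c]) (simp add: UV)
    show "openin ultraweak {R \<in> topspace ultraweak. R (delta j) i \<in> V}"
      by (rule openin_continuous_map_preimage[OF c]) (simp add: UV)
  qed (use * UV in \<open>auto simp: disjnt_def\<close>)
qed

text \<open>Continuity is demanded on all bounded operators and not on a particular algebra, so the
  concrete maps compose freely; restriction to an algebra happens only when
  \<open>normal_map\<close> or \<open>linear_map\<close> has to be shown.\<close>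

definition normal_lin :: "('i oper \<Rightarrow> 'j oper) \<Rightarrow> bool" where
  "normal_lin \<Phi> \<longleftrightarrow> continuous_map ultraweak ultraweak \<Phi> \<and>
     (\<forall>S\<in>bounded_ops. \<forall>T\<in>bounded_ops. \<Phi> (op_add S T) = op_add (\<Phi> S) (\<Phi> T)) \<and>
     (\<forall>c. \<forall>T\<in>bounded_ops. \<Phi> (op_scale c T) = op_scale c (\<Phi> T))"

definition normal_fun :: "('i oper \<Rightarrow> complex) \<Rightarrow> bool" where
  "normal_fun f \<longleftrightarrow> continuous_map ultraweak euclidean f \<and>
     (\<forall>S\<in>bounded_ops. \<forall>T\<in>bounded_ops. f (op_add S T) = f S + f T) \<and>
     (\<forall>c. \<forall>T\<in>bounded_ops. f (op_scale c T) = c * f T)"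

lemma normal_lin_bops: "normal_lin \<Phi> \<Longrightarrow> T \<in> bounded_ops \<Longrightarrow> \<Phi> T \<in> bounded_ops"
  unfolding normal_lin_def continuous_map_def by auto

lemma normal_lin_continuous: "normal_lin \<Phi> \<Longrightarrow> continuous_map ultraweak ultraweak \<Phi>"
  by (simp add: normal_lin_def)

lemma normal_lin_add:
  "normal_lin \<Phi> \<Longrightarrow> S \<in> bounded_ops \<Longrightarrow> T \<in> bounded_ops \<Longrightarrow> \<Phi> (op_add S T) = op_add (\<Phi> S) (\<Phi> T)"
  by (simp add: normal_lin_def)

lemma normal_lin_scale: "normal_lin \<Phi> \<Longrightarrow> T \<in> bounded_ops \<Longrightarrow> \<Phi> (op_scale c T) = op_scale c (\<Phi> T)"
  by (simp add: normal_lin_def)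

lemma normal_lin_compose:
  assumes "normal_lin \<Phi>" "normal_lin \<Psi>"
  shows "normal_lin (\<lambda>T. \<Psi> (\<Phi> T))"
  using assms continuous_map_compose[of ultraweak ultraweak \<Phi> ultraweak \<Psi>]
  by (simp add: normal_lin_def[of "\<lambda>T. \<Psi> (\<Phi> T)"] o_def normal_lin_continuous normal_lin_add
      normal_lin_scale normal_lin_bops)

lemma normal_lin_cong:
  assumes n: "normal_lin \<Phi>" and eq: "\<And>T. T \<in> bounded_ops \<Longrightarrow> \<Phi> T = \<Psi> T"
  shows "normal_lin \<Psi>"
proof -
  have "continuous_map ultraweak ultraweak \<Psi>"
    by (rule continuous_map_eq[OF normal_lin_continuous[OF n]]) (simp add: eq)
  moreover have "\<Psi> (op_add S T) = op_add (\<Psi> S) (\<Psi> T)" if "S \<in> bounded_ops" "T \<in> bounded_ops" for S T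
    using normal_lin_add[OF n that] by (simp add: eq bops_add_op that)
  moreover have "\<Psi> (op_scale c T) = op_scale c (\<Psi> T)" if "T \<in> bounded_ops" for c T
    using normal_lin_scale[OF n that, of c] by (simp add: eq bops_scale_op that)
  ultimately show ?thesis by (simp add: normal_lin_def)
qed

lemma normal_lin_id: "normal_lin (\<lambda>T. T)"
  by (simp add: normal_lin_def)

lemma normal_lin_amp: "inj_on \<sigma> (S \<times> UNIV) \<Longrightarrow> normal_lin (amp \<sigma> S)"
  by (simp add: normal_lin_def uw_continuous_amp amp_add amp_scale)

lemma normal_lin_compress: "inj \<tau> \<Longrightarrow> normal_lin (compress \<tau>)"
  by (simp add: normal_lin_def uw_continuous_compress compress_add compress_scale)

lemma normal_lin_mult_left: "a \<in> bounded_ops \<Longrightarrow> normal_lin (\<lambda>T. a \<circ> T)"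
  by (simp add: normal_lin_def uw_continuous_mult_left comp_op_add_right comp_op_scale_right)

lemma normal_lin_mult_right: "a \<in> bounded_ops \<Longrightarrow> normal_lin (\<lambda>T. T \<circ> a)"
  by (simp add: normal_lin_def uw_continuous_mult_right comp_op_add_left comp_op_scale_left)

lemma normal_fun_apply: "y \<in> ell2 \<Longrightarrow> normal_fun (\<lambda>T. T y i)"
  by (simp add: normal_fun_def uw_apply_continuous op_add_apply op_scale_apply)

lemma normal_fun_compose:
  assumes "normal_lin \<Phi>" "normal_fun f"
  shows "normal_fun (\<lambda>T. f (\<Phi> T))"
  using assms continuous_map_compose[of ultraweak ultraweak \<Phi> euclidean f]
  by (simp add: normal_fun_def o_def normal_lin_continuous normal_lin_add
      normal_lin_scale normal_lin_bops)

lemma normal_fun_scale_op: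
  assumes "normal_fun f" and e: "e \<in> bounded_ops"
  shows "normal_lin (\<lambda>T. op_scale (f T) e)"
proof -
  have "continuous_map ultraweak ultraweak (\<lambda>T. op_scale (f T) e)"
  proof (rule uw_continuousI)
    fix x y :: "nat \<Rightarrow> 'b \<Rightarrow> complex"
    have "continuous_map ultraweak euclidean ((\<lambda>z. z * (\<Sum>\<^sub>\<infinity>n. ell2_inner (x n) (e (y n)))) \<circ> f)"
      using assms(1) by (intro continuous_map_compose[of _ euclidean])
        (auto simp: normal_fun_def intro!: continuous_intros)
    moreover have "ell2_inner (x n) (op_scale c e (y n)) = c * ell2_inner (x n) (e (y n))" for n c
      by (simp add: op_scale_def ell2_inner_scale_right)
    ultimately show "continuous_map ultraweak euclidean (\<lambda>T. \<Sum>\<^sub>\<infinity>n. ell2_inner (x n) (op_scale (f T) e (y n)))"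
      by (simp add: infsum_cmult_right' o_def)
  qed (simp add: e bops_scale_op)
  then show ?thesis
    using assms by (auto simp: normal_lin_def normal_fun_def op_scale_def op_add_def fun_eq_iff algebra_simps)
qed

subsection \<open>Ultraweakly closed subspaces and generated von Neumann algebras\<close>

text \<open>The shape of every property that is carried from generators to a generated algebra:
  preimages, equalizers and kernels of normal linear maps all have it.\<close>

definition uw_subspace :: "'i oper set \<Rightarrow> bool" where
  "uw_subspace N \<longleftrightarrow> closedin ultraweak N \<and> (\<lambda>_ _. 0) \<in> N \<and>
     (\<forall>a\<in>N. \<forall>b\<in>N. op_add a b \<in> N) \<and> (\<forall>c. \<forall>a\<in>N. op_scale c a \<in> N)"

lemma uw_subspace_bops: "uw_subspace N \<Longrightarrow> a \<in> N \<Longrightarrow> a \<in> bounded_ops"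
  using closedin_subset[of ultraweak N] by (auto simp: uw_subspace_def)

lemma uw_subspace_Inter:
  assumes "\<And>N. N \<in> \<N> \<Longrightarrow> uw_subspace N" "\<N> \<noteq> {}"
  shows "uw_subspace (\<Inter>\<N>)"
  using assms closedin_Inter[of \<N> ultraweak] unfolding uw_subspace_def by blast

lemma op_scale_zero: "op_scale 0 T = (\<lambda>_ _. 0)"
  by (simp add: op_scale_def)

lemma op_scale_one: "op_scale 1 T = T"
  by (simp add: op_scale_def)

lemma op_scale_scale: "op_scale a (op_scale b T) = op_scale (a * b) T"
  by (simp add: op_scale_def mult.assoc)

lemma normal_lin_zero: "normal_lin \<Phi> \<Longrightarrow> \<Phi> (\<lambda>_ _. 0) = (\<lambda>_ _. 0)"
  using normal_lin_scale[of \<Phi> "\<lambda>_ _. 0" 0] by (simp add: op_scale_def)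

lemma normal_fun_zero:
  assumes "normal_fun f" shows "f (\<lambda>_ _. 0) = 0"
proof -
  have "f (op_scale 0 (\<lambda>_ _. 0)) = 0 * f (\<lambda>_ _. 0)"
    using assms bops_zero_op unfolding normal_fun_def by blast
  then show ?thesis by (simp add: op_scale_zero)
qed

lemma uw_subspace_UNIV: "uw_subspace bounded_ops"
  unfolding uw_subspace_def
  using closedin_topspace[of ultraweak] by (auto simp: bops_add_op bops_scale_op)

lemma uw_subspace_preimage:
  assumes \<Phi>: "normal_lin \<Phi>" and N: "uw_subspace N"
  shows "uw_subspace {T \<in> bounded_ops. \<Phi> T \<in> N}"
proof -
  have "closedin ultraweak {T \<in> topspace ultraweak. \<Phi> T \<in> N}"
    using N by (intro closedin_continuous_map_preimage[OF normal_lin_continuous[OF \<Phi>]]) (simp add: uw_subspace_def)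
  then show ?thesis
    using N unfolding uw_subspace_def
    by (auto simp: bops_add_op bops_scale_op normal_lin_zero[OF \<Phi>] normal_lin_add[OF \<Phi>] normal_lin_scale[OF \<Phi>])
qed

lemma uw_subspace_equalizer:
  assumes \<Phi>: "normal_lin \<Phi>" and \<Psi>: "normal_lin \<Psi>"
  shows "uw_subspace {T \<in> bounded_ops. \<Phi> T = \<Psi> T}"
proof -
  have "closedin ultraweak {T \<in> topspace ultraweak. \<Phi> T = \<Psi> T}"
    by (intro closedin_continuous_maps_eq[OF Hausdorff_ultraweak] normal_lin_continuous \<Phi> \<Psi>)
  then show ?thesis unfolding uw_subspace_def
    by (auto simp: bops_add_op bops_scale_op normal_lin_zero[OF \<Phi>] normal_lin_add[OF \<Phi>] normal_lin_scale[OF \<Phi>]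
        normal_lin_zero[OF \<Psi>] normal_lin_add[OF \<Psi>] normal_lin_scale[OF \<Psi>])
qed

lemma uw_subspace_fun_equalizer:
  assumes f: "normal_fun f" and g: "normal_fun g"
  shows "uw_subspace {T \<in> bounded_ops. f T = g T}"
proof -
  have "closedin ultraweak {T \<in> topspace ultraweak. f T = g T}"
    using f g by (intro closedin_continuous_maps_eq[of euclidean]) (auto simp: normal_fun_def)
  then show ?thesis
    using f g normal_fun_zero[OF f] normal_fun_zero[OF g] unfolding uw_subspace_def
    by (auto simp: bops_add_op bops_scale_op normal_fun_def)
qed

lemma uw_subspace_kernel:
  assumes "normal_fun f"
  shows "uw_subspace {T \<in> bounded_ops. f T = 0}"
  by (rule uw_subspace_fun_equalizer[OF assms]) (simp add: normal_fun_def)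

lemma uw_subspace_zero: "uw_subspace {(\<lambda>_ _. 0) :: 'i oper}"
proof -
  have "uw_subspace {T \<in> bounded_ops. T = ((\<lambda>_ _. 0) :: 'i oper)}"
    by (rule uw_subspace_equalizer[OF normal_lin_id]) (simp add: normal_lin_def op_add_def op_scale_def)
  moreover have "{T \<in> bounded_ops. T = ((\<lambda>_ _. 0) :: 'i oper)} = {\<lambda>_ _. 0}"
    using bops_zero_op by blast
  ultimately show ?thesis by (simp only:)
qed

text \<open>Separate from the general preimage because \<open>op_adj\<close> is conjugate-linear,
  hence not \<open>normal_lin\<close>.\<close>

lemma uw_subspace_adj_preimage:
  fixes N :: "'i oper set"
  assumes N: "uw_subspace N"
  shows "uw_subspace {T \<in> bounded_ops. op_adj T \<in> N}"
proof -
  have "closedin ultraweak {T \<in> topspace ultraweak. op_adj T \<in> N}"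
    using N by (intro closedin_continuous_map_preimage[OF uw_continuous_adj]) (simp add: uw_subspace_def)
  moreover have "op_adj ((\<lambda>_ _. 0) :: 'i oper) = (\<lambda>_ _. 0)"
    by (rule op_adj_eqI) auto
  ultimately show ?thesis
    using N unfolding uw_subspace_def
    by (auto simp: bops_add_op bops_scale_op op_adj_add op_adj_scale)
qed

lemma vna_subspace: "von_neumann_algebra M \<Longrightarrow> uw_subspace M"
proof -
  assume M: "von_neumann_algebra M"
  then obtain e where "e \<in> M" by (auto simp: von_neumann_algebra_def)
  then have "op_scale 0 e \<in> M" using M by (auto simp: von_neumann_algebra_def)
  with M show ?thesis by (auto simp: von_neumann_algebra_def uw_subspace_def op_scale_zero)
qed

definition cspan :: "'i oper set \<Rightarrow> 'i oper set" where
  "cspan X = \<Inter>{N. uw_subspace N \<and> X \<subseteq> N}"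

lemma cspan_minimal: "uw_subspace N \<Longrightarrow> X \<subseteq> N \<Longrightarrow> cspan X \<subseteq> N"
  unfolding cspan_def by blast

lemma cspan_superset: "X \<subseteq> cspan X"
  unfolding cspan_def by blast

lemma cspan_subspace: "X \<subseteq> bounded_ops \<Longrightarrow> uw_subspace (cspan X)"
  unfolding cspan_def by (rule uw_subspace_Inter) (use uw_subspace_UNIV in auto)

text \<open>The unit \<open>e\<close> may be a proper projection. For the translations of a group it
  is the projection onto the families supported on the carrier.\<close>

definition star_monoid :: "'i oper set \<Rightarrow> 'i oper \<Rightarrow> bool" where
  "star_monoid X e \<longleftrightarrow> X \<subseteq> bounded_ops \<and> e \<in> X \<and> (\<forall>a\<in>X. e \<circ> a = a \<and> a \<circ> e = a) \<and>
     (\<forall>a\<in>X. \<forall>b\<in>X. a \<circ> b \<in> X) \<and> (\<forall>a\<in>X. op_adj a \<in> X)"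

lemma cspan_unit:
  assumes X: "star_monoid X e" and T: "T \<in> cspan X"
  shows "e \<circ> T = T" "T \<circ> e = T"
proof -
  have e: "e \<in> bounded_ops" using X by (auto simp: star_monoid_def)
  have "cspan X \<subseteq> {T \<in> bounded_ops. e \<circ> T = T}" "cspan X \<subseteq> {T \<in> bounded_ops. T \<circ> e = T}"
    using X by (intro cspan_minimal uw_subspace_equalizer normal_lin_mult_left normal_lin_mult_right
      normal_lin_id e; auto simp: star_monoid_def)+
  with T show "e \<circ> T = T" "T \<circ> e = T" by auto
qed

text \<open>
  The closed span of a \<open>*\<close>-monoid of operators is already multiplicatively closed (fix one factor in
  the monoid first, then in the closed span), so it is the generated von Neumann algebra. This is what
  allows identities of normal linear maps to be checked on generators.
\<close>

lemma cspan_vna: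
  assumes X: "star_monoid X e"
  shows "von_neumann_algebra (cspan X)"
proof -
  have Xb: "X \<subseteq> bounded_ops" and e: "e \<in> X" using X by (auto simp: star_monoid_def)
  note sub = cspan_subspace[OF Xb]
  have bops: "T \<in> bounded_ops" if "T \<in> cspan X" for T
    using uw_subspace_bops[OF sub that] .
  have left: "a \<circ> T \<in> cspan X" if a: "a \<in> X" and T: "T \<in> cspan X" for a T
  proof -
    have "cspan X \<subseteq> {T \<in> bounded_ops. a \<circ> T \<in> cspan X}"
      using X a cspan_superset[of X] Xb
      by (intro cspan_minimal uw_subspace_preimage[OF normal_lin_mult_left sub])
         (auto simp: star_monoid_def)
    then show ?thesis using T by auto
  qed
  have mult: "S \<circ> T \<in> cspan X" if S: "S \<in> cspan X" and T: "T \<in> cspan X" for S T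
  proof -
    have "cspan X \<subseteq> {S \<in> bounded_ops. S \<circ> T \<in> cspan X}"
      using Xb left[OF _ T]
      by (intro cspan_minimal uw_subspace_preimage[OF normal_lin_mult_right[OF bops[OF T]] sub]) auto
    then show ?thesis using S by auto
  qed
  have adj: "op_adj T \<in> cspan X" if T: "T \<in> cspan X" for T
  proof -
    have "cspan X \<subseteq> {T \<in> bounded_ops. op_adj T \<in> cspan X}"
      using X Xb cspan_superset[of X]
      by (intro cspan_minimal uw_subspace_adj_preimage[OF sub]) (auto simp: star_monoid_def)
    then show ?thesis using T by auto
  qed
  have "e \<in> cspan X" using e cspan_superset[of X] by (rule rev_subsetD)
  then have "\<exists>e\<in>cspan X. \<forall>a\<in>cspan X. e \<circ> a = a \<and> a \<circ> e = a"
    using cspan_unit[OF X] by (intro bexI[of _ e] ballI conjI)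
  with sub bops mult adj show ?thesis
    by (simp add: von_neumann_algebra_def uw_subspace_def subset_iff)
qed

lemma vn_generated_superset: "X \<subseteq> vn_generated X"
  unfolding vn_generated_def by blast

lemma vn_generated_eq_cspan:
  assumes X: "star_monoid X e"
  shows "vn_generated X = cspan X"
proof
  show "vn_generated X \<subseteq> cspan X"
    unfolding vn_generated_def by (rule Inter_lower) (simp add: cspan_vna[OF X] cspan_superset)
  show "cspan X \<subseteq> vn_generated X"
    unfolding vn_generated_def by (rule Inter_greatest) (simp add: vna_subspace cspan_minimal)
qed

lemma vn_generated_vna: "star_monoid X e \<Longrightarrow> von_neumann_algebra (vn_generated X)"
  using cspan_vna vn_generated_eq_cspan by metis

text \<open>The property \<open>N\<close> only has to be linear and closed; products are already
  accounted for inside the monoid \<open>X\<close>. This is the induction principle behind all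
  statements about \<open>L(G)\<close> and its tensor square.\<close>

lemma vn_generated_induct:
  assumes "star_monoid X e" "uw_subspace N" "X \<subseteq> N"
  shows "vn_generated X \<subseteq> N"
  using assms cspan_minimal vn_generated_eq_cspan by metis

lemma vn_unit_eqI:
  assumes "e \<in> M" "\<And>a. a \<in> M \<Longrightarrow> e \<circ> a = a \<and> a \<circ> e = a"
  shows "vn_unit M = e"
  unfolding vn_unit_def
proof (rule the_equality)
  fix f assume "f \<in> M \<and> (\<forall>a\<in>M. f \<circ> a = a \<and> a \<circ> f = a)"
  then show "f = e" using assms by metis
qed (use assms in auto)

lemma vn_generated_unit:
  assumes "star_monoid X e"
  shows "vn_unit (vn_generated X) = e"
  using assms cspan_unit[OF assms] cspan_superset[of X]
  by (intro vn_unit_eqI) (auto simp: vn_generated_eq_cspan[OF assms] star_monoid_def)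

lemma vna_star_monoid:
  assumes "von_neumann_algebra M"
  shows "star_monoid M (vn_unit M)"
proof -
  obtain e where e: "e \<in> M" "\<forall>a\<in>M. e \<circ> a = a \<and> a \<circ> e = a"
    using assms by (auto simp: von_neumann_algebra_def)
  then have "vn_unit M = e" by (intro vn_unit_eqI) auto
  with e assms show ?thesis by (auto simp: von_neumann_algebra_def star_monoid_def)
qed

lemma vna_bops: "von_neumann_algebra M \<Longrightarrow> a \<in> M \<Longrightarrow> a \<in> bounded_ops"
  by (auto simp: von_neumann_algebra_def)

lemma normal_lin_normal_map:
  assumes "normal_lin \<Phi>" "\<And>a. a \<in> M \<Longrightarrow> \<Phi> a \<in> N"
  shows "normal_map M N \<Phi>"
  unfolding normal_map_def
  by (rule continuous_map_into_subtopology[OF continuous_map_from_subtopology])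
    (use assms in \<open>auto simp: normal_lin_def\<close>)

lemma normal_lin_linear_map:
  assumes "normal_lin \<Phi>" "M \<subseteq> bounded_ops" "\<And>a. a \<in> M \<Longrightarrow> \<Phi> a \<in> N"
  shows "linear_map M N \<Phi>"
  using assms by (auto simp: normal_lin_def linear_map_def subset_iff)

subsection \<open>Tensor products of operators\<close>

definition tens :: "('i \<Rightarrow> complex) \<Rightarrow> ('j \<Rightarrow> complex) \<Rightarrow> 'i \<times> 'j \<Rightarrow> complex" where
  "tens x y = (\<lambda>(i, j). x i * y j)"

lemma tens_ell2:
  assumes x: "x \<in> ell2" and y: "y \<in> ell2"
  shows "tens x y \<in> ell2"
proof -
  have "(\<lambda>p. (cmod (tens x y p))\<^sup>2) summable_on UNIV \<times> UNIV"
  proof (rule summable_on_SigmaI)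
    fix i
    show "((\<lambda>j. (cmod (tens x y (i, j)))\<^sup>2) has_sum (cmod (x i))\<^sup>2 * (ell2_norm y)\<^sup>2) UNIV"
      unfolding ell2_norm_sq tens_def using ell2_summable[OF y]
      by (auto simp: norm_mult power_mult_distrib intro!: has_sum_cmult_right)
  next
    show "(\<lambda>i. (cmod (x i))\<^sup>2 * (ell2_norm y)\<^sup>2) summable_on UNIV"
      by (intro summable_on_cmult_left ell2_summable[OF x])
  qed simp
  then show ?thesis by (simp add: ell2_def)
qed

lemma delta_Pair: "delta (i, j) = tens (delta i) (delta j)"
  by (auto simp: delta_def tens_def fun_eq_iff)

lemma inj_swap_UNIV: "inj_on prod.swap (UNIV \<times> UNIV)"
  by (auto simp: inj_on_def)

text \<open>The factorisation (a \<otimes> 1)(1 \<otimes> b). Slicing by \<open>id\<close> fixes the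
  first coordinate and lets \<open>b\<close> act on the second; \<open>prod.swap\<close> exchanges
  the roles.\<close>

lemma op_tensor_amp:
  fixes a :: "'i oper" and b :: "'j oper"
  assumes a: "a \<in> bounded_ops" and b: "b \<in> bounded_ops"
  shows "op_tensor a b = amp prod.swap UNIV a \<circ> amp id UNIV b"
proof (intro ext)
  fix z and p :: "'i \<times> 'j"
  have i: "inj_on id (UNIV \<times> UNIV)" by simp
  obtain i j where p: "p = (i, j)" by (cases p)
  show "op_tensor a b z p = (amp prod.swap UNIV a \<circ> amp id UNIV b) z p"
  proof (cases "z \<in> ell2")
    case True
    have "amp id UNIV b z (i', j) = b (\<lambda>j'. z (i', j')) j" for i'
      using amp_apply[OF i, of i' z b j] True by simp
    moreover have "amp prod.swap UNIV a w (i, j) = a (\<lambda>i'. w (i', j)) i" if "w \<in> ell2" for w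
      using amp_apply[OF inj_swap_UNIV, of j w a i] that by simp
    ultimately show ?thesis
      using True by (simp add: p op_tensor_def bops_ell2[OF amp_bops[OF i b]])
  next
    case False
    then show ?thesis
      by (simp add: op_tensor_def amp_not_ell2 bops_zero[OF amp_bops[OF inj_swap_UNIV a]])
  qed
qed

lemma op_tensor_bops [simp]:
  assumes a: "a \<in> bounded_ops" and b: "b \<in> bounded_ops"
  shows "op_tensor a b \<in> bounded_ops"
  unfolding op_tensor_amp[OF assms] by (intro bops_comp amp_bops inj_swap_UNIV a b) auto

lemma op_tensor_tens:
  assumes a: "a \<in> bounded_ops" and b: "b \<in> bounded_ops" and x: "x \<in> ell2" and y: "y \<in> ell2"
  shows "op_tensor a b (tens x y) = tens (a x) (b y)"
proof -
  have "a (\<lambda>i'. b (\<lambda>j'. x i' * y j') j) i = a x i * b y j" for i j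
    using bops_scale[OF a x, of "b y j"] by (simp add: bops_scale[OF b y] mult.commute)
  then show ?thesis
    by (simp add: op_tensor_def tens_ell2[OF x y] fun_eq_iff) (simp add: tens_def)
qed

lemma op_tensor_delta:
  assumes "a \<in> bounded_ops" "b \<in> bounded_ops"
  shows "op_tensor a b (delta (i, j)) = tens (a (delta i)) (b (delta j))"
  unfolding delta_Pair by (rule op_tensor_tens[OF assms]) auto

lemma op_tensor_matrix:
  assumes "a \<in> bounded_ops" "b \<in> bounded_ops"
  shows "op_tensor a b (delta (i, j)) (k, l) = a (delta i) k * b (delta j) l"
  by (simp add: op_tensor_delta[OF assms]) (simp add: tens_def)

lemma op_tensor_comp:
  assumes a: "a \<in> bounded_ops" and b: "b \<in> bounded_ops" and c: "c \<in> bounded_ops" and d: "d \<in> bounded_ops"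
  shows "op_tensor a b \<circ> op_tensor c d = op_tensor (a \<circ> c) (b \<circ> d)"
proof (rule bops_eqI)
  fix p q
  show "(op_tensor a b \<circ> op_tensor c d) (delta q) p = op_tensor (a \<circ> c) (b \<circ> d) (delta q) p"
    by (cases q) (simp add: op_tensor_delta c d op_tensor_tens[OF a b bops_ell2[OF c] bops_ell2[OF d]] bops_comp a b)
qed (simp_all add: bops_comp assms)

lemma op_tensor_adj:
  assumes a: "a \<in> bounded_ops" and b: "b \<in> bounded_ops"
  shows "op_adj (op_tensor a b) = op_tensor (op_adj a) (op_adj b)"
proof (rule op_adj_eqI)
  fix p q
  show "op_tensor (op_adj a) (op_adj b) (delta q) p = cnj (op_tensor a b (delta p) q)"
    by (cases p; cases q) (simp add: op_tensor_matrix assms op_adj_matrix)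
qed (use assms in auto)

lemma op_tensor_eqI:
  assumes "S \<in> bounded_ops" "T \<in> bounded_ops"
    and "\<And>i j k l. S (delta (i, j)) (k, l) = T (delta (i, j)) (k, l)"
  shows "S = T"
  by (rule bops_eqI[OF assms(1,2)]) (metis assms(3) surj_pair)

text \<open>In the coordinates provided by \<sigma> an amplification is block diagonal with one
  repeated block. The legs of tensors, the flip, reassociation and the diagonal translations are
  recognised as amplifications by this pattern.\<close>

lemma amp_eq_matrixI:
  assumes inj: "inj_on \<sigma> (S \<times> UNIV)" and T: "T \<in> bounded_ops" and R: "R \<in> bounded_ops"
    and "\<And>s s' i j. s \<in> S \<Longrightarrow> s' \<in> S \<Longrightarrow>
        R (delta (\<sigma> (s, i))) (\<sigma> (s', j)) = (if s = s' then T (delta i) j else 0)"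
    and "\<And>l m. l \<notin> \<sigma> ` (S \<times> UNIV) \<or> m \<notin> \<sigma> ` (S \<times> UNIV) \<Longrightarrow> R (delta l) m = 0"
  shows "amp \<sigma> S T = R"
proof (rule bops_eqI)
  fix m l
  show "amp \<sigma> S T (delta l) m = R (delta l) m"
  proof (cases "l \<in> \<sigma> ` (S \<times> UNIV) \<and> m \<in> \<sigma> ` (S \<times> UNIV)")
    case True
    then obtain s i s' j where "s \<in> S" "s' \<in> S" "l = \<sigma> (s, i)" "m = \<sigma> (s', j)" by auto
    then show ?thesis by (simp add: assms(4) amp_delta_apply[OF inj T])
  next
    case False
    then consider "l \<notin> \<sigma> ` (S \<times> UNIV)" | "m \<notin> \<sigma> ` (S \<times> UNIV)" by blast
    then show ?thesis
      by cases (simp_all add: amp_out amp_delta_out[OF inj T] assms(5))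
  qed
qed (use inj T R in simp_all)

text \<open>If \<open>amp \<sigma> S\<close> is a map \<theta>, then amplifying along this index map
  is \<theta> \<otimes> id, and along \<open>extend_right \<sigma>\<close> it is id \<otimes>
  \<theta>.\<close>

definition extend_left :: "('s \<times> 'i \<Rightarrow> 'l) \<Rightarrow> 's \<times> 'i \<times> 'k \<Rightarrow> 'l \<times> 'k" where
  "extend_left \<sigma> = (\<lambda>(s, i, k). (\<sigma> (s, i), k))"

definition extend_right :: "('s \<times> 'i \<Rightarrow> 'l) \<Rightarrow> 's \<times> 'k \<times> 'i \<Rightarrow> 'k \<times> 'l" where
  "extend_right \<sigma> = (\<lambda>(s, k, i). (k, \<sigma> (s, i)))"

lemma inj_extend_left: "inj_on \<sigma> (S \<times> UNIV) \<Longrightarrow> inj_on (extend_left \<sigma>) (S \<times> UNIV)"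
  unfolding inj_on_def extend_left_def by auto

lemma inj_extend_right: "inj_on \<sigma> (S \<times> UNIV) \<Longrightarrow> inj_on (extend_right \<sigma>) (S \<times> UNIV)"
  unfolding inj_on_def extend_right_def by auto

lemma amp_extend_left:
  fixes \<sigma> :: "'s \<times> 'b \<Rightarrow> 'c" and b :: "'d oper"
  assumes inj: "inj_on \<sigma> (S \<times> UNIV)" and a: "a \<in> bounded_ops" and b: "b \<in> bounded_ops"
  shows "amp (extend_left \<sigma>) S (op_tensor a b) = op_tensor (amp \<sigma> S a) b"
proof (rule amp_eq_matrixI[OF inj_extend_left[OF inj]])
  have a': "amp \<sigma> S a \<in> bounded_ops" using inj a by simp
  fix s s' and p q :: "'b \<times> 'd" assume s: "s \<in> S" "s' \<in> S"
  show "op_tensor (amp \<sigma> S a) b (delta (extend_left \<sigma> (s, p))) (extend_left \<sigma> (s', q))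
      = (if s = s' then op_tensor a b (delta p) q else 0)"
    by (cases p; cases q)
      (simp add: extend_left_def op_tensor_matrix[OF a' b] op_tensor_matrix[OF a b] amp_delta_apply[OF inj a s])
next
  have a': "amp \<sigma> S a \<in> bounded_ops" using inj a by simp
  fix l m :: "'c \<times> 'd" assume "l \<notin> extend_left \<sigma> ` (S \<times> UNIV) \<or> m \<notin> extend_left \<sigma> ` (S \<times> UNIV)"
  then have "fst l \<notin> \<sigma> ` (S \<times> UNIV) \<or> fst m \<notin> \<sigma> ` (S \<times> UNIV)"
    by (cases l; cases m) (force simp: extend_left_def image_iff)
  then have "amp \<sigma> S a (delta (fst l)) (fst m) = 0"
    using amp_out[of "fst m" \<sigma> S a] amp_delta_out[OF inj a, of "fst l"] by auto
  then show "op_tensor (amp \<sigma> S a) b (delta l) m = 0"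
    using op_tensor_matrix[OF a' b, of "fst l" "snd l" "fst m" "snd m"] by simp
qed (use assms in simp_all)

lemma amp_extend_right:
  fixes \<sigma> :: "'s \<times> 'b \<Rightarrow> 'c" and b :: "'d oper"
  assumes inj: "inj_on \<sigma> (S \<times> UNIV)" and a: "a \<in> bounded_ops" and b: "b \<in> bounded_ops"
  shows "amp (extend_right \<sigma>) S (op_tensor b a) = op_tensor b (amp \<sigma> S a)"
proof (rule amp_eq_matrixI[OF inj_extend_right[OF inj]])
  have a': "amp \<sigma> S a \<in> bounded_ops" using inj a by simp
  fix s s' and p q :: "'d \<times> 'b" assume s: "s \<in> S" "s' \<in> S"
  show "op_tensor b (amp \<sigma> S a) (delta (extend_right \<sigma> (s, p))) (extend_right \<sigma> (s', q))
      = (if s = s' then op_tensor b a (delta p) q else 0)"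
    by (cases p; cases q)
      (simp add: extend_right_def op_tensor_matrix[OF b a'] op_tensor_matrix[OF b a] amp_delta_apply[OF inj a s])
next
  have a': "amp \<sigma> S a \<in> bounded_ops" using inj a by simp
  fix l m :: "'d \<times> 'c" assume "l \<notin> extend_right \<sigma> ` (S \<times> UNIV) \<or> m \<notin> extend_right \<sigma> ` (S \<times> UNIV)"
  then have "snd l \<notin> \<sigma> ` (S \<times> UNIV) \<or> snd m \<notin> \<sigma> ` (S \<times> UNIV)"
    by (cases l; cases m) (force simp: extend_right_def image_iff)
  then have "amp \<sigma> S a (delta (snd l)) (snd m) = 0"
    using amp_out[of "snd m" \<sigma> S a] amp_delta_out[OF inj a, of "snd l"] by auto
  then show "op_tensor b (amp \<sigma> S a) (delta l) m = 0"
    using op_tensor_matrix[OF b a', of "fst l" "snd l" "fst m" "snd m"] by simp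
qed (use assms in simp_all)

text \<open>The \<open>unit\<close> component is a one-point set of slices: amplification along such
  a bijection is conjugation by a permutation of the basis. The same holds for
  \<open>assoc_idx\<close>.\<close>

definition flip_idx :: "unit \<times> 'i \<times> 'j \<Rightarrow> 'j \<times> 'i" where
  "flip_idx = (\<lambda>(u, i, j). (j, i))"

definition assoc_idx :: "unit \<times> ('i \<times> 'j) \<times> 'k \<Rightarrow> 'i \<times> 'j \<times> 'k" where
  "assoc_idx = (\<lambda>(u, (i, j), k). (i, j, k))"

definition op_flip :: "('i \<times> 'j) oper \<Rightarrow> ('j \<times> 'i) oper" where
  "op_flip = amp flip_idx UNIV"

lemma inj_flip: "inj_on flip_idx (UNIV \<times> UNIV)"
  by (auto simp: inj_on_def flip_idx_def assoc_idx_def)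

lemma normal_lin_flip: "normal_lin op_flip"
  unfolding op_flip_def by (rule normal_lin_amp[OF inj_flip])

lemma op_flip_comp:
  "S \<in> bounded_ops \<Longrightarrow> T \<in> bounded_ops \<Longrightarrow> op_flip (S \<circ> T) = op_flip S \<circ> op_flip T"
  unfolding op_flip_def by (rule amp_comp[OF inj_flip])

lemma op_flip_tensor:
  assumes a: "a \<in> bounded_ops" and b: "b \<in> bounded_ops"
  shows "op_flip (op_tensor a b) = op_tensor b a"
  unfolding op_flip_def
proof (rule amp_eq_matrixI[OF inj_flip])
  fix s s' :: unit and p q :: "'a \<times> 'b"
  show "op_tensor b a (delta (flip_idx (s, p))) (flip_idx (s', q)) =
       (if s = s' then op_tensor a b (delta p) q else 0)"
    by (cases p; cases q) (simp add: op_tensor_matrix a b flip_idx_def)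
next
  fix l m :: "'b \<times> 'a"
  assume "l \<notin> flip_idx ` (UNIV \<times> UNIV) \<or> m \<notin> flip_idx ` (UNIV \<times> UNIV)"
  then have False by (cases l; cases m) (force simp: image_iff flip_idx_def assoc_idx_def)
  then show "op_tensor b a (delta l) m = 0" ..
qed (use a b in simp_all)

lemma inj_assoc: "inj_on assoc_idx (UNIV \<times> UNIV)"
  by (auto simp: inj_on_def flip_idx_def assoc_idx_def)

lemma op_assoc_amp:
  assumes T: "T \<in> bounded_ops"
  shows "op_assoc T = amp assoc_idx UNIV T"
proof (rule ext)
  fix z :: "'a \<times> 'b \<times> 'c \<Rightarrow> complex"
  show "op_assoc T z = amp assoc_idx UNIV T z"
  proof (cases "z \<in> ell2")
    case True
    show ?thesis
    proof (rule amp_eqI[OF inj_assoc True, symmetric])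
      fix s :: unit and p :: "('a \<times> 'b) \<times> 'c"
      show "op_assoc T z (assoc_idx (s, p)) =
         T (\<lambda>i'. z (assoc_idx (s, i'))) p"
        by (cases p) (auto simp: op_assoc_def assoc_idx_def case_prod_unfold)
    qed (force simp: image_iff flip_idx_def assoc_idx_def)
  next
    case False
    have "(\<lambda>((i', j'), k'). z (i', j', k')) \<notin> ell2"
    proof
      assume *: "(\<lambda>((i', j'), k'). z (i', j', k')) \<in> ell2"
      have "inj (\<lambda>(i, j, k). ((i, j), k))" by (auto simp: inj_on_def)
      from ell2_reindex(1)[OF this *] have "z \<in> ell2" by (simp add: case_prod_unfold)
      with False show False ..
    qed
    then show ?thesis using bops_out[OF T] False
      by (simp add: op_assoc_def amp_not_ell2 fun_eq_iff)
  qed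
qed

lemma normal_lin_assoc: "normal_lin op_assoc"
  by (rule normal_lin_cong[OF normal_lin_amp[OF inj_assoc]]) (simp add: op_assoc_amp)

lemma op_assoc_comp:
  "S \<in> bounded_ops \<Longrightarrow> T \<in> bounded_ops \<Longrightarrow> op_assoc (S \<circ> T) = op_assoc S \<circ> op_assoc T"
  by (simp add: op_assoc_amp bops_comp amp_comp[OF inj_assoc])

lemma op_assoc_tensor:
  assumes a: "a \<in> bounded_ops" and b: "b \<in> bounded_ops" and c: "c \<in> bounded_ops"
  shows "op_assoc (op_tensor (op_tensor a b) c) = op_tensor a (op_tensor b c)"
proof -
  have "amp assoc_idx UNIV (op_tensor (op_tensor a b) c) = op_tensor a (op_tensor b c)"
  proof (rule amp_eq_matrixI[OF inj_assoc])
    fix s s' :: unit and p q :: "('a \<times> 'b) \<times> 'c"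
    show "op_tensor a (op_tensor b c) (delta (assoc_idx (s, p)))
        (assoc_idx (s', q)) =
         (if s = s' then op_tensor (op_tensor a b) c (delta p) q else 0)"
      by (cases p; cases q; cases "fst p"; cases "fst q") (simp add: op_tensor_matrix assms assoc_idx_def)
  next
    fix l m :: "'a \<times> 'b \<times> 'c"
    assume "l \<notin> assoc_idx ` (UNIV \<times> UNIV) \<or>
      m \<notin> assoc_idx ` (UNIV \<times> UNIV)"
    then have False by (cases l; cases m) (force simp: image_iff flip_idx_def assoc_idx_def)
    then show "op_tensor a (op_tensor b c) (delta l) m = 0" ..
  qed (use assms in simp_all)
  then show ?thesis by (simp add: op_assoc_amp assms)
qed

section \<open>Slices by vector functionals and von Neumann tensor products\<close>

lemma compress_matrix: "inj \<tau> \<Longrightarrow> compress \<tau> T (delta j) i = T (delta (\<tau> j)) (\<tau> i)"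
  by (simp add: compress_def push_delta)

lemma compress_tensor_right:
  assumes a: "a \<in> bounded_ops" and b: "b \<in> bounded_ops"
  shows "compress (\<lambda>i. (i, j)) (op_tensor a b) = op_scale (b (delta j) j) a"
proof -
  have inj: "inj (\<lambda>i. (i, j))" by (auto simp: inj_on_def)
  show ?thesis
    by (rule bops_eqI)
      (simp_all add: assms inj bops_scale_op compress_matrix[OF inj] op_tensor_matrix op_scale_apply)
qed

lemma compress_tensor_left:
  assumes a: "a \<in> bounded_ops" and b: "b \<in> bounded_ops"
  shows "compress (\<lambda>i. (j, i)) (op_tensor a b) = op_scale (a (delta j) j) b"
proof -
  have inj: "inj (\<lambda>i. (j, i))" by (auto simp: inj_on_def)
  show ?thesis
    by (rule bops_eqI)
      (simp_all add: assms inj bops_scale_op compress_matrix[OF inj] op_tensor_matrix op_scale_apply)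
qed

lemma star_monoid_tensor:
  assumes M: "star_monoid M e" and N: "star_monoid N f"
  shows "star_monoid {op_tensor a b | a b. a \<in> M \<and> b \<in> N} (op_tensor e f)"
proof -
  have b: "\<And>a. a \<in> M \<Longrightarrow> a \<in> bounded_ops" "\<And>a. a \<in> N \<Longrightarrow> a \<in> bounded_ops"
    and e: "e \<in> M" "f \<in> N"
    using M N by (auto simp: star_monoid_def)
  show ?thesis
    unfolding star_monoid_def
  proof (intro conjI ballI subsetI)
    fix T assume "T \<in> {op_tensor a b | a b. a \<in> M \<and> b \<in> N}"
    then obtain a c where T: "T = op_tensor a c" and ac: "a \<in> M" "c \<in> N" by auto
    show "T \<in> bounded_ops" using T ac b by simp
    show "op_tensor e f \<circ> T = T" "T \<circ> op_tensor e f = T"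
      using M N ac unfolding T by (simp_all add: op_tensor_comp b e star_monoid_def)
    show "op_adj T \<in> {op_tensor a b | a b. a \<in> M \<and> b \<in> N}"
    proof -
      have "op_adj T = op_tensor (op_adj a) (op_adj c)" unfolding T by (simp add: op_tensor_adj b ac)
      moreover have "op_adj a \<in> M" "op_adj c \<in> N" using M N ac by (auto simp: star_monoid_def)
      ultimately show ?thesis by blast
    qed
    fix R assume "R \<in> {op_tensor a b | a b. a \<in> M \<and> b \<in> N}"
    then obtain a' c' where R: "R = op_tensor a' c'" and ac': "a' \<in> M" "c' \<in> N" by auto
    have "T \<circ> R = op_tensor (a \<circ> a') (c \<circ> c')" unfolding T R by (simp add: op_tensor_comp b ac ac')
    moreover have "a \<circ> a' \<in> M" "c \<circ> c' \<in> N" using M N ac ac' by (auto simp: star_monoid_def)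
    ultimately show "T \<circ> R \<in> {op_tensor a b | a b. a \<in> M \<and> b \<in> N}" by blast
  qed (use e in auto)
qed

lemma
  assumes M: "von_neumann_algebra M" and N: "von_neumann_algebra N"
  shows vn_tensor_vna: "von_neumann_algebra (vn_tensor M N)"
    and vn_tensor_unit: "vn_unit (vn_tensor M N) = op_tensor (vn_unit M) (vn_unit N)"
    and vn_tensor_induct: "\<And>P. uw_subspace P \<Longrightarrow> (\<And>a b. a \<in> M \<Longrightarrow> b \<in> N \<Longrightarrow> op_tensor a b \<in> P)
      \<Longrightarrow> vn_tensor M N \<subseteq> P"
proof -
  note X = star_monoid_tensor[OF vna_star_monoid[OF M] vna_star_monoid[OF N]]
  show "von_neumann_algebra (vn_tensor M N)"
    "vn_unit (vn_tensor M N) = op_tensor (vn_unit M) (vn_unit N)"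
    unfolding vn_tensor_def by (rule vn_generated_vna[OF X], rule vn_generated_unit[OF X])
  show "vn_tensor M N \<subseteq> P" if "uw_subspace P" "\<And>a b. a \<in> M \<Longrightarrow> b \<in> N \<Longrightarrow> op_tensor a b \<in> P" for P
    unfolding vn_tensor_def by (rule vn_generated_induct[OF X that(1)]) (use that(2) in auto)
qed

lemma op_tensor_in_vn_tensor: "a \<in> M \<Longrightarrow> b \<in> N \<Longrightarrow> op_tensor a b \<in> vn_tensor M N"
  unfolding vn_tensor_def by (rule subsetD[OF vn_generated_superset]) auto

subsection \<open>Group von Neumann algebras\<close>

context group
begin

lemma left_regular_apply:
  "x \<in> ell2 \<Longrightarrow> left_regular G g x k = (if k \<in> carrier G then x (inv g \<otimes> k) else 0)"
  by (simp add: left_regular_def)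

lemma left_regular_bops [simp]:
  assumes g: "g \<in> carrier G"
  shows "left_regular G g \<in> bounded_ops"
proof (rule bounded_opsI[where C=1])
  fix x :: "'a \<Rightarrow> complex" and F :: "'a set" assume x: "x \<in> ell2" and F: "finite F"
  have inj: "inj_on (\<lambda>k. inv g \<otimes> k) (F \<inter> carrier G)"
    using g by (auto simp: inj_on_def)
  have "(\<Sum>k\<in>F. (cmod (left_regular G g x k))\<^sup>2) = (\<Sum>k\<in>F \<inter> carrier G. (cmod (x (inv g \<otimes> k)))\<^sup>2)"
    using F by (intro sum.mono_neutral_cong_right) (auto simp: left_regular_apply x)
  also have "\<dots> = (\<Sum>k\<in>(\<lambda>k. inv g \<otimes> k) ` (F \<inter> carrier G). (cmod (x k))\<^sup>2)"
    by (subst sum.reindex[OF inj]) simp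
  also have "\<dots> \<le> (ell2_norm x)\<^sup>2"
    by (rule ell2_sum_le) (use x F in auto)
  finally show "(\<Sum>k\<in>F. (cmod (left_regular G g x k))\<^sup>2) \<le> (1 * ell2_norm x)\<^sup>2" by simp
qed (auto simp: left_regular_def ell2_add ell2_scale)

lemma left_regular_delta:
  assumes g: "g \<in> carrier G" and h: "h \<in> carrier G"
  shows "left_regular G g (delta h) = delta (g \<otimes> h)"
proof
  fix k
  have "inv g \<otimes> k = h \<longleftrightarrow> k = g \<otimes> h" if "k \<in> carrier G"
    using that g h by (metis inv_solve_left)
  then show "left_regular G g (delta h) k = delta (g \<otimes> h) k"
    using g h by (auto simp: left_regular_apply delta_apply)
qed

lemma left_regular_delta_out:
  assumes g: "g \<in> carrier G" and h: "h \<notin> carrier G"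
  shows "left_regular G g (delta h) = (\<lambda>_. 0)"
  using g h by (auto simp: fun_eq_iff left_regular_apply delta_apply)

lemma left_regular_mult:
  assumes g: "g \<in> carrier G" and h: "h \<in> carrier G"
  shows "left_regular G g \<circ> left_regular G h = left_regular G (g \<otimes> h)"
proof (rule bops_eqI)
  fix k l
  show "(left_regular G g \<circ> left_regular G h) (delta l) k = left_regular G (g \<otimes> h) (delta l) k"
    using g h by (cases "l \<in> carrier G")
      (simp_all add: left_regular_delta left_regular_delta_out m_assoc bops_zero[OF left_regular_bops])
qed (use g h in \<open>simp_all add: bops_comp\<close>)

lemma left_regular_adj:
  assumes g: "g \<in> carrier G"
  shows "op_adj (left_regular G g) = left_regular G (inv g)"
proof (rule op_adj_eqI)
  fix k l
  have "inv g \<otimes> l = k \<longleftrightarrow> g \<otimes> k = l" if "k \<in> carrier G" "l \<in> carrier G"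
    using that g by (metis inv_solve_left)
  then show "left_regular G (inv g) (delta l) k = cnj (left_regular G g (delta k) l)"
    using g by (cases "k \<in> carrier G"; cases "l \<in> carrier G")
      (auto simp: left_regular_delta left_regular_delta_out delta_apply)
qed (use g in simp_all)

lemma star_monoid_left_regular: "star_monoid (left_regular G ` carrier G) (left_regular G \<one>)"
  unfolding star_monoid_def by (auto simp: left_regular_mult left_regular_adj)

lemma group_vn_vna: "von_neumann_algebra (group_vn G)"
  unfolding group_vn_def by (rule vn_generated_vna[OF star_monoid_left_regular])

lemma group_vn_unit: "vn_unit (group_vn G) = left_regular G \<one>"
  unfolding group_vn_def by (rule vn_generated_unit[OF star_monoid_left_regular])

lemma group_vn_induct:
  "uw_subspace N \<Longrightarrow> (\<And>g. g \<in> carrier G \<Longrightarrow> left_regular G g \<in> N) \<Longrightarrow> group_vn G \<subseteq> N"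
  unfolding group_vn_def by (rule vn_generated_induct[OF star_monoid_left_regular]) auto

lemma left_regular_in_group_vn: "g \<in> carrier G \<Longrightarrow> left_regular G g \<in> group_vn G"
  unfolding group_vn_def by (rule subsetD[OF vn_generated_superset]) auto

lemma group_vn_bops: "a \<in> group_vn G \<Longrightarrow> a \<in> bounded_ops"
  by (rule vna_bops[OF group_vn_vna])

text \<open>This is commutation with the right translations; it makes \<open>\<delta>\<^sub>1\<close> a separating vector.\<close>

lemma group_vn_delta:
  assumes a: "a \<in> group_vn G" and h: "h \<in> carrier G" and k: "k \<in> carrier G"
  shows "a (delta h) k = a (delta \<one>) (k \<otimes> inv h)"
proof -
  have "group_vn G \<subseteq> {T \<in> bounded_ops. T (delta h) k = T (delta \<one>) (k \<otimes> inv h)}"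
  proof (rule group_vn_induct)
    show "uw_subspace {T \<in> bounded_ops. T (delta h) k = T (delta \<one>) (k \<otimes> inv h)}"
      by (intro uw_subspace_fun_equalizer normal_fun_apply) auto
    fix g assume g: "g \<in> carrier G"
    have "k = g \<otimes> h \<longleftrightarrow> k \<otimes> inv h = g"
      using g h k by (metis inv_solve_right m_closed)
    then show "left_regular G g \<in> {T \<in> bounded_ops. T (delta h) k = T (delta \<one>) (k \<otimes> inv h)}"
      using g h k by (auto simp: left_regular_delta delta_apply)
  qed
  then show ?thesis using a by auto
qed

lemma group_vn_delta_out:
  assumes a: "a \<in> group_vn G" and hk: "h \<notin> carrier G \<or> k \<notin> carrier G"
  shows "a (delta h) k = 0"
proof -
  have "group_vn G \<subseteq> {T \<in> bounded_ops. T (delta h) k = 0}"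
    by (rule group_vn_induct[OF uw_subspace_kernel[OF normal_fun_apply]])
      (use hk in \<open>auto simp: left_regular_apply delta_apply\<close>)
  then show ?thesis using a by auto
qed

section \<open>The canonical trace\<close>

definition group_trace :: "'a oper \<Rightarrow> complex" where
  "group_trace a = a (delta \<one>) \<one>"

lemma normal_fun_group_trace: "normal_fun group_trace"
  unfolding group_trace_def[abs_def] by (rule normal_fun_apply) simp

lemma group_trace_left_regular:
  "g \<in> carrier G \<Longrightarrow> group_trace (left_regular G g) = of_bool (g = \<one>)"
  by (auto simp: group_trace_def left_regular_delta delta_apply)

text \<open>The value on \<open>op_adj a \<circ> a\<close> is the squared norm of
  \<open>a (delta \<one>)\<close>. If it is zero, all entries of \<open>a\<close> vanish, since
  right translation moves every column to the column of the unit.\<close>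

lemma group_trace_faithful: "faithful_normal_state (group_vn G) group_trace"
proof -
  have sq: "group_trace (op_adj a \<circ> a) = of_real ((ell2_norm (a (delta \<one>)))\<^sup>2)" if "a \<in> group_vn G" for a
  proof -
    have a: "a \<in> bounded_ops" using that by (rule group_vn_bops)
    have "group_trace (op_adj a \<circ> a) = ell2_inner (delta \<one>) (op_adj a (a (delta \<one>)))"
      by (simp add: group_trace_def)
    also have "\<dots> = ell2_inner (a (delta \<one>)) (a (delta \<one>))"
      by (rule op_adj_inner'[OF a delta_ell2 bops_ell2[OF a]])
    also have "\<dots> = of_real ((ell2_norm (a (delta \<one>)))\<^sup>2)"
      by (rule ell2_inner_self[OF bops_ell2[OF a]])
    finally show ?thesis .
  qed
  show ?thesis
    unfolding faithful_normal_state_def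
  proof (intro conjI ballI allI impI)
    fix a assume a: "a \<in> group_vn G"
    show "group_trace (op_adj a \<circ> a) \<in> \<real>\<^sub>\<ge>\<^sub>0"
      unfolding sq[OF a] by (simp only: nonneg_Reals_of_real_iff) simp
    assume "group_trace (op_adj a \<circ> a) = 0"
    then have "ell2_norm (a (delta \<one>)) = 0" unfolding sq[OF a] by simp
    then have z: "a (delta \<one>) k = 0" for k
      using ell2_coeff_le[OF bops_ell2[OF group_vn_bops[OF a]], of "delta \<one>" k] by simp
    show "a = (\<lambda>_ _. 0)"
    proof (rule bops_eqI[OF group_vn_bops[OF a] bops_zero_op])
      fix k h
      show "a (delta h) k = 0"
        using group_vn_delta[OF a, of h k] group_vn_delta_out[OF a, of h k] z
        by (cases "h \<in> carrier G \<and> k \<in> carrier G") auto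
    qed
  next
    show "group_trace (vn_unit (group_vn G)) = 1"
      by (simp add: group_vn_unit group_trace_left_regular)
    show "continuous_map (subtopology ultraweak (group_vn G)) euclidean group_trace"
      using normal_fun_group_trace by (intro continuous_map_from_subtopology) (simp add: normal_fun_def)
  qed (use normal_fun_group_trace group_vn_bops in \<open>auto simp: normal_fun_def\<close>)
qed

text \<open>On group elements this says that gh = 1 exactly when hg = 1. It is extended to one
  factor with the other a fixed group element, and only then to the second factor.\<close>

lemma group_trace_commute:
  assumes a: "a \<in> group_vn G" and b: "b \<in> group_vn G"
  shows "group_trace (a \<circ> b) = group_trace (b \<circ> a)"
proof -
  have 1: "group_trace (left_regular G g \<circ> b) = group_trace (b \<circ> left_regular G g)"
    if g: "g \<in> carrier G" and b: "b \<in> group_vn G" for g b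
  proof -
    have gb: "left_regular G g \<in> bounded_ops" using g by simp
    have "group_vn G \<subseteq> {b \<in> bounded_ops. group_trace (left_regular G g \<circ> b) = group_trace (b \<circ> left_regular G g)}"
    proof (rule group_vn_induct)
      show "uw_subspace {b \<in> bounded_ops. group_trace (left_regular G g \<circ> b) = group_trace (b \<circ> left_regular G g)}"
        by (intro uw_subspace_fun_equalizer normal_fun_compose[OF normal_lin_mult_left[OF gb] normal_fun_group_trace]
          normal_fun_compose[OF normal_lin_mult_right[OF gb] normal_fun_group_trace])
      fix h assume h: "h \<in> carrier G"
      then have "g \<otimes> h = \<one> \<longleftrightarrow> h \<otimes> g = \<one>" using g by (metis inv_comm)
      then show "left_regular G h \<in> {b \<in> bounded_ops. group_trace (left_regular G g \<circ> b) = group_trace (b \<circ> left_regular G g)}"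
        using g h by (simp add: left_regular_mult group_trace_left_regular)
    qed
    then show ?thesis using b by auto
  qed
  have bb: "b \<in> bounded_ops" by (rule group_vn_bops[OF b])
  have "group_vn G \<subseteq> {a \<in> bounded_ops. group_trace (a \<circ> b) = group_trace (b \<circ> a)}"
  proof (rule group_vn_induct)
    show "uw_subspace {a \<in> bounded_ops. group_trace (a \<circ> b) = group_trace (b \<circ> a)}"
      by (intro uw_subspace_fun_equalizer normal_fun_compose[OF normal_lin_mult_left[OF bb] normal_fun_group_trace]
        normal_fun_compose[OF normal_lin_mult_right[OF bb] normal_fun_group_trace])
  qed (use 1[OF _ b] in auto)
  then show ?thesis using a by auto
qed

text \<open>
  The comultiplication is implemented by the unitary \<open>\<delta>\<^sub>k \<otimes> \<delta>\<^sub>s \<mapsto> \<delta>\<^sub>k \<otimes> \<delta>\<^sub>k\<^sub>s\<close>. The values of the index map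
  at \<open>k \<notin> carrier G\<close> are irrelevant and only chosen to make it injective.
\<close>

definition comult_idx :: "'a \<times> 'a \<Rightarrow> 'a \<times> 'a" where
  "comult_idx = (\<lambda>(s, k). if k \<in> carrier G then (k, k \<otimes> s) else (k, s))"

definition comult :: "'a oper \<Rightarrow> ('a \<times> 'a) oper" where
  "comult = amp comult_idx (carrier G)"

lemma inj_comult_idx: "inj_on comult_idx (carrier G \<times> UNIV)"
  by (auto simp: inj_on_def comult_idx_def split: if_splits)

lemma range_comult_idx:
  "k \<in> carrier G \<Longrightarrow> l \<in> carrier G \<Longrightarrow> (k, l) \<in> comult_idx ` (carrier G \<times> UNIV)"
  by (rule image_eqI[of _ _ "(inv k \<otimes> l, k)"]) (auto simp: comult_idx_def m_assoc[symmetric])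

lemma normal_lin_comult: "normal_lin comult"
  unfolding comult_def by (rule normal_lin_amp[OF inj_comult_idx])

text \<open>The coordinates (s, k) stand for the basis vector at (k, ks). Diagonal left translation
  by \<open>g\<close> sends it to (gk, gks): it fixes \<open>s\<close> and translates
  \<open>k\<close>, which is the block pattern of an amplification.\<close>

lemma comult_left_regular:
  assumes g: "g \<in> carrier G"
  shows "comult (left_regular G g) = op_tensor (left_regular G g) (left_regular G g)"
  unfolding comult_def
proof (rule amp_eq_matrixI[OF inj_comult_idx])
  have gb: "left_regular G g \<in> bounded_ops" using g by simp
  fix s s' i j assume s: "s \<in> carrier G" "s' \<in> carrier G"
  show "op_tensor (left_regular G g) (left_regular G g) (delta (comult_idx (s, i))) (comult_idx (s', j)) =
       (if s = s' then left_regular G g (delta i) j else 0)"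
  proof (cases "i \<in> carrier G")
    case i: True
    have "g \<otimes> i \<otimes> s = g \<otimes> i \<otimes> s' \<longleftrightarrow> s = s'" using g i s by simp
    then show ?thesis using g i s
      by (auto simp: comult_idx_def op_tensor_matrix gb left_regular_delta delta_apply m_assoc)
  qed (use g in \<open>simp add: comult_idx_def op_tensor_matrix gb left_regular_delta_out split: prod.split\<close>)
next
  have gb: "left_regular G g \<in> bounded_ops" using g by simp
  fix l m assume *: "l \<notin> comult_idx ` (carrier G \<times> UNIV) \<or> m \<notin> comult_idx ` (carrier G \<times> UNIV)"
  obtain l1 l2 m1 m2 where lm: "l = (l1, l2)" "m = (m1, m2)" by (cases l; cases m)
  from * have "l1 \<notin> carrier G \<or> l2 \<notin> carrier G \<or> m1 \<notin> carrier G \<or> m2 \<notin> carrier G"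
    unfolding lm using range_comult_idx by blast
  then show "op_tensor (left_regular G g) (left_regular G g) (delta l) m = 0"
    unfolding lm op_tensor_matrix[OF gb gb]
    using g by (auto simp: left_regular_apply delta_apply)
qed (use g in simp_all)

lemma comult_in:
  assumes "a \<in> group_vn G"
  shows "comult a \<in> vn_tensor (group_vn G) (group_vn G)"
proof -
  have "group_vn G \<subseteq> {a \<in> bounded_ops. comult a \<in> vn_tensor (group_vn G) (group_vn G)}"
    by (rule group_vn_induct[OF uw_subspace_preimage[OF normal_lin_comult vna_subspace[OF vn_tensor_vna[OF group_vn_vna group_vn_vna]]]])
      (simp add: comult_left_regular op_tensor_in_vn_tensor left_regular_in_group_vn)
  then show ?thesis using assms by auto
qed

lemma comult_comp: "a \<in> bounded_ops \<Longrightarrow> b \<in> bounded_ops \<Longrightarrow> comult (a \<circ> b) = comult a \<circ> comult b"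
  unfolding comult_def by (rule amp_comp[OF inj_comult_idx])

lemma comult_adj: "a \<in> bounded_ops \<Longrightarrow> comult (op_adj a) = op_adj (comult a)"
  unfolding comult_def by (rule amp_adj[OF inj_comult_idx])

lemma comult_injective: "a \<in> bounded_ops \<Longrightarrow> b \<in> bounded_ops \<Longrightarrow> comult a = comult b \<Longrightarrow> a = b"
  unfolding comult_def by (rule amp_injective[OF inj_comult_idx]) auto

lemma comult_star_hom: "star_hom (group_vn G) (vn_tensor (group_vn G) (group_vn G)) comult"
  unfolding star_hom_def
  using normal_lin_linear_map[OF normal_lin_comult, of "group_vn G"] comult_in group_vn_bops
  by (auto simp: comult_comp comult_adj)

text \<open>Cocommutativity, the invariant that distinguishes the group comultiplication from its
  twist.\<close>

lemma flip_comult: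
  assumes "a \<in> group_vn G"
  shows "op_flip (comult a) = comult a"
proof -
  have "group_vn G \<subseteq> {a \<in> bounded_ops. op_flip (comult a) = comult a}"
    by (rule group_vn_induct[OF uw_subspace_equalizer[OF normal_lin_compose[OF normal_lin_comult normal_lin_flip] normal_lin_comult]])
      (simp add: comult_left_regular op_flip_tensor)
  then show ?thesis using assms by auto
qed

text \<open>Here \<open>D\<close> is controlled on \<open>L(G)\<close> only and is continuous for
  the subspace topology, so the equalizer of globally normal maps does not apply. The agreement set
  is closed in \<open>L(G)\<close>, and \<open>L(G)\<close> is itself ultraweakly closed.\<close>

lemma group_comult_eq_aux:
  assumes D: "linear_map (group_vn G) (vn_tensor (group_vn G) (group_vn G)) D"
    and n: "normal_map (group_vn G) (vn_tensor (group_vn G) (group_vn G)) D"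
    and u: "\<And>g. g \<in> carrier G \<Longrightarrow> D (left_regular G g) = op_tensor (left_regular G g) (left_regular G g)"
    and a: "a \<in> group_vn G"
  shows "D a = comult a"
proof -
  let ?M = "group_vn G"
  let ?N = "{a \<in> ?M. D a = comult a}"
  have sub: "uw_subspace ?M" by (rule vna_subspace[OF group_vn_vna])
  have top: "topspace (subtopology ultraweak ?M) = ?M" using group_vn_bops by auto
  have cD: "continuous_map (subtopology ultraweak ?M) ultraweak D"
    using n unfolding normal_map_def by (rule continuous_map_into_fulltopology)
  have cd: "continuous_map (subtopology ultraweak ?M) ultraweak comult"
    by (rule continuous_map_from_subtopology[OF normal_lin_continuous[OF normal_lin_comult]])
  have "closedin (subtopology ultraweak ?M) ?N"
    using closedin_continuous_maps_eq[OF Hausdorff_ultraweak cD cd] unfolding top .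
  then have cl: "closedin ultraweak ?N"
    using sub closedin_trans_full unfolding uw_subspace_def by blast
  have D0: "D (\<lambda>_ _. 0) = (\<lambda>_ _. 0)"
  proof -
    have "(\<lambda>_ _. 0) \<in> ?M" using sub by (simp add: uw_subspace_def)
    then have "D (op_scale 0 (\<lambda>_ _. 0)) = op_scale 0 (D (\<lambda>_ _. 0))"
      using D by (simp add: linear_map_def)
    then show ?thesis by (simp add: op_scale_zero)
  qed
  have "uw_subspace ?N"
    unfolding uw_subspace_def
  proof (intro conjI ballI allI)
    show "(\<lambda>_ _. 0) \<in> ?N" using D0 normal_lin_zero[OF normal_lin_comult] sub by (simp add: uw_subspace_def)
    show "op_add a b \<in> ?N" if "a \<in> ?N" "b \<in> ?N" for a b
      using that D sub group_vn_bops normal_lin_add[OF normal_lin_comult]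
      by (simp add: linear_map_def uw_subspace_def)
    show "op_scale c a \<in> ?N" if "a \<in> ?N" for a c
      using that D sub group_vn_bops normal_lin_scale[OF normal_lin_comult]
      by (simp add: linear_map_def uw_subspace_def)
  qed (rule cl)
  then have "?M \<subseteq> ?N"
    by (rule group_vn_induct) (simp add: u left_regular_in_group_vn comult_left_regular)
  then show ?thesis using a by auto
qed

text \<open>The restriction of \<open>comult\<close> satisfies the conditions of the definite
  description, and normality together with the values on group elements leaves no other extensional
  candidate.\<close>

lemma group_comult_eq:
  assumes a: "a \<in> group_vn G"
  shows "group_comult G a = comult a"
proof -
  let ?M = "group_vn G"
  have "group_comult G = restrict comult ?M"
    unfolding group_comult_def
  proof (rule the_equality, intro conjI ballI)
    have sub: "von_neumann_algebra ?M" by (rule group_vn_vna)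
    show "star_hom ?M (vn_tensor ?M ?M) (restrict comult ?M)"
      using comult_star_hom sub
      by (auto simp: star_hom_def linear_map_def von_neumann_algebra_def)
    show "normal_map ?M (vn_tensor ?M ?M) (restrict comult ?M)"
      unfolding normal_map_def
      by (rule continuous_map_eq[OF normal_lin_normal_map[OF normal_lin_comult comult_in, unfolded normal_map_def]]) auto
    show "restrict comult ?M (left_regular G g) = op_tensor (left_regular G g) (left_regular G g)"
      if "g \<in> carrier G" for g
      using that by (simp add: left_regular_in_group_vn comult_left_regular)
  next
    fix D assume D: "D \<in> extensional ?M \<and> star_hom ?M (vn_tensor ?M ?M) D \<and>
      normal_map ?M (vn_tensor ?M ?M) D \<and>
      (\<forall>g\<in>carrier G. D (left_regular G g) = op_tensor (left_regular G g) (left_regular G g))"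
    have "D x = comult x" if "x \<in> ?M" for x
      using D that by (intro group_comult_eq_aux) (auto simp: star_hom_def)
    then show "D = restrict comult ?M"
      using D by (intro extensionalityI[of D ?M]) auto
  qed simp
  then show ?thesis using a by simp
qed

end

subsection \<open>Finite linear combinations of operators\<close>

definition opsum :: "'k set \<Rightarrow> ('k \<Rightarrow> complex) \<Rightarrow> ('k \<Rightarrow> 'i oper) \<Rightarrow> 'i oper" where
  "opsum K d T = (\<lambda>z i. \<Sum>k\<in>K. d k * T k z i)"

lemma opsum_apply: "opsum K d T z i = (\<Sum>k\<in>K. d k * T k z i)"
  by (simp add: opsum_def)

lemma opsum_empty: "opsum {} d T = (\<lambda>_ _. 0)"
  by (simp add: opsum_def)

lemma opsum_insert:
  "finite K \<Longrightarrow> k \<notin> K \<Longrightarrow> opsum (insert k K) d T = op_add (op_scale (d k) (T k)) (opsum K d T)"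
  by (simp add: opsum_def op_add_def op_scale_def)

lemma opsum_in_subspace:
  assumes "uw_subspace N" "finite K" "\<And>k. k \<in> K \<Longrightarrow> T k \<in> N"
  shows "opsum K d T \<in> N"
  using assms(2,3)
proof (induction K rule: finite_induct)
  case empty
  then show ?case using assms(1) by (simp add: opsum_empty uw_subspace_def)
next
  case (insert k K)
  then show ?case using assms(1) by (simp add: opsum_insert uw_subspace_def)
qed

lemma opsum_bops: "finite K \<Longrightarrow> (\<And>k. k \<in> K \<Longrightarrow> T k \<in> bounded_ops) \<Longrightarrow> opsum K d T \<in> bounded_ops"
  by (rule opsum_in_subspace[OF uw_subspace_UNIV])

lemma opsum_cong:
  "(\<And>k. k \<in> K \<Longrightarrow> T k = S k) \<Longrightarrow> (\<And>k. k \<in> K \<Longrightarrow> d k = e k) \<Longrightarrow> opsum K d T = opsum K e S"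
  by (simp add: opsum_def)

lemma linear_map_opsum:
  assumes f: "linear_map M N f" and M: "uw_subspace M" and "finite K" "\<And>k. k \<in> K \<Longrightarrow> T k \<in> M"
  shows "f (opsum K d T) = opsum K d (\<lambda>k. f (T k))"
  using assms(3,4)
proof (induction K rule: finite_induct)
  case empty
  have "(\<lambda>_ _. 0) \<in> M" using M by (simp add: uw_subspace_def)
  then have "f (op_scale 0 (\<lambda>_ _. 0)) = op_scale 0 (f (\<lambda>_ _. 0))"
    using f by (simp add: linear_map_def)
  then show ?case by (simp add: opsum_empty op_scale_zero)
next
  case (insert k K)
  have "opsum K d T \<in> M" by (rule opsum_in_subspace[OF M]) (use insert in auto)
  moreover have "op_scale (d k) (T k) \<in> M" using insert M by (simp add: uw_subspace_def)
  ultimately show ?case using insert f by (simp add: opsum_insert linear_map_def)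
qed

lemma normal_lin_opsum:
  assumes "normal_lin \<Phi>" "finite K" "\<And>k. k \<in> K \<Longrightarrow> T k \<in> bounded_ops"
  shows "\<Phi> (opsum K d T) = opsum K d (\<lambda>k. \<Phi> (T k))"
  by (rule linear_map_opsum[OF normal_lin_linear_map[of \<Phi> bounded_ops bounded_ops] uw_subspace_UNIV])
    (use assms normal_lin_bops[OF assms(1)] in auto)

lemma opsum_comp:
  assumes "finite K" "finite L" "\<And>k. k \<in> K \<Longrightarrow> T k \<in> bounded_ops" "\<And>l. l \<in> L \<Longrightarrow> S l \<in> bounded_ops"
  shows "opsum K d T \<circ> opsum L e S = opsum (K \<times> L) (\<lambda>(k, l). d k * e l) (\<lambda>(k, l). T k \<circ> S l)"
proof (intro ext)
  fix z i
  have "T k (\<lambda>i. \<Sum>l\<in>L. e l * S l z i) = (\<lambda>i. \<Sum>l\<in>L. e l * T k (S l z) i)" if "k \<in> K" for k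
    by (rule bops_sum) (use that assms bops_ell2 in auto)
  then have "(opsum K d T \<circ> opsum L e S) z i = (\<Sum>k\<in>K. d k * (\<Sum>l\<in>L. e l * T k (S l z) i))"
    by (simp add: opsum_def)
  also have "\<dots> = opsum (K \<times> L) (\<lambda>(k, l). d k * e l) (\<lambda>(k, l). T k \<circ> S l) z i"
    by (simp add: opsum_def sum_distrib_left sum.cartesian_product case_prod_unfold mult.assoc)
  finally show "(opsum K d T \<circ> opsum L e S) z i
      = opsum (K \<times> L) (\<lambda>(k, l). d k * e l) (\<lambda>(k, l). T k \<circ> S l) z i" .
qed

lemma opsum_collapse:
  assumes "finite I" "i0 \<in> I"
  shows "opsum I c (\<lambda>k. op_scale (of_bool (k = i0)) T) = op_scale (c i0) T"
proof (intro ext)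
  fix z i
  have "(\<Sum>k\<in>I. c k * (of_bool (k = i0) * T z i)) = (\<Sum>k\<in>I. if k = i0 then c k * T z i else 0)"
    by (rule sum.cong) auto
  also have "\<dots> = c i0 * T z i" using assms by simp
  finally show "opsum I c (\<lambda>k. op_scale (of_bool (k = i0)) T) z i = op_scale (c i0) T z i"
    by (simp add: opsum_apply op_scale_apply)
qed

lemma opsum_adj:
  assumes "finite K" "\<And>k. k \<in> K \<Longrightarrow> T k \<in> bounded_ops"
  shows "op_adj (opsum K d T) = opsum K (\<lambda>k. cnj (d k)) (\<lambda>k. op_adj (T k))"
  by (rule op_adj_eqI) (use assms in \<open>simp_all add: opsum_bops opsum_apply op_adj_matrix\<close>)

lemma normal_lin_tensor_left:
  assumes b: "b \<in> bounded_ops"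
  shows "normal_lin (\<lambda>a. op_tensor a b)"
  by (rule normal_lin_cong[OF normal_lin_compose[OF normal_lin_amp[OF inj_swap_UNIV]
      normal_lin_mult_right[of "amp id UNIV b"]]]) (simp_all add: b op_tensor_amp)

lemma normal_lin_tensor_right:
  assumes a: "a \<in> bounded_ops"
  shows "normal_lin (\<lambda>b. op_tensor a b)"
  by (rule normal_lin_cong[OF normal_lin_compose[OF normal_lin_amp[of id UNIV]
      normal_lin_mult_left[OF amp_bops[OF inj_swap_UNIV a]]]]) (simp_all add: a op_tensor_amp)

lemma op_tensor_scale:
  assumes "a \<in> bounded_ops" "b \<in> bounded_ops"
  shows "op_tensor (op_scale c a) b = op_scale c (op_tensor a b)"
    "op_tensor a (op_scale c b) = op_scale c (op_tensor a b)"
    "op_tensor (op_scale c a) (op_scale c' b) = op_scale (c * c') (op_tensor a b)"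
proof -
  have l: "op_tensor (op_scale c a) b = op_scale c (op_tensor a b)" for c
    by (rule normal_lin_scale[OF normal_lin_tensor_left]) (rule assms)+
  have r: "op_tensor a (op_scale c b) = op_scale c (op_tensor a b)" if "a \<in> bounded_ops" for a c
    by (rule normal_lin_scale[OF normal_lin_tensor_right]) (rule assms that)+
  show "op_tensor (op_scale c a) b = op_scale c (op_tensor a b)"
    "op_tensor a (op_scale c b) = op_scale c (op_tensor a b)"
    by (rule l, rule r[OF assms(1)])
  show "op_tensor (op_scale c a) (op_scale c' b) = op_scale (c * c') (op_tensor a b)"
    by (simp add: r[OF bops_scale_op[OF assms(1)]] l) (simp add: op_scale_def mult_ac)
qed

text \<open>
  It is enough to slice with matrix coefficients, one leg at a time, so no normality of the tensor
  product map is involved.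
\<close>

lemma algebraic_tensor_injective:
  assumes f: "linear_map M N f" and inj: "inj_on f M" and M: "uw_subspace M" and N: "N \<subseteq> bounded_ops"
    and K: "finite K" and ab: "\<And>k. k \<in> K \<Longrightarrow> a k \<in> M" "\<And>k. k \<in> K \<Longrightarrow> b k \<in> M"
    and z: "opsum K d (\<lambda>k. op_tensor (f (a k)) (f (b k))) = (\<lambda>_ _. 0)"
  shows "opsum K d (\<lambda>k. op_tensor (a k) (b k)) = (\<lambda>_ _. 0)"
proof -
  have Mb: "T \<in> bounded_ops" if "T \<in> M" for T using uw_subspace_bops[OF M that] .
  have fN: "f T \<in> N" if "T \<in> M" for T using f that by (auto simp: linear_map_def)
  then have fb: "f T \<in> bounded_ops" if "T \<in> M" for T using N that by auto
  have M0: "(\<lambda>_ _. 0) \<in> M" using M by (simp add: uw_subspace_def)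
  have f0: "f (\<lambda>_ _. 0) = (\<lambda>_ _. 0)"
  proof -
    have "f (op_scale 0 (\<lambda>_ _. 0)) = op_scale 0 (f (\<lambda>_ _. 0))" using f M0 by (simp add: linear_map_def)
    then show ?thesis by (simp add: op_scale_zero)
  qed
  have inj0: "opsum K e c = (\<lambda>_ _. 0)"
    if "\<And>k. k \<in> K \<Longrightarrow> c k \<in> M" "\<And>i j. (\<Sum>k\<in>K. e k * f (c k) (delta i) j) = 0" for e c
  proof -
    have m: "opsum K e c \<in> M" by (rule opsum_in_subspace[OF M K that(1)])
    have "f (opsum K e c) = opsum K e (\<lambda>k. f (c k))" by (rule linear_map_opsum[OF f M K that(1)])
    also have "\<dots> = (\<lambda>_ _. 0)"
      by (rule bops_eqI[OF opsum_bops[OF K] bops_zero_op]) (simp_all add: fb that(1), simp add: opsum_def that(2))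
    finally show ?thesis using inj_onD[OF inj _ m M0] f0 by simp
  qed
  have 1: "(\<Sum>k\<in>K. d k * f (a k) (delta i) j * f (b k) (delta i') j') = 0" for i j i' j'
  proof -
    have "opsum K d (\<lambda>k. op_tensor (f (a k)) (f (b k))) (delta (i, i')) (j, j') = 0" by (simp add: z)
    then show ?thesis by (simp add: opsum_def op_tensor_matrix fb ab mult.assoc)
  qed
  \<comment> \<open>The entries of the first leg are now scalars, so \<open>inj0\<close> removes
    \<open>f\<close> from the second leg; the next statement then treats the entries of the second
    leg as scalars and removes \<open>f\<close> from the first.\<close>
  have 2: "(\<Sum>k\<in>K. d k * f (a k) (delta i) j * b k (delta i') j') = 0" for i j i' j'
  proof -
    have "opsum K (\<lambda>k. d k * f (a k) (delta i) j) b = (\<lambda>_ _. 0)"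
      by (rule inj0) (simp_all add: ab 1)
    then have "opsum K (\<lambda>k. d k * f (a k) (delta i) j) b (delta i') j' = 0" by simp
    then show ?thesis by (simp add: opsum_def)
  qed
  have 3: "(\<Sum>k\<in>K. d k * b k (delta i') j' * a k (delta i) j) = 0" for i j i' j'
  proof -
    have "opsum K (\<lambda>k. d k * b k (delta i') j') a = (\<lambda>_ _. 0)"
      by (rule inj0) (use 2 in \<open>simp_all add: ab mult_ac\<close>)
    then have "opsum K (\<lambda>k. d k * b k (delta i') j') a (delta i) j = 0" by simp
    then show ?thesis by (simp add: opsum_def)
  qed
  show ?thesis
  proof (rule op_tensor_eqI)
    show "opsum K d (\<lambda>k. op_tensor (a k) (b k)) \<in> bounded_ops"
      by (rule opsum_bops[OF K]) (simp add: ab Mb)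
    fix i j k l
    show "opsum K d (\<lambda>k. op_tensor (a k) (b k)) (delta (i, j)) (k, l) = 0"
      using 3[of j l i k] by (simp add: opsum_def op_tensor_matrix ab Mb mult_ac)
  qed simp
qed

subsection \<open>Twisting by a unitary 2-cocycle supported on a finite abelian subgroup\<close>

context group
begin

definition sub_vn :: "'a set \<Rightarrow> 'a oper set" where
  "sub_vn H = vn_generated (left_regular G ` H)"

lemma star_monoid_sub:
  assumes "subgroup H G"
  shows "star_monoid (left_regular G ` H) (left_regular G \<one>)"
proof -
  have "H \<subseteq> carrier G" by (rule subgroup.subset[OF assms])
  then show ?thesis
    using subgroup.one_closed[OF assms] subgroup.m_closed[OF assms] subgroup.m_inv_closed[OF assms]
    unfolding star_monoid_def by (auto simp: left_regular_mult left_regular_adj subset_iff)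
qed

lemma sub_vn_vna: "subgroup H G \<Longrightarrow> von_neumann_algebra (sub_vn H)"
  unfolding sub_vn_def by (rule vn_generated_vna[OF star_monoid_sub])

lemma sub_vn_induct:
  "subgroup H G \<Longrightarrow> uw_subspace N \<Longrightarrow> (\<And>g. g \<in> H \<Longrightarrow> left_regular G g \<in> N) \<Longrightarrow> sub_vn H \<subseteq> N"
  unfolding sub_vn_def by (rule vn_generated_induct[OF star_monoid_sub]) auto

lemma left_regular_in_sub_vn: "g \<in> H \<Longrightarrow> left_regular G g \<in> sub_vn H"
  unfolding sub_vn_def by (rule subsetD[OF vn_generated_superset]) auto

lemma sub_vn_subset: "subgroup H G \<Longrightarrow> sub_vn H \<subseteq> group_vn G"
  by (rule sub_vn_induct[OF _ vna_subspace[OF group_vn_vna]])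
    (auto intro: left_regular_in_group_vn dest: subgroup.mem_carrier)

text \<open>An elementary tensor is normal in each leg separately, so each leg in turn may be
  replaced by a translation.\<close>

lemma sub_vn_tensor_induct:
  assumes H: "subgroup H G" and N: "uw_subspace N"
    and u: "\<And>s t. s \<in> H \<Longrightarrow> t \<in> H \<Longrightarrow> op_tensor (left_regular G s) (left_regular G t) \<in> N"
  shows "vn_tensor (sub_vn H) (sub_vn H) \<subseteq> N"
proof (rule vn_tensor_induct[OF sub_vn_vna[OF H] sub_vn_vna[OF H] N])
  have b: "a \<in> bounded_ops" if "a \<in> sub_vn H" for a using vna_bops[OF sub_vn_vna[OF H] that] .
  have ub: "left_regular G s \<in> bounded_ops" if "s \<in> H" for s
    using that subgroup.mem_carrier[OF H] by simp
  have 1: "op_tensor (left_regular G s) c \<in> N" if s: "s \<in> H" and c: "c \<in> sub_vn H" for s c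
  proof -
    have "sub_vn H \<subseteq> {c \<in> bounded_ops. op_tensor (left_regular G s) c \<in> N}"
      by (rule sub_vn_induct[OF H uw_subspace_preimage[OF normal_lin_tensor_right[OF ub[OF s]] N]])
        (simp add: ub u s)
    then show ?thesis using c by auto
  qed
  fix a c assume a: "a \<in> sub_vn H" and c: "c \<in> sub_vn H"
  have "sub_vn H \<subseteq> {a \<in> bounded_ops. op_tensor a c \<in> N}"
    by (rule sub_vn_induct[OF H uw_subspace_preimage[OF normal_lin_tensor_left[OF b[OF c]] N]])
      (simp add: ub 1 c)
  then show "op_tensor a c \<in> N" using a by auto
qed

text \<open>The map \<Delta> \<otimes> id as a formula on all operators, which gives a meaning to
  (\<Delta> \<otimes> id)(\<Omega>) in the cocycle identity; \<open>comult_right\<close> is id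
  \<otimes> \<Delta>.\<close>

definition comult_left :: "('a \<times> 'a) oper \<Rightarrow> (('a \<times> 'a) \<times> 'a) oper" where
  "comult_left = amp (extend_left comult_idx) (carrier G)"

definition comult_right :: "('a \<times> 'a) oper \<Rightarrow> ('a \<times> 'a \<times> 'a) oper" where
  "comult_right = amp (extend_right comult_idx) (carrier G)"

lemma normal_lin_comult_left: "normal_lin comult_left"
  unfolding comult_left_def by (rule normal_lin_amp[OF inj_extend_left[OF inj_comult_idx]])

lemma normal_lin_comult_right: "normal_lin comult_right"
  unfolding comult_right_def by (rule normal_lin_amp[OF inj_extend_right[OF inj_comult_idx]])

lemma comult_left_tensor:
  "a \<in> bounded_ops \<Longrightarrow> b \<in> bounded_ops \<Longrightarrow> comult_left (op_tensor a b) = op_tensor (comult a) b"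
  unfolding comult_left_def comult_def by (rule amp_extend_left[OF inj_comult_idx])

lemma comult_right_tensor:
  "a \<in> bounded_ops \<Longrightarrow> b \<in> bounded_ops \<Longrightarrow> comult_right (op_tensor a b) = op_tensor a (comult b)"
  unfolding comult_right_def comult_def by (rule amp_extend_right[OF inj_comult_idx])

end

text \<open>A unitary 2-cocycle for \<Delta> with both legs in \<open>L(G0)\<close>. The finite
  expansion of \<Omega> is part of the data because an abstract isomorphism can only be applied to
  it leg by leg. Unitarity is relative to E \<otimes> E, with
  \<open>E = left_regular G \<one>\<close> the unit of \<open>L(G)\<close>.\<close>

locale twist = group G for G (structure) +
  fixes G0 :: "'a set" and K :: "'k set" and d :: "'k \<Rightarrow> complex" and p q :: "'k \<Rightarrow> 'a oper"
    and \<Omega> :: "('a \<times> 'a) oper"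
  assumes G0: "subgroup G0 G" "finite G0" "\<And>s t. s \<in> G0 \<Longrightarrow> t \<in> G0 \<Longrightarrow> s \<otimes> t = t \<otimes> s"
    and K: "finite K" and p: "\<And>k. k \<in> K \<Longrightarrow> p k \<in> sub_vn G0" and q: "\<And>k. k \<in> K \<Longrightarrow> q k \<in> sub_vn G0"
    and \<Omega>_eq: "\<Omega> = opsum K d (\<lambda>k. op_tensor (p k) (q k))"
    and unitary: "\<Omega> \<circ> op_adj \<Omega> = op_tensor (left_regular G \<one>) (left_regular G \<one>)"
      "op_adj \<Omega> \<circ> \<Omega> = op_tensor (left_regular G \<one>) (left_regular G \<one>)"
    and cocycle: "op_assoc (op_tensor \<Omega> (left_regular G \<one>) \<circ> comult_left \<Omega>)
      = op_tensor (left_regular G \<one>) \<Omega> \<circ> comult_right \<Omega>"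
begin

abbreviation "M \<equiv> group_vn G"
abbreviation "E \<equiv> left_regular G \<one>"
abbreviation "u \<equiv> left_regular G"
abbreviation "W0 \<equiv> vn_tensor (sub_vn G0) (sub_vn G0)"

definition tw :: "'a oper \<Rightarrow> ('a \<times> 'a) oper" where
  "tw a = \<Omega> \<circ> comult a \<circ> op_adj \<Omega>"

lemma ub [simp]: "g \<in> G0 \<Longrightarrow> u g \<in> bounded_ops"
  using subgroup.mem_carrier[OF G0(1)] by simp

lemma Eb [simp]: "E \<in> bounded_ops" by simp

lemma W0_vna: "von_neumann_algebra W0"
  by (intro vn_tensor_vna sub_vn_vna G0)

lemma MM_vna: "von_neumann_algebra (vn_tensor M M)"
  by (intro vn_tensor_vna group_vn_vna)

lemma W0_subset: "W0 \<subseteq> vn_tensor M M"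
  by (rule sub_vn_tensor_induct[OF G0(1) vna_subspace[OF MM_vna]])
    (intro op_tensor_in_vn_tensor left_regular_in_group_vn subgroup.mem_carrier[OF G0(1)])

lemma \<Omega>_W0: "\<Omega> \<in> W0"
  unfolding \<Omega>_eq by (intro opsum_in_subspace[OF vna_subspace[OF W0_vna] K] op_tensor_in_vn_tensor p q)

lemma \<Omega>b [simp]: "\<Omega> \<in> bounded_ops"
  using vna_bops[OF W0_vna \<Omega>_W0] .

lemma MM_unit: "T \<in> vn_tensor M M \<Longrightarrow> op_tensor E E \<circ> T = T" "T \<in> vn_tensor M M \<Longrightarrow> T \<circ> op_tensor E E = T"
  using vna_star_monoid[OF MM_vna] vn_tensor_unit[OF group_vn_vna group_vn_vna]
  by (auto simp: star_monoid_def group_vn_unit)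

lemma MM_closed:
  "S \<in> vn_tensor M M \<Longrightarrow> T \<in> vn_tensor M M \<Longrightarrow> S \<circ> T \<in> vn_tensor M M"
  "T \<in> vn_tensor M M \<Longrightarrow> op_adj T \<in> vn_tensor M M"
  using MM_vna by (auto simp: von_neumann_algebra_def)

lemma \<Omega>_MM: "\<Omega> \<in> vn_tensor M M" "op_adj \<Omega> \<in> vn_tensor M M"
  using \<Omega>_W0 W0_subset MM_closed(2) by auto

lemma normal_lin_tw: "normal_lin tw"
  unfolding tw_def
  by (rule normal_lin_compose[OF normal_lin_compose[OF normal_lin_comult normal_lin_mult_left] normal_lin_mult_right])
    simp_all

lemma tw_in: "a \<in> M \<Longrightarrow> tw a \<in> vn_tensor M M"
  unfolding tw_def by (intro MM_closed \<Omega>_MM comult_in)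

lemma comult_bops: "a \<in> M \<Longrightarrow> comult a \<in> bounded_ops"
  by (rule normal_lin_bops[OF normal_lin_comult group_vn_bops])

section \<open>The twist as an injective unital homomorphism\<close>

lemma tw_comp:
  assumes a: "a \<in> M" and b: "b \<in> M"
  shows "tw (a \<circ> b) = tw a \<circ> tw b"
proof -
  have "tw a \<circ> tw b = \<Omega> \<circ> comult a \<circ> ((op_adj \<Omega> \<circ> \<Omega>) \<circ> comult b) \<circ> op_adj \<Omega>"
    by (simp add: tw_def comp_assoc)
  also have "\<dots> = \<Omega> \<circ> comult a \<circ> comult b \<circ> op_adj \<Omega>"
    unfolding unitary(2) MM_unit(1)[OF comult_in[OF b]] by simp
  also have "\<dots> = tw (a \<circ> b)"
    using a b by (simp add: tw_def comult_comp group_vn_bops comp_assoc)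
  finally show ?thesis ..
qed

lemma tw_adj:
  assumes a: "a \<in> M"
  shows "tw (op_adj a) = op_adj (tw a)"
  using comult_bops[OF a] group_vn_bops[OF a]
  by (simp add: tw_def op_adj_comp bops_comp op_adj_adj comult_adj comp_assoc)

lemma tw_recover:
  assumes a: "a \<in> M"
  shows "op_adj \<Omega> \<circ> tw a \<circ> \<Omega> = comult a"
proof -
  have "op_adj \<Omega> \<circ> tw a \<circ> \<Omega> = ((op_adj \<Omega> \<circ> \<Omega>) \<circ> comult a) \<circ> (op_adj \<Omega> \<circ> \<Omega>)"
    by (simp add: tw_def comp_assoc)
  then show ?thesis unfolding unitary(2) by (simp add: MM_unit comult_in[OF a])
qed

lemma tw_inj: "inj_on tw M"
  by (rule inj_onI) (metis tw_recover comult_injective group_vn_bops)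

lemma E_M: "E \<in> M" by (rule left_regular_in_group_vn) simp

lemma tw_unit: "tw E = op_tensor E E"
proof -
  have "\<Omega> \<circ> op_tensor E E = \<Omega>" by (rule MM_unit(2)[OF \<Omega>_MM(1)])
  then show ?thesis by (simp add: tw_def comult_left_regular unitary(1))
qed

lemma tw_star_hom: "star_hom M (vn_tensor M M) tw"
  unfolding star_hom_def
  using normal_lin_linear_map[OF normal_lin_tw, of M "vn_tensor M M"] tw_in group_vn_bops tw_comp tw_adj
  by auto

section \<open>The Haar state of the twist\<close>

lemma W0_commute:
  assumes g: "g \<in> G0" and T: "T \<in> W0"
  shows "T \<circ> op_tensor (u g) (u g) = op_tensor (u g) (u g) \<circ> T"
proof -
  have gb: "op_tensor (u g) (u g) \<in> bounded_ops" using g by simp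
  have "W0 \<subseteq> {T \<in> bounded_ops. T \<circ> op_tensor (u g) (u g) = op_tensor (u g) (u g) \<circ> T}"
    by (rule sub_vn_tensor_induct[OF G0(1) uw_subspace_equalizer[OF normal_lin_mult_right[OF gb] normal_lin_mult_left[OF gb]]])
      (use g G0 in \<open>simp add: op_tensor_comp left_regular_mult subgroup.mem_carrier[OF G0(1)]\<close>)
  then show ?thesis using T by auto
qed

text \<open>Since \<open>G0\<close> is abelian, \<Omega> moves past the diagonal translation by
  \<open>g\<close> and cancels against its adjoint.\<close>

lemma tw_left_regular_G0:
  assumes g: "g \<in> G0"
  shows "tw (u g) = op_tensor (u g) (u g)"
proof -
  have gc: "g \<in> carrier G" using g subgroup.mem_carrier[OF G0(1)] by blast
  have "tw (u g) = op_tensor (u g) (u g) \<circ> (\<Omega> \<circ> op_adj \<Omega>)"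
    by (simp add: tw_def comult_left_regular[OF gc] W0_commute[OF g \<Omega>_W0] comp_assoc)
  also have "\<dots> = op_tensor (u g) (u g)"
    unfolding unitary(1) by (intro MM_unit op_tensor_in_vn_tensor left_regular_in_group_vn gc)
  finally show ?thesis .
qed

text \<open>Conjugation by \<open>\<Omega>\<close> moves \<open>u\<^sub>g \<otimes> u\<^sub>g\<close> within \<open>G\<^sub>0gG\<^sub>0\<close> in either leg, hence away from the unit if \<open>g \<notin> G\<^sub>0\<close>.\<close>

lemma slice_tw_aux:
  assumes g: "g \<in> carrier G" "g \<notin> G0"
    and \<Phi>: "normal_lin \<Phi>"
    and \<Phi>0: "\<And>s t. s \<in> carrier G \<Longrightarrow> t \<in> carrier G \<Longrightarrow> s \<noteq> \<one> \<Longrightarrow> t \<noteq> \<one> \<Longrightarrow>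
       \<Phi> (op_tensor (u s) (u t)) = (\<lambda>_ _. 0)"
  shows "\<Phi> (tw (u g)) = (\<lambda>_ _. 0)"
proof -
  note car = subgroup.mem_carrier[OF G0(1)]
  let ?U = "op_tensor (u g) (u g)"
  have Ub: "?U \<in> bounded_ops" using g by simp
  have ne: "s \<otimes> g \<otimes> t \<noteq> \<one>" if "s \<in> G0" "t \<in> G0" for s t
  proof
    assume "s \<otimes> g \<otimes> t = \<one>"
    then have "g = inv s \<otimes> inv t"
      using that g car by (metis inv_equality inv_solve_left m_assoc m_closed inv_closed l_one r_inv inv_inv)
    then show False using that g(2) subgroup.m_closed[OF G0(1)] subgroup.m_inv_closed[OF G0(1)] by simp
  qed
  note z = uw_subspace_zero
  \<comment> \<open>The two outer factors are generalised separately. While the right one is a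
    tensor of translations, the left one runs through \<open>W0\<close>, because for translations on
    both sides the product is a single tensor of translations. Afterwards the left factor is fixed
    as \<Omega> and the right one runs through \<open>W0\<close>.\<close>
  have 1: "\<Phi> (T \<circ> (?U \<circ> op_tensor (u s) (u t))) = (\<lambda>_ _. 0)" if T: "T \<in> W0" and st: "s \<in> G0" "t \<in> G0" for T s t
  proof -
    have b: "?U \<circ> op_tensor (u s) (u t) \<in> bounded_ops" using st Ub by (intro bops_comp) auto
    have "W0 \<subseteq> {T \<in> bounded_ops. \<Phi> (T \<circ> (?U \<circ> op_tensor (u s) (u t))) \<in> {\<lambda>_ _. 0}}"
    proof (rule sub_vn_tensor_induct[OF G0(1) uw_subspace_preimage[OF normal_lin_compose[OF normal_lin_mult_right[OF b] \<Phi>] z]])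
      fix s' t' assume s't': "s' \<in> G0" "t' \<in> G0"
      have "op_tensor (u s') (u t') \<circ> (?U \<circ> op_tensor (u s) (u t))
          = op_tensor (u (s' \<otimes> g \<otimes> s)) (u (t' \<otimes> g \<otimes> t))"
        using s't' st g car by (simp add: op_tensor_comp left_regular_mult m_assoc)
      moreover have "\<Phi> \<dots> = (\<lambda>_ _. 0)"
        using s't' st g car ne by (intro \<Phi>0) auto
      ultimately show "op_tensor (u s') (u t')
          \<in> {T \<in> bounded_ops. \<Phi> (T \<circ> (?U \<circ> op_tensor (u s) (u t))) \<in> {\<lambda>_ _. 0}}"
        using s't' by simp
    qed
    then show ?thesis using T by auto
  qed
  have b: "\<Omega> \<circ> ?U \<in> bounded_ops" using Ub by (intro bops_comp) auto
  have "W0 \<subseteq> {T \<in> bounded_ops. \<Phi> ((\<Omega> \<circ> ?U) \<circ> T) \<in> {\<lambda>_ _. 0}}"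
    by (rule sub_vn_tensor_induct[OF G0(1) uw_subspace_preimage[OF normal_lin_compose[OF normal_lin_mult_left[OF b] \<Phi>] z]])
      (use 1[OF \<Omega>_W0] in \<open>simp add: comp_assoc\<close>)
  moreover have "op_adj \<Omega> \<in> W0" using W0_vna \<Omega>_W0 by (simp add: von_neumann_algebra_def)
  ultimately show ?thesis using g(1) by (auto simp: tw_def comult_left_regular)
qed

text \<open>The disjunction in \<open>\<Phi>u\<close> lets one proof serve both slices. For
  \<open>s\<close> and \<open>t\<close> both nontrivial either alternative gives zero, which
  disposes of \<open>g\<close> outside \<open>G0\<close>; inside \<open>G0\<close> the twist changes
  nothing.\<close>

lemma slice_tw:
  assumes \<Phi>: "normal_lin \<Phi>"
    and \<Phi>u: "\<And>s t. s \<in> carrier G \<Longrightarrow> t \<in> carrier G \<Longrightarrow>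
       \<Phi> (op_tensor (u s) (u t)) = op_scale (of_bool (t = \<one>)) (u s) \<or>
       \<Phi> (op_tensor (u s) (u t)) = op_scale (of_bool (s = \<one>)) (u t)"
    and a: "a \<in> M"
  shows "\<Phi> (tw a) = op_scale (group_trace a) E"
proof -
  have "M \<subseteq> {a \<in> bounded_ops. \<Phi> (tw a) = op_scale (group_trace a) E}"
  proof (rule group_vn_induct[OF uw_subspace_equalizer])
    show "normal_lin (\<lambda>a. \<Phi> (tw a))" by (rule normal_lin_compose[OF normal_lin_tw \<Phi>])
    show "normal_lin (\<lambda>a. op_scale (group_trace a) E)" by (rule normal_fun_scale_op[OF normal_fun_group_trace Eb])
    fix g assume g: "g \<in> carrier G"
    have "\<Phi> (tw (u g)) = op_scale (group_trace (u g)) E"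
    proof (cases "g \<in> G0")
      case True
      then show ?thesis using \<Phi>u[OF g g]
        by (cases "g = \<one>") (auto simp: tw_left_regular_G0 group_trace_left_regular op_scale_zero g)
    next
      case False
      then have "g \<noteq> \<one>" using subgroup.one_closed[OF G0(1)] by auto
      have "\<Phi> (tw (u g)) = (\<lambda>_ _. 0)"
        by (rule slice_tw_aux[OF g False \<Phi>]) (use \<Phi>u in \<open>force simp: op_scale_zero\<close>)
      then show ?thesis using \<open>g \<noteq> \<one>\<close> by (simp add: group_trace_left_regular[OF g] op_scale_zero)
    qed
    then show "u g \<in> {a \<in> bounded_ops. \<Phi> (tw a) = op_scale (group_trace a) E}" using g by simp
  qed
  then show ?thesis using a by auto
qed

lemma tw_haar: "haar_state M tw group_trace"
proof -
  have scale: "op_scale c a \<in> M" if "a \<in> M" for c a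
    using group_vn_vna that by (simp add: von_neumann_algebra_def)
  have lin: "linear_map (vn_tensor M M) M \<Phi>" "normal_map (vn_tensor M M) M \<Phi>"
    if \<Phi>: "normal_lin \<Phi>" and \<Phi>M: "\<And>a b. a \<in> M \<Longrightarrow> b \<in> M \<Longrightarrow> \<Phi> (op_tensor a b) \<in> M" for \<Phi>
  proof -
    have "vn_tensor M M \<subseteq> {T \<in> bounded_ops. \<Phi> T \<in> M}"
      by (rule vn_tensor_induct[OF group_vn_vna group_vn_vna uw_subspace_preimage[OF \<Phi> vna_subspace[OF group_vn_vna]]])
        (simp add: \<Phi>M group_vn_bops)
    then show "linear_map (vn_tensor M M) M \<Phi>" "normal_map (vn_tensor M M) M \<Phi>"
      by (auto intro!: normal_lin_linear_map[OF \<Phi>] normal_lin_normal_map[OF \<Phi>])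
  qed
  \<comment> \<open>The trace is the vector state at \<open>delta \<one>\<close>, so slicing by it
    is compression to the copy of the Hilbert space at the index of the unit.\<close>
  let ?r = "compress (\<lambda>i. (i, \<one>))" and ?l = "compress (\<lambda>i. (\<one>, i))"
  have r: "normal_lin ?r" and l: "normal_lin ?l"
    by (rule normal_lin_compress, simp add: inj_on_def)+
  have rt: "?r (op_tensor a b) = op_scale (group_trace b) a" if "a \<in> M" "b \<in> M" for a b
    by (simp add: compress_tensor_right group_vn_bops that group_trace_def)
  have lt: "?l (op_tensor a b) = op_scale (group_trace a) b" if "a \<in> M" "b \<in> M" for a b
    by (simp add: compress_tensor_left group_vn_bops that group_trace_def)
  show ?thesis
    unfolding haar_state_def group_vn_unit
  proof (intro conjI exI ballI)
    show "is_slice_right M group_trace ?r"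
      unfolding is_slice_right_def using lin[OF r] rt scale by simp
    show "is_slice_left M group_trace ?l"
      unfolding is_slice_left_def using lin[OF l] lt scale by simp
    show "?r (tw a) = op_scale (group_trace a) E" if "a \<in> M" for a
      by (rule slice_tw[OF r _ that]) (simp add: rt left_regular_in_group_vn group_trace_left_regular)
    show "?l (tw a) = op_scale (group_trace a) E" if "a \<in> M" for a
      by (rule slice_tw[OF l _ that]) (simp add: lt left_regular_in_group_vn group_trace_left_regular)
  qed (rule group_trace_faithful)
qed

text \<open>Since \<Delta> \<otimes> id is multiplicative, (tw \<otimes> id)(tw a) is (\<Delta>
  \<otimes> id)(\<Delta> a) conjugated by X = (\<Omega> \<otimes> 1)(\<Delta> \<otimes>
  id)(\<Omega>). The other iterate is (id \<otimes> \<Delta>)(\<Delta> a) conjugated by Y = (1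
  \<otimes> \<Omega>)(id \<otimes> \<Delta>)(\<Omega>). The assumption \<open>cocycle\<close>
  identifies X with Y after reassociation, and for a group element both inner terms are its triple
  tensor.\<close>

lemma tw_coassociative: "coassociative M tw"
proof -
  let ?L = "op_tensor \<Omega> E" and ?R = "op_tensor E \<Omega>"
  define h where "h T = ?L \<circ> comult_left T \<circ> op_adj ?L" for T
  define h' where "h' T = ?R \<circ> comult_right T \<circ> op_adj ?R" for T
  have Lb: "?L \<in> bounded_ops" and Rb: "?R \<in> bounded_ops" by simp_all
  have adjE: "op_adj E = E" by (simp add: left_regular_adj)
  have EaE: "E \<circ> a \<circ> E = a" if "a \<in> M" for a
    using vna_star_monoid[OF group_vn_vna] that by (simp add: star_monoid_def group_vn_unit)
  have nh: "normal_lin h" unfolding h_def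
    by (rule normal_lin_compose[OF normal_lin_compose[OF normal_lin_comult_left normal_lin_mult_left] normal_lin_mult_right])
      (simp_all add: Lb)
  have nh': "normal_lin h'" unfolding h'_def
    by (rule normal_lin_compose[OF normal_lin_compose[OF normal_lin_comult_right normal_lin_mult_left] normal_lin_mult_right])
      (simp_all add: Rb)
  have ht: "h (op_tensor a b) = op_tensor (tw a) b" if "a \<in> M" "b \<in> M" for a b
    using that EaE[of b] unfolding h_def op_tensor_adj[OF \<Omega>b Eb]
    by (simp add: comult_left_tensor op_tensor_comp group_vn_bops comult_bops tw_def adjE bops_comp)
  have h't: "h' (op_tensor a b) = op_tensor a (tw b)" if "a \<in> M" "b \<in> M" for a b
    using that EaE[of a] unfolding h'_def op_tensor_adj[OF Eb \<Omega>b]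
    by (simp add: comult_right_tensor op_tensor_comp group_vn_bops comult_bops tw_def adjE bops_comp)
  have MMb: "T \<in> bounded_ops" if "T \<in> vn_tensor M M" for T using vna_bops[OF MM_vna that] .
  have "vn_tensor M M \<subseteq> {T \<in> bounded_ops. h T \<in> vn_tensor (vn_tensor M M) M}"
    by (rule vn_tensor_induct[OF group_vn_vna group_vn_vna uw_subspace_preimage[OF nh vna_subspace[OF vn_tensor_vna[OF MM_vna group_vn_vna]]]])
      (simp add: ht group_vn_bops op_tensor_in_vn_tensor tw_in)
  then have h: "is_map_tensor M M (vn_tensor M M) M tw id h"
    unfolding is_map_tensor_def
    by (auto intro!: normal_lin_linear_map[OF nh] normal_lin_normal_map[OF nh] simp: ht)
  have "vn_tensor M M \<subseteq> {T \<in> bounded_ops. h' T \<in> vn_tensor M (vn_tensor M M)}"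
    by (rule vn_tensor_induct[OF group_vn_vna group_vn_vna uw_subspace_preimage[OF nh' vna_subspace[OF vn_tensor_vna[OF group_vn_vna MM_vna]]]])
      (simp add: h't group_vn_bops op_tensor_in_vn_tensor tw_in)
  then have h': "is_map_tensor M M M (vn_tensor M M) id tw h'"
    unfolding is_map_tensor_def
    by (auto intro!: normal_lin_linear_map[OF nh'] normal_lin_normal_map[OF nh'] simp: h't)
  have M: "M \<subseteq> {a \<in> bounded_ops. op_assoc (h (tw a)) = h' (tw a)}"
  proof (rule group_vn_induct[OF uw_subspace_equalizer])
    show "normal_lin (\<lambda>a. op_assoc (h (tw a)))"
      by (rule normal_lin_compose[OF normal_lin_compose[OF normal_lin_tw nh] normal_lin_assoc])
    show "normal_lin (\<lambda>a. h' (tw a))" by (rule normal_lin_compose[OF normal_lin_tw nh'])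
    fix g assume g: "g \<in> carrier G"
    let ?U = "op_tensor (u g) (u g)"
    define X where "X = ?L \<circ> comult_left \<Omega>"
    define Y where "Y = ?R \<circ> comult_right \<Omega>"
    have gb: "u g \<in> bounded_ops" using g by simp
    have clb: "comult_left \<Omega> \<in> bounded_ops" "comult_right \<Omega> \<in> bounded_ops"
      by (simp_all add: normal_lin_bops[OF normal_lin_comult_left] normal_lin_bops[OF normal_lin_comult_right])
    have Xb: "X \<in> bounded_ops" and Yb: "Y \<in> bounded_ops"
      unfolding X_def Y_def by (intro bops_comp Lb Rb clb)+
    have assoc_adj: "op_assoc (op_adj X) = op_adj (op_assoc X)"
      using amp_adj[OF inj_assoc Xb] by (simp add: op_assoc_amp Xb)
    have "h (tw (u g)) = ?L \<circ> (comult_left \<Omega> \<circ> comult_left ?U \<circ> op_adj (comult_left \<Omega>)) \<circ> op_adj ?L"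
      unfolding h_def tw_def comult_left_regular[OF g] comult_left_def
      by (simp add: amp_comp[OF inj_extend_left[OF inj_comult_idx]] amp_adj[OF inj_extend_left[OF inj_comult_idx]] bops_comp gb)
    also have "\<dots> = X \<circ> op_tensor ?U (u g) \<circ> op_adj X"
      by (simp add: X_def op_adj_comp[OF Lb clb(1)] comult_left_tensor gb comult_left_regular[OF g] comp_assoc)
    finally have "op_assoc (h (tw (u g))) = op_assoc X \<circ> op_tensor (u g) ?U \<circ> op_adj (op_assoc X)"
      by (simp add: op_assoc_comp bops_comp Xb gb op_assoc_tensor assoc_adj)
    also have "\<dots> = Y \<circ> op_tensor (u g) ?U \<circ> op_adj Y"
      unfolding X_def Y_def cocycle ..
    also have "\<dots> = ?R \<circ> (comult_right \<Omega> \<circ> comult_right ?U \<circ> op_adj (comult_right \<Omega>)) \<circ> op_adj ?R"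
      by (simp add: Y_def op_adj_comp[OF Rb clb(2)] comult_right_tensor gb comult_left_regular[OF g] comp_assoc)
    also have "\<dots> = h' (tw (u g))"
      unfolding h'_def tw_def comult_left_regular[OF g] comult_right_def
      by (simp add: amp_comp[OF inj_extend_right[OF inj_comult_idx]] amp_adj[OF inj_extend_right[OF inj_comult_idx]] bops_comp gb)
    finally show "u g \<in> {a \<in> bounded_ops. op_assoc (h (tw a)) = h' (tw a)}" using gb by simp
  qed
  show ?thesis
    unfolding coassociative_def
    by (intro exI[of _ h] exI[of _ h'] conjI h h') (use M in auto)
qed

lemma tw_compact_quantum_group: "compact_quantum_group M tw"
  unfolding compact_quantum_group_def
proof (intro conjI exI[of _ group_trace])
  show "tw (vn_unit M) = vn_unit (vn_tensor M M)"
    by (simp add: group_vn_unit tw_unit vn_tensor_unit[OF group_vn_vna group_vn_vna])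
qed (rule group_vn_vna tw_star_hom tw_inj tw_coassociative tw_haar
    normal_lin_normal_map[OF normal_lin_tw tw_in] | assumption)+

lemma tw_kac_type: "kac_type M tw"
  unfolding kac_type_def using tw_haar group_trace_commute by blast

end

section \<open>Flip-invariance forced by an isomorphism\<close>

lemma op_flip_opsum:
  assumes J: "finite J" and ab: "\<And>j. j \<in> J \<Longrightarrow> a j \<in> bounded_ops" "\<And>j. j \<in> J \<Longrightarrow> b j \<in> bounded_ops"
  shows "op_flip (opsum J e (\<lambda>j. op_tensor (a j) (b j))) = opsum J e (\<lambda>j. op_tensor (b j) (a j))"
proof -
  have "op_flip (opsum J e (\<lambda>j. op_tensor (a j) (b j))) = opsum J e (\<lambda>j. op_flip (op_tensor (a j) (b j)))"
    by (rule normal_lin_opsum[OF normal_lin_flip J]) (simp add: ab)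
  also have "\<dots> = opsum J e (\<lambda>j. op_tensor (b j) (a j))"
    by (rule opsum_cong) (simp_all add: op_flip_tensor ab)
  finally show ?thesis .
qed

context twist
begin

text \<open>Shows that the twisted coproduct of a group element is an algebraic tensor, so that its
  image under \<pi> \<otimes> \<pi> is computed from the values on elementary tensors.\<close>

lemma tw_left_regular_opsum:
  assumes g: "g \<in> carrier G"
  shows "tw (u g) = opsum (K \<times> K) (\<lambda>(k, l). d k * cnj (d l))
    (\<lambda>j. op_tensor (p (fst j) \<circ> u g \<circ> op_adj (p (snd j))) (q (fst j) \<circ> u g \<circ> op_adj (q (snd j))))"
proof -
  have gb: "u g \<in> bounded_ops" using g by simp
  have pb: "p k \<in> bounded_ops" and qb: "q k \<in> bounded_ops" if "k \<in> K" for k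
    using vna_bops[OF sub_vn_vna[OF G0(1)] p[OF that]] vna_bops[OF sub_vn_vna[OF G0(1)] q[OF that]] .
  let ?U = "op_tensor (u g) (u g)"
  have 1: "\<Omega> \<circ> ?U = opsum K d (\<lambda>k. op_tensor (p k) (q k) \<circ> ?U)"
    unfolding \<Omega>_eq
    by (rule normal_lin_opsum[OF normal_lin_mult_right K]) (simp_all add: gb pb qb)
  have 2: "op_adj \<Omega> = opsum K (\<lambda>k. cnj (d k)) (\<lambda>k. op_tensor (op_adj (p k)) (op_adj (q k)))"
  proof -
    have "op_adj \<Omega> = opsum K (\<lambda>k. cnj (d k)) (\<lambda>k. op_adj (op_tensor (p k) (q k)))"
      unfolding \<Omega>_eq by (rule opsum_adj[OF K]) (simp add: pb qb)
    also have "\<dots> = opsum K (\<lambda>k. cnj (d k)) (\<lambda>k. op_tensor (op_adj (p k)) (op_adj (q k)))"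
      by (rule opsum_cong) (simp_all add: op_tensor_adj pb qb)
    finally show ?thesis .
  qed
  have "tw (u g) = opsum (K \<times> K) (\<lambda>(k, l). d k * cnj (d l))
      (\<lambda>(k, l). (op_tensor (p k) (q k) \<circ> ?U) \<circ> op_tensor (op_adj (p l)) (op_adj (q l)))"
    unfolding tw_def comult_left_regular[OF g] 1 2
    by (rule opsum_comp[OF K K]) (simp_all add: bops_comp pb qb gb)
  also have "\<dots> = opsum (K \<times> K) (\<lambda>(k, l). d k * cnj (d l))
    (\<lambda>j. op_tensor (p (fst j) \<circ> u g \<circ> op_adj (p (snd j))) (q (fst j) \<circ> u g \<circ> op_adj (q (snd j))))"
    by (rule opsum_cong) (auto simp: op_tensor_comp bops_comp pb qb gb comp_assoc)
  finally show ?thesis .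
qed

text \<open>The image of \<open>tw (u g)\<close> under \<open>h\<close> is a group coproduct, hence
  flip-invariant. So \<pi> \<otimes> \<pi> annihilates the difference between
  \<open>tw (u g)\<close> and its flip, and injectivity of \<pi> on algebraic tensors makes the
  difference zero.\<close>

lemma tw_flip_invariant:
  assumes iso: "cqg_isomorphic M tw M (group_comult G)" and g: "g \<in> carrier G"
  shows "op_flip (tw (u g)) = tw (u g)"
proof -
  obtain \<pi> h where \<pi>: "star_iso M M \<pi>" and h: "is_map_tensor M M M M \<pi> \<pi> h"
    and \<pi>h: "\<And>a. a \<in> M \<Longrightarrow> group_comult G (\<pi> a) = h (tw a)"
    using iso unfolding cqg_isomorphic_def by blast
  have lin: "linear_map M M \<pi>" and inj: "inj_on \<pi> M"
    using \<pi> by (auto simp: star_iso_def star_hom_def bij_betw_def)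
  then have \<pi>M: "\<pi> a \<in> M" if "a \<in> M" for a using that by (auto simp: linear_map_def)
  have hlin: "linear_map (vn_tensor M M) (vn_tensor M M) h"
    and ht: "\<And>a b. a \<in> M \<Longrightarrow> b \<in> M \<Longrightarrow> h (op_tensor a b) = op_tensor (\<pi> a) (\<pi> b)"
    using h by (auto simp: is_map_tensor_def)
  define J where "J = K \<times> K"
  define e where "e = (\<lambda>(k, l). d k * cnj (d l))"
  define a where "a j = p (fst j) \<circ> u g \<circ> op_adj (p (snd j))" for j
  define b where "b j = q (fst j) \<circ> u g \<circ> op_adj (q (snd j))" for j
  have J: "finite J" unfolding J_def using K by simp
  have closed: "x \<circ> u g \<circ> op_adj y \<in> M" if "x \<in> sub_vn G0" "y \<in> sub_vn G0" for x y
  proof -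
    have "x \<in> M" "y \<in> M" "u g \<in> M"
      using that sub_vn_subset[OF G0(1)] left_regular_in_group_vn[OF g] by auto
    then show ?thesis using group_vn_vna by (simp add: von_neumann_algebra_def)
  qed
  have aM: "a j \<in> M" and bM: "b j \<in> M" if "j \<in> J" for j
    using that closed p q unfolding J_def a_def b_def by auto
  have ab: "a j \<in> bounded_ops" "b j \<in> bounded_ops" "\<pi> (a j) \<in> bounded_ops" "\<pi> (b j) \<in> bounded_ops" if "j \<in> J" for j
    using aM[OF that] bM[OF that] \<pi>M group_vn_bops by auto
  have T: "tw (u g) = opsum J e (\<lambda>j. op_tensor (a j) (b j))"
    unfolding J_def e_def a_def b_def by (rule tw_left_regular_opsum[OF g])
  have fT: "op_flip (tw (u g)) = opsum J e (\<lambda>j. op_tensor (b j) (a j))"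
    unfolding T by (rule op_flip_opsum[OF J ab(1,2)])
  have hT: "h (tw (u g)) = opsum J e (\<lambda>j. op_tensor (\<pi> (a j)) (\<pi> (b j)))"
  proof -
    have "h (tw (u g)) = opsum J e (\<lambda>j. h (op_tensor (a j) (b j)))"
      unfolding T by (rule linear_map_opsum[OF hlin vna_subspace[OF MM_vna] J]) (intro op_tensor_in_vn_tensor aM bM)
    also have "\<dots> = opsum J e (\<lambda>j. op_tensor (\<pi> (a j)) (\<pi> (b j)))"
      by (rule opsum_cong) (simp_all add: ht aM bM)
    finally show ?thesis .
  qed
  have uM: "u g \<in> M" by (rule left_regular_in_group_vn[OF g])
  have "h (tw (u g)) = comult (\<pi> (u g))"
    using \<pi>h[OF uM] group_comult_eq[OF \<pi>M[OF uM]] by simp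
  then have "op_flip (h (tw (u g))) = h (tw (u g))" using flip_comult[OF \<pi>M[OF uM]] by simp
  then have sym: "opsum J e (\<lambda>j. op_tensor (\<pi> (b j)) (\<pi> (a j))) = opsum J e (\<lambda>j. op_tensor (\<pi> (a j)) (\<pi> (b j)))"
    unfolding hT using op_flip_opsum[OF J, of "\<lambda>j. \<pi> (a j)" "\<lambda>j. \<pi> (b j)" e] ab by simp
  \<comment> \<open>A Boolean index doubles the family, so that the tensor minus its flip becomes
    one signed sum, as \<open>algebraic_tensor_injective\<close> requires. The map \<theta> is taken
    to be \<pi> on the image side and the identity on the original.\<close>
  have both: "opsum (UNIV \<times> J) (\<lambda>(s, j). if s then e j else - e j)
      (\<lambda>k. op_tensor (\<theta> (if fst k then a (snd k) else b (snd k))) (\<theta> (if fst k then b (snd k) else a (snd k)))) z i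
    = opsum J e (\<lambda>j. op_tensor (\<theta> (a j)) (\<theta> (b j))) z i - opsum J e (\<lambda>j. op_tensor (\<theta> (b j)) (\<theta> (a j))) z i"
    for z i and \<theta> :: "'a oper \<Rightarrow> 'a oper"
  proof -
    have "(\<Sum>k\<in>UNIV \<times> J. F k) = (\<Sum>j\<in>J. F (True, j)) + (\<Sum>j\<in>J. F (False, j))"
      for F :: "bool \<times> 'k \<times> 'k \<Rightarrow> complex"
    proof -
      have "(\<Sum>k\<in>UNIV \<times> J. F k) = (\<Sum>s\<in>UNIV. \<Sum>j\<in>J. F (s, j))"
        by (simp add: sum.cartesian_product)
      then show ?thesis by (simp add: UNIV_bool)
    qed
    then show ?thesis by (simp add: opsum_def sum_negf)
  qed
  have "opsum (UNIV \<times> J) (\<lambda>(s, j). if s then e j else - e j)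
      (\<lambda>k. op_tensor (if fst k then a (snd k) else b (snd k)) (if fst k then b (snd k) else a (snd k)))
    = (\<lambda>_ _. 0)"
    by (rule algebraic_tensor_injective[OF lin inj vna_subspace[OF group_vn_vna]])
      (auto simp: J aM bM group_vn_bops fun_eq_iff both sym)
  then have "opsum J e (\<lambda>j. op_tensor (a j) (b j)) z i = opsum J e (\<lambda>j. op_tensor (b j) (a j)) z i" for z i
    using both[of "\<lambda>x. x" z i] by simp
  then show ?thesis unfolding T[symmetric] fT[symmetric] by (simp add: fun_eq_iff)
qed

section \<open>Fourier coefficients in the tensor square and the icc condition\<close>

lemma MM_delta:
  assumes T: "T \<in> vn_tensor M M" and c: "h \<in> carrier G" "m \<in> carrier G" "k \<in> carrier G" "l \<in> carrier G"
  shows "T (delta (h, m)) (k, l) = T (delta (\<one>, \<one>)) (k \<otimes> inv h, l \<otimes> inv m)"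
proof -
  have "vn_tensor M M \<subseteq> {T \<in> bounded_ops. T (delta (h, m)) (k, l) = T (delta (\<one>, \<one>)) (k \<otimes> inv h, l \<otimes> inv m)}"
  proof (rule vn_tensor_induct[OF group_vn_vna group_vn_vna])
    show "uw_subspace {T \<in> bounded_ops. T (delta (h, m)) (k, l) = T (delta (\<one>, \<one>)) (k \<otimes> inv h, l \<otimes> inv m)}"
      by (intro uw_subspace_fun_equalizer normal_fun_apply delta_ell2)
    fix a b assume "a \<in> M" "b \<in> M"
    then show "op_tensor a b \<in> {T \<in> bounded_ops. T (delta (h, m)) (k, l) = T (delta (\<one>, \<one>)) (k \<otimes> inv h, l \<otimes> inv m)}"
      using c group_vn_delta[of a h k] group_vn_delta[of b m l]
      by (simp add: op_tensor_matrix group_vn_bops)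
  qed
  then show ?thesis using T by auto
qed

lemma MM_delta_out:
  assumes T: "T \<in> vn_tensor M M" and c: "\<not> (h \<in> carrier G \<and> m \<in> carrier G \<and> k \<in> carrier G \<and> l \<in> carrier G)"
  shows "T (delta (h, m)) (k, l) = 0"
proof -
  have "vn_tensor M M \<subseteq> {T \<in> bounded_ops. T (delta (h, m)) (k, l) = 0}"
  proof (rule vn_tensor_induct[OF group_vn_vna group_vn_vna uw_subspace_kernel[OF normal_fun_apply[OF delta_ell2]]])
    fix a b assume ab: "a \<in> M" "b \<in> M"
    have "a (delta h) k = 0 \<or> b (delta m) l = 0"
      using c group_vn_delta_out[OF ab(1), of h k] group_vn_delta_out[OF ab(2), of m l] by blast
    then show "op_tensor a b \<in> {T \<in> bounded_ops. T (delta (h, m)) (k, l) = 0}"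
      using ab by (auto simp add: op_tensor_matrix group_vn_bops)
  qed
  then show ?thesis using T by auto
qed

lemma W0_support:
  assumes T: "T \<in> W0" and kl: "\<not> (k \<in> G0 \<and> l \<in> G0)"
  shows "T (delta (\<one>, \<one>)) (k, l) = 0"
proof -
  have "W0 \<subseteq> {T \<in> bounded_ops. T (delta (\<one>, \<one>)) (k, l) = 0}"
    by (rule sub_vn_tensor_induct[OF G0(1) uw_subspace_kernel[OF normal_fun_apply[OF delta_ell2]]])
      (use kl subgroup.mem_carrier[OF G0(1)] in \<open>auto simp: op_tensor_matrix left_regular_delta delta_apply\<close>)
  then show ?thesis using T by auto
qed

lemma W0_flip: "T \<in> W0 \<Longrightarrow> op_flip T \<in> W0"
proof -
  have "W0 \<subseteq> {T \<in> bounded_ops. op_flip T \<in> W0}"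
    by (rule sub_vn_tensor_induct[OF G0(1) uw_subspace_preimage[OF normal_lin_flip vna_subspace[OF W0_vna]]])
      (simp add: op_flip_tensor op_tensor_in_vn_tensor left_regular_in_sub_vn)
  then show "T \<in> W0 \<Longrightarrow> op_flip T \<in> W0" by auto
qed

text \<open>
  An element of \<open>L(G\<^sub>0) \<otimes> L(G\<^sub>0)\<close> has finitely many Fourier coefficients; if it commutes with all
  \<open>u\<^sub>g \<otimes> u\<^sub>g\<close>, they are constant on diagonal conjugacy classes, so in an icc group only the one at the
  unit survives.
\<close>

lemma icc_scalar:
  assumes icc: "icc G" and Y: "Y \<in> W0"
    and comm: "\<And>g. g \<in> carrier G \<Longrightarrow> op_tensor (u g) (u g) \<circ> Y = Y \<circ> op_tensor (u g) (u g)"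
  shows "Y = op_scale (Y (delta (\<one>, \<one>)) (\<one>, \<one>)) (op_tensor E E)"
proof -
  note car = subgroup.mem_carrier[OF G0(1)]
  have YM: "Y \<in> vn_tensor M M" using Y W0_subset by auto
  have Yb: "Y \<in> bounded_ops" by (rule vna_bops[OF MM_vna YM])
  define v where "v k l = Y (delta (\<one>, \<one>)) (k, l)" for k l
  have conj: "v k l = v (g \<otimes> k \<otimes> inv g) (g \<otimes> l \<otimes> inv g)"
    if g: "g \<in> carrier G" and k: "k \<in> carrier G" and l: "l \<in> carrier G" for g k l
  proof -
    have gb: "u g \<in> bounded_ops" using g by simp
    \<comment> \<open>The vector \<open>Y (delta (\<one>, \<one>))\<close> is not an elementary
      tensor, so the translation is moved by its adjoint onto a basis vector.\<close>
    have shift: "op_tensor (u g) (u g) x (g \<otimes> k, g \<otimes> l) = x (k, l)" if x: "x \<in> ell2" for x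
    proof -
      have "op_tensor (u g) (u g) x (g \<otimes> k, g \<otimes> l)
          = ell2_inner (delta (g \<otimes> k, g \<otimes> l)) (op_tensor (u g) (u g) x)" by simp
      also have "\<dots> = ell2_inner (op_adj (op_tensor (u g) (u g)) (delta (g \<otimes> k, g \<otimes> l))) x"
        by (rule op_adj_inner[symmetric]) (simp_all add: gb x)
      also have "op_adj (op_tensor (u g) (u g)) (delta (g \<otimes> k, g \<otimes> l)) = delta (k, l)"
        using g k l by (simp add: op_tensor_adj gb left_regular_adj op_tensor_delta left_regular_delta
          m_assoc[symmetric]) (simp add: delta_Pair)
      finally show ?thesis by simp
    qed
    have "v k l = op_tensor (u g) (u g) (Y (delta (\<one>, \<one>))) (g \<otimes> k, g \<otimes> l)"
      by (simp add: shift bops_ell2[OF Yb] v_def)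
    also have "\<dots> = Y (op_tensor (u g) (u g) (delta (\<one>, \<one>))) (g \<otimes> k, g \<otimes> l)"
      using fun_cong[OF comm[OF g], of "delta (\<one>, \<one>)"] by simp
    also have "op_tensor (u g) (u g) (delta (\<one>, \<one>)) = delta (g, g)"
      using g by (simp add: op_tensor_delta gb left_regular_delta) (simp add: delta_Pair)
    also have "Y (delta (g, g)) (g \<otimes> k, g \<otimes> l) = v (g \<otimes> k \<otimes> inv g) (g \<otimes> l \<otimes> inv g)"
      unfolding v_def using g k l by (intro MM_delta[OF YM]) auto
    finally show ?thesis .
  qed
  have v0: "v k l = 0" if "k \<noteq> \<one> \<or> l \<noteq> \<one>" for k l
  proof (rule ccontr)
    assume nz: "v k l \<noteq> 0"
    then have kl: "k \<in> G0" "l \<in> G0" using W0_support[OF Y, of k l] by (auto simp: v_def)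
    \<comment> \<open>The coefficient at each conjugate pair equals the nonzero
      \<open>v k l\<close>, so the support property confines all conjugates of \<open>k\<close> and
      of \<open>l\<close> to \<open>G0\<close>.\<close>
    have G0c: "g \<otimes> k \<otimes> inv g \<in> G0" "g \<otimes> l \<otimes> inv g \<in> G0" if "g \<in> carrier G" for g
      using W0_support[OF Y, of "g \<otimes> k \<otimes> inv g" "g \<otimes> l \<otimes> inv g"] conj[OF that car[OF kl(1)] car[OF kl(2)]] nz
      by (auto simp: v_def)
    have fin: "finite ((\<lambda>g. g \<otimes> k \<otimes> inv g) ` carrier G)" "finite ((\<lambda>g. g \<otimes> l \<otimes> inv g) ` carrier G)"
      by (rule finite_subset[OF _ G0(2)]; use G0c in auto)+
    then show False using icc that kl car unfolding icc_def by auto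
  qed
  show ?thesis
  proof (rule op_tensor_eqI[OF Yb])
    show "op_scale (Y (delta (\<one>, \<one>)) (\<one>, \<one>)) (op_tensor E E) \<in> bounded_ops" by (simp add: bops_scale_op)
    fix h m k l
    show "Y (delta (h, m)) (k, l) = op_scale (Y (delta (\<one>, \<one>)) (\<one>, \<one>)) (op_tensor E E) (delta (h, m)) (k, l)"
    proof (cases "h \<in> carrier G \<and> m \<in> carrier G \<and> k \<in> carrier G \<and> l \<in> carrier G")
      case c: True
      have "Y (delta (h, m)) (k, l) = v (k \<otimes> inv h) (l \<otimes> inv m)"
        unfolding v_def using c by (intro MM_delta[OF YM]) auto
      moreover have "k \<otimes> inv h = \<one> \<longleftrightarrow> k = h" "l \<otimes> inv m = \<one> \<longleftrightarrow> l = m"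
        using c by (metis inv_equality inv_inv r_inv inv_closed)+
      ultimately show ?thesis using c v0[of "k \<otimes> inv h" "l \<otimes> inv m"]
        by (auto simp: op_scale_apply op_tensor_matrix left_regular_delta delta_apply v_def)
    next
      case False
      moreover have "op_tensor E E \<in> vn_tensor M M" by (intro op_tensor_in_vn_tensor E_M)
      ultimately show ?thesis
        using MM_delta_out[OF YM, of h m k l] MM_delta_out[of "op_tensor E E" h m k l]
        by (simp add: op_scale_apply)
    qed
  qed
qed

text \<open>Conjugation by \<Omega> and by its flip agree on diagonal translations, which only
  determines the unitary up to the commutant; the icc condition reduces the ambiguity to the scalar
  \<open>c\<close>.\<close>

lemma iso_imp_symmetric:
  assumes icc: "icc G" and iso: "cqg_isomorphic M tw M (group_comult G)"
  shows "\<exists>c. \<Omega> = op_scale c (op_flip \<Omega>)"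
proof -
  define \<Omega>' where "\<Omega>' = op_flip \<Omega>"
  define Y where "Y = op_adj \<Omega>' \<circ> \<Omega>"
  have flip_adj: "op_flip (op_adj \<Omega>) = op_adj \<Omega>'"
    unfolding \<Omega>'_def op_flip_def by (rule amp_adj[OF inj_flip \<Omega>b])
  have \<Omega>'W: "\<Omega>' \<in> W0" unfolding \<Omega>'_def by (rule W0_flip[OF \<Omega>_W0])
  then have \<Omega>'b [simp]: "\<Omega>' \<in> bounded_ops" by (rule vna_bops[OF W0_vna])
  have unit': "\<Omega>' \<circ> op_adj \<Omega>' = op_tensor E E" "op_adj \<Omega>' \<circ> \<Omega>' = op_tensor E E"
    unfolding flip_adj[symmetric] unfolding \<Omega>'_def
    by (simp_all add: op_flip_comp[symmetric] unitary op_flip_tensor)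
  have YW: "Y \<in> W0"
    unfolding Y_def using W0_vna \<Omega>'W \<Omega>_W0 by (simp add: von_neumann_algebra_def)
  have comm: "op_tensor (u g) (u g) \<circ> Y = Y \<circ> op_tensor (u g) (u g)" if g: "g \<in> carrier G" for g
  proof -
    let ?U = "op_tensor (u g) (u g)"
    have gb: "u g \<in> bounded_ops" using g by simp
    have UM: "?U \<in> vn_tensor M M" by (intro op_tensor_in_vn_tensor left_regular_in_group_vn g)
    have "\<Omega>' \<circ> ?U \<circ> op_adj \<Omega>' = \<Omega> \<circ> ?U \<circ> op_adj \<Omega>"
      using tw_flip_invariant[OF iso g]
      by (simp add: tw_def comult_left_regular g op_flip_comp bops_comp gb op_flip_tensor flip_adj \<Omega>'_def[symmetric])
    then have "op_adj \<Omega>' \<circ> (\<Omega>' \<circ> ?U \<circ> op_adj \<Omega>') \<circ> \<Omega> = op_adj \<Omega>' \<circ> (\<Omega> \<circ> ?U \<circ> op_adj \<Omega>) \<circ> \<Omega>" by simp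
    then have "((op_adj \<Omega>' \<circ> \<Omega>') \<circ> ?U) \<circ> Y = Y \<circ> (?U \<circ> (op_adj \<Omega> \<circ> \<Omega>))"
      by (simp add: Y_def comp_assoc)
    then show ?thesis unfolding unit' unitary by (simp add: MM_unit[OF UM])
  qed
  have \<Omega>'M: "\<Omega>' \<in> vn_tensor M M" using \<Omega>'W W0_subset by auto
  have "\<Omega> = (\<Omega>' \<circ> op_adj \<Omega>') \<circ> \<Omega>" unfolding unit' by (simp add: MM_unit \<Omega>_MM)
  also have "\<dots> = \<Omega>' \<circ> Y" by (simp add: Y_def comp_assoc)
  also have "\<dots> = \<Omega>' \<circ> op_scale (Y (delta (\<one>, \<one>)) (\<one>, \<one>)) (op_tensor E E)"
    using icc_scalar[OF icc YW comm] by simp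
  also have "\<dots> = op_scale (Y (delta (\<one>, \<one>)) (\<one>, \<one>)) \<Omega>'"
    by (simp add: comp_op_scale_right MM_unit[OF \<Omega>'M])
  finally show ?thesis unfolding \<Omega>'_def by blast
qed

end

subsection \<open>Characters and symmetric 2-cocycles of finite abelian groups\<close>

lemma circle_group_simps [simp]:
  "carrier circle_group = {z. cmod z = 1}" "x \<otimes>\<^bsub>circle_group\<^esub> y = x * y" "\<one>\<^bsub>circle_group\<^esub> = 1"
  by (simp_all add: circle_group_def)

lemma comm_group_circle: "comm_group circle_group"
proof (rule comm_groupI)
  fix z :: complex assume z: "z \<in> carrier circle_group"
  then have "z \<noteq> 0" by auto
  with z show "\<exists>w\<in>carrier circle_group. w \<otimes>\<^bsub>circle_group\<^esub> z = \<one>\<^bsub>circle_group\<^esub>"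
    by (intro bexI[of _ "inverse z"]) (auto simp: norm_inverse)
qed (auto simp: norm_mult)

lemma inv_circle: "cmod z = 1 \<Longrightarrow> inv\<^bsub>circle_group\<^esub> z = inverse z"
proof -
  interpret comm_group circle_group by (rule comm_group_circle)
  show "cmod z = 1 \<Longrightarrow> inv\<^bsub>circle_group\<^esub> z = inverse z"
    by (rule inv_equality) (auto simp: norm_inverse intro: left_inverse)
qed

lemma sum_root_of_unity_powers:
  fixes \<zeta> :: complex
  assumes "\<zeta> ^ N = 1" "\<zeta> \<noteq> 1"
  shows "(\<Sum>k<N. \<zeta> ^ k) = 0"
  using assms by (simp add: geometric_sum)

locale finite_sym_cocycle = comm_group A for A (structure) +
  fixes \<omega> :: "'a \<times> 'a \<Rightarrow> complex"
  assumes fin: "finite (carrier A)"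
    and norm: "\<And>a b. a \<in> carrier A \<Longrightarrow> b \<in> carrier A \<Longrightarrow> cmod (\<omega> (a, b)) = 1"
    and cocycle: "\<And>a b c. a \<in> carrier A \<Longrightarrow> b \<in> carrier A \<Longrightarrow> c \<in> carrier A \<Longrightarrow>
      \<omega> (a, b) * \<omega> (a \<otimes> b, c) = \<omega> (b, c) * \<omega> (a, b \<otimes> c)"
    and sym: "\<And>a b. a \<in> carrier A \<Longrightarrow> b \<in> carrier A \<Longrightarrow> \<omega> (a, b) = \<omega> (b, a)"
begin

text \<open>
  The twisted translations commute and have a scalar power, so every function on the group is a sum of
  joint eigenvectors. For \<open>\<omega> = 1\<close> these are multiples of characters; in general a joint eigenvector
  exhibits \<open>\<omega>\<close> as a coboundary.
\<close>

definition tt :: "'a \<Rightarrow> ('a \<Rightarrow> complex) \<Rightarrow> 'a \<Rightarrow> complex" where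
  "tt x f y = (if y \<in> carrier A then \<omega> (y, x) * f (y \<otimes> x) else 0)"

text \<open>Values of \<open>tt\<close> vanish off the carrier, so eigenvector equations for
  \<open>tt\<close> are stated for truncated functions.\<close>

definition trunc :: "('a \<Rightarrow> complex) \<Rightarrow> 'a \<Rightarrow> complex" where
  "trunc f y = (if y \<in> carrier A then f y else 0)"

lemma trunc_trunc [simp]: "trunc (trunc f) = trunc f"
  by (simp add: trunc_def fun_eq_iff)

lemma trunc_apply [simp]: "y \<in> carrier A \<Longrightarrow> trunc f y = f y"
  by (simp add: trunc_def)

lemma nz: "a \<in> carrier A \<Longrightarrow> b \<in> carrier A \<Longrightarrow> \<omega> (a, b) \<noteq> 0"
  using norm by fastforce

text \<open>The cocycle is not assumed normalised. Consequently \<open>tt \<one>\<close> is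
  truncation times the constant \<open>\<omega> (\<one>, \<one>)\<close>.\<close>

lemma one_right: "y \<in> carrier A \<Longrightarrow> \<omega> (y, \<one>) = \<omega> (\<one>, \<one>)"
  using cocycle[of y \<one> \<one>] nz[of y \<one>] by simp

text \<open>The cocycle relation at (y, x, x') says that \<open>tt\<close> is a projective
  representation with multiplier \<omega>.\<close>

lemma tt_tt:
  assumes "x \<in> carrier A" "x' \<in> carrier A"
  shows "tt x (tt x' f) = (\<lambda>y. \<omega> (x, x') * tt (x \<otimes> x') f y)"
proof
  fix y
  show "tt x (tt x' f) y = \<omega> (x, x') * tt (x \<otimes> x') f y"
    using cocycle[of y x x'] assms by (auto simp: tt_def m_assoc[symmetric])
qed

text \<open>The two products differ by the ratio of \<open>\<omega> (x, x')\<close> and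
  \<open>\<omega> (x', x)\<close>, which symmetry makes trivial.\<close>

lemma tt_commute:
  assumes "x \<in> carrier A" "x' \<in> carrier A"
  shows "tt x (tt x' f) = tt x' (tt x f)"
  using assms by (simp add: tt_tt sym[of x x'] m_comm[of x x'])

lemma tt_scale: "tt x (\<lambda>y. c * f y) = (\<lambda>y. c * tt x f y)"
  by (simp add: tt_def fun_eq_iff)

lemma tt_sum: "tt x (\<lambda>y. \<Sum>k\<in>K. f k y) = (\<lambda>y. \<Sum>k\<in>K. tt x (f k) y)"
  by (simp add: tt_def fun_eq_iff sum_distrib_left)

lemma tt_cut: "x \<in> carrier A \<Longrightarrow> tt x (trunc f) = tt x f"
  by (simp add: tt_def fun_eq_iff)

lemma tt_pow_scalar:
  assumes x: "x \<in> carrier A"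
  shows "\<exists>s. cmod s = 1 \<and> (\<forall>f. (tt x ^^ order A) f = (\<lambda>y. s * trunc f y))"
proof -
  \<comment> \<open>The induction starts at exponent one: the zeroth iterate is \<open>f\<close>
    itself, whereas \<open>tt \<one> f\<close> is truncated and scaled.\<close>
  have "\<exists>s. cmod s = 1 \<and> (\<forall>f. (tt x ^^ Suc j) f = (\<lambda>y. s * tt (x [^] Suc j) f y))" for j
  proof (induction j)
    case 0
    then show ?case using x by (intro exI[of _ 1]) simp
  next
    case (Suc j)
    then obtain s where s: "cmod s = 1" "\<And>f. (tt x ^^ Suc j) f = (\<lambda>y. s * tt (x [^] Suc j) f y)" by blast
    have "(tt x ^^ Suc (Suc j)) f = (\<lambda>y. s * \<omega> (x, x [^] Suc j) * tt (x [^] Suc (Suc j)) f y)" for f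
    proof -
      have "(tt x ^^ Suc (Suc j)) f = tt x ((tt x ^^ Suc j) f)" by simp
      also have "\<dots> = (\<lambda>y. s * tt x (tt (x [^] Suc j) f) y)" unfolding s(2) tt_scale ..
      also have "\<dots> = (\<lambda>y. s * \<omega> (x, x [^] Suc j) * tt (x [^] Suc (Suc j)) f y)"
        using x by (simp only: tt_tt nat_pow_closed nat_pow_Suc2[of x "Suc j"] mult.assoc)
      finally show ?thesis .
    qed
    then show ?case using s(1) norm[of x "x [^] Suc j"] x
      by (intro exI[of _ "s * \<omega> (x, x [^] Suc j)"]) (simp add: norm_mult)
  qed
  from this[of "order A - 1"] obtain s where s: "cmod s = 1"
    "\<And>f. (tt x ^^ Suc (order A - 1)) f = (\<lambda>y. s * tt (x [^] Suc (order A - 1)) f y)" by blast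
  have pos: "order A > 0" using fin by (simp add: order_gt_0_iff_finite)
  then have "Suc (order A - 1) = order A" by simp
  with s(2) have 1: "(tt x ^^ order A) f = (\<lambda>y. s * tt \<one> f y)" for f
    using pow_order_eq_1[OF x] by metis
  have "tt \<one> f y = \<omega> (\<one>, \<one>) * trunc f y" for f y
    using one_right[of y] by (simp add: tt_def trunc_def)
  then have "(tt x ^^ order A) f = (\<lambda>y. (s * \<omega> (\<one>, \<one>)) * trunc f y)" for f
    unfolding 1 by (simp add: mult.assoc)
  moreover have "cmod (s * \<omega> (\<one>, \<one>)) = 1" by (simp add: norm_mult s(1) norm)
  ultimately show ?thesis by (intro exI[of _ "s * \<omega> (\<one>, \<one>)"]) auto
qed

text \<open>The \<open>N\<close>-th power of \<open>tt x\<close> is a scalar \<open>s\<close>, with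
  \<open>N\<close> the order of the group, so the eigenvalues are among the \<open>N\<close> roots
  \<open>w k\<close> of \<open>s\<close>. The piece \<open>g k\<close> is the spectral projection,
  the average over \<open>j < N\<close> of the \<open>j\<close>-th power of \<open>tt x\<close>
  scaled by the \<open>j\<close>-th inverse power of \<open>w k\<close>. As a polynomial in
  \<open>tt x\<close> it commutes with every \<open>tt x'\<close> and keeps eigenvectors of
  \<open>tt x'\<close> with their eigenvalue.\<close>

lemma eigen_decomposition:
  assumes x: "x \<in> carrier A"
  shows "\<exists>g. (\<forall>y. trunc f y = (\<Sum>k<order A. g k y)) \<and>
    (\<forall>k. \<exists>c. tt x (g k) = (\<lambda>y. c * g k y)) \<and>
    (\<forall>k. \<forall>x'\<in>carrier A. \<forall>c. tt x' (trunc f) = (\<lambda>y. c * trunc f y) \<longrightarrow> tt x' (g k) = (\<lambda>y. c * g k y))"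
proof -
  define N where "N = order A"
  have N: "N > 0" using fin by (simp add: N_def order_gt_0_iff_finite)
  define F where "F = trunc f"
  have cutF: "trunc F = F" by (simp add: F_def)
  obtain s where s: "cmod s = 1" "(tt x ^^ N) F = (\<lambda>y. s * F y)"
  proof -
    obtain s where "cmod s = 1" "\<forall>f. (tt x ^^ N) f = (\<lambda>y. s * trunc f y)"
      using tt_pow_scalar[OF x] unfolding N_def by blast
    then show thesis using that[of s] by (simp add: cutF)
  qed
  have "s \<noteq> 0" using s(1) by auto
  obtain r where r: "s = r ^ N"
    using exists_complex_root[of N s] N by auto
  then have r0: "r \<noteq> 0" using \<open>s \<noteq> 0\<close> N by auto
  define \<zeta> where "\<zeta> = cis (2 * pi / N)"
  have \<zeta>N: "\<zeta> ^ N = 1"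
    unfolding \<zeta>_def Complex.DeMoivre using N by simp
  have \<zeta>0: "\<zeta> \<noteq> 0" by (simp add: \<zeta>_def)
  have \<zeta>1: "inverse \<zeta> ^ j \<noteq> 1" if j: "0 < j" "j < N" for j
  proof
    assume "inverse \<zeta> ^ j = 1"
    then have "\<zeta> ^ j = 1" by (simp add: power_inverse)
    then have "cis (real j * (2 * pi / N)) = 1" unfolding \<zeta>_def Complex.DeMoivre .
    from arg_cong[OF this, of Re] have "cos (real j * (2 * pi / N)) = 1"
      by (simp only: cis.sel one_complex.sel)
    then obtain m :: int where "real j * (2 * pi / N) = of_int m * 2 * pi"
      by (auto simp: cos_one_2pi_int)
    then have "real j = of_int m * real N" using N by (simp add: field_simps)
    then have m: "int j = m * int N" by (metis of_int_eq_iff of_int_mult of_int_of_nat_eq)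
    have "0 < m * int N" "m * int N < 1 * int N" using j unfolding m[symmetric] by auto
    then have "0 < m" "m < 1" using N by (auto simp: zero_less_mult_iff)
    then show False by simp
  qed
  define w where "w k = r * \<zeta> ^ k" for k
  have w0: "w k \<noteq> 0" for k using r0 \<zeta>0 by (simp add: w_def)
  have wN: "w k ^ N = s" for k
    using \<zeta>N by (simp add: w_def power_mult_distrib r mult.commute power_mult[symmetric]) (simp add: power_mult mult.commute)
  define g where "g k = (\<lambda>y. \<Sum>j<N. inverse (of_nat N) * inverse (w k) ^ j * (tt x ^^ j) F y)" for k
  have sum_g: "F y = (\<Sum>k<N. g k y)" for y
  proof -
    have "(\<Sum>k<N. g k y) = (\<Sum>j<N. \<Sum>k<N. inverse (of_nat N) * inverse (w k) ^ j * (tt x ^^ j) F y)"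
      unfolding g_def by (rule sum.swap)
    also have "\<dots> = (\<Sum>j<N. (inverse (of_nat N) * inverse r ^ j * (tt x ^^ j) F y) * (\<Sum>k<N. (inverse \<zeta> ^ j) ^ k))"
    proof -
      have "inverse (\<zeta> ^ k) ^ j = inverse \<zeta> ^ (j * k)" for j k
        by (simp add: power_inverse power_mult[symmetric] mult.commute)
      then show ?thesis
        by (simp add: sum_distrib_left w_def power_mult_distrib power_mult[symmetric] mult_ac)
    qed
    also have "\<dots> = (\<Sum>j<N. if j = 0 then F y else 0)"
    proof (rule sum.cong[OF refl])
      fix j assume "j \<in> {..<N}"
      then have j: "j < N" by simp
      show "(inverse (of_nat N) * inverse r ^ j * (tt x ^^ j) F y) * (\<Sum>k<N. (inverse \<zeta> ^ j) ^ k) = (if j = 0 then F y else 0)"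
      proof (cases "j = 0")
        case True
        then show ?thesis using N by simp
      next
        case False
        have "(inverse \<zeta> ^ j) ^ N = (inverse \<zeta> ^ N) ^ j" by (simp only: power_mult[symmetric] mult.commute)
        also have "\<dots> = 1" by (simp add: power_inverse \<zeta>N)
        finally have "(\<Sum>k<N. (inverse \<zeta> ^ j) ^ k) = 0"
          using \<zeta>1[of j] j False by (intro sum_root_of_unity_powers) auto
        then show ?thesis using False by simp
      qed
    qed
    also have "\<dots> = F y" using N by simp
    finally show ?thesis ..
  qed
  have tt_g: "tt x' (g k) = (\<lambda>y. \<Sum>j<N. inverse (of_nat N) * inverse (w k) ^ j * tt x' ((tt x ^^ j) F) y)" for x' k
    unfolding g_def tt_sum tt_scale ..
  have eig: "tt x (g k) = (\<lambda>y. w k * g k y)" for k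
  proof
    fix y
    define a where "a j = inverse (of_nat N) * inverse (w k) ^ j * (tt x ^^ j) F y" for j
    have "tt x (g k) y = w k * (\<Sum>j<N. a (Suc j))"
      unfolding tt_g a_def using w0[of k] by (simp add: sum_distrib_left field_simps)
    \<comment> \<open>The shifted sum gains the term at \<open>N\<close> and loses the one at 0;
      they agree because \<open>w k ^ N = s\<close>.\<close>
    also have "(\<Sum>j<N. a (Suc j)) = (\<Sum>j<N. a j) + a N - a 0"
      using sum.lessThan_Suc_shift[of a N] by simp
    also have "a N = a 0"
      unfolding a_def s(2) using wN[of k] \<open>s \<noteq> 0\<close> by (simp add: power_inverse)
    finally show "tt x (g k) y = w k * g k y" by (simp add: a_def g_def)
  qed
  have pres: "tt x' (g k) = (\<lambda>y. c * g k y)"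
    if x': "x' \<in> carrier A" and c: "tt x' F = (\<lambda>y. c * F y)" for k x' c
  proof -
    have "tt x' ((tt x ^^ j) F) = (\<lambda>y. c * (tt x ^^ j) F y)" for j
    proof (induction j)
      case (Suc j)
      have "tt x' ((tt x ^^ Suc j) F) = tt x (tt x' ((tt x ^^ j) F))"
        by (simp add: tt_commute[OF x' x])
      then show ?case using Suc by (simp add: tt_scale)
    qed (simp add: c)
    then have "tt x' (g k) y = c * g k y" for y
      unfolding tt_g by (simp add: g_def sum_distrib_left mult_ac)
    then show ?thesis by (rule ext)
  qed
  show ?thesis
    unfolding N_def[symmetric] F_def[symmetric] using sum_g eig pres by (intro exI[of _ g]) blast
qed

text \<open>Induction on the finite set \<open>Y\<close> of group elements for which the truncated
  function is not yet known to be an eigenvector: a decomposition along one of them settles it and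
  spoils none of the others. The predicate \<open>Q\<close> is abstract since the principle serves
  both the coboundary statement and the separation of points by characters.\<close>

lemma joint_eigenvector_induct:
  fixes Q :: "('a \<Rightarrow> complex) \<Rightarrow> bool"
  assumes sum: "\<And>n g. (\<And>k :: nat. k < n \<Longrightarrow> Q (g k)) \<Longrightarrow> Q (\<lambda>y. \<Sum>k<n. g k y)"
    and eig: "\<And>f. (\<And>x. x \<in> carrier A \<Longrightarrow> \<exists>c. \<forall>y\<in>carrier A. \<omega> (y, x) * f (y \<otimes> x) = c * f y) \<Longrightarrow> Q f"
    and ext: "\<And>f. Q (trunc f) \<Longrightarrow> Q f"
  shows "Q f"
proof -
  have "(\<forall>x\<in>carrier A - Y. \<exists>c. tt x (trunc f) = (\<lambda>y. c * trunc f y)) \<Longrightarrow> Q f"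
    if "finite Y" "Y \<subseteq> carrier A" for Y f
    using that
  proof (induction Y arbitrary: f rule: finite_induct)
    case empty
    show ?case
    proof (rule eig)
      fix x assume x: "x \<in> carrier A"
      then obtain c where c: "tt x (trunc f) = (\<lambda>y. c * trunc f y)" using empty by auto
      have "\<omega> (y, x) * f (y \<otimes> x) = c * f y" if "y \<in> carrier A" for y
        using fun_cong[OF c, of y] that x by (simp add: tt_def)
      then show "\<exists>c. \<forall>y\<in>carrier A. \<omega> (y, x) * f (y \<otimes> x) = c * f y" by blast
    qed
  next
    case (insert x Y)
    note hyp = insert.prems(1)
    have x: "x \<in> carrier A" using insert by auto
    obtain g where g: "\<And>y. trunc f y = (\<Sum>k<order A. g k y)"
      "\<And>k. \<exists>c. tt x (g k) = (\<lambda>y. c * g k y)"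
      "\<And>k x' c. x' \<in> carrier A \<Longrightarrow> tt x' (trunc f) = (\<lambda>y. c * trunc f y) \<Longrightarrow> tt x' (g k) = (\<lambda>y. c * g k y)"
      using eigen_decomposition[OF x, of f] by auto
    have lift: "\<exists>c. tt x' (trunc (g k)) = (\<lambda>y. c * trunc (g k) y)"
      if x': "x' \<in> carrier A" and ex: "\<exists>c. tt x' (g k) = (\<lambda>y. c * g k y)" for k x'
    proof -
      obtain c where c: "tt x' (g k) = (\<lambda>y. c * g k y)" using ex by blast
      have "tt x' (trunc (g k)) y = c * trunc (g k) y" for y
        using fun_cong[OF c, of y] unfolding tt_cut[OF x'] by (cases "y \<in> carrier A") (simp_all add: tt_def trunc_def)
      then show ?thesis by blast
    qed
    have Qg: "Q (g k)" for k
    proof (rule insert.IH)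
      show "Y \<subseteq> carrier A" using insert by auto
      show "\<forall>x'\<in>carrier A - Y. \<exists>c. tt x' (trunc (g k)) = (\<lambda>y. c * trunc (g k) y)"
      proof
        fix x' assume x': "x' \<in> carrier A - Y"
        show "\<exists>c. tt x' (trunc (g k)) = (\<lambda>y. c * trunc (g k) y)"
        proof (rule lift)
          show "\<exists>c. tt x' (g k) = (\<lambda>y. c * g k y)"
          proof (cases "x' = x")
            case True
            then show ?thesis using g(2)[of k] by simp
          next
            case False
            with x' have mem: "x' \<in> carrier A - insert x Y" and x'A: "x' \<in> carrier A" by auto
            from bspec[OF hyp mem] obtain c where "tt x' (trunc f) = (\<lambda>y. c * trunc f y)" ..
            from g(3)[OF x'A this] show ?thesis ..
          qed
        qed (use x' in auto)
      qed
    qed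
    have "Q (\<lambda>y. \<Sum>k<order A. g k y)" by (rule sum) (rule Qg)
    then have "Q (trunc f)" unfolding g(1) .
    then show ?case by (rule ext)
  qed
  from this[OF fin subset_refl] show ?thesis by simp
qed

text \<open>A power of the eigenvalue equals the unimodular scalar to which that power of
  \<open>tt x\<close> reduces.\<close>

lemma eigenvalue_norm:
  assumes x: "x \<in> carrier A" and c: "\<And>y. y \<in> carrier A \<Longrightarrow> \<omega> (y, x) * f (y \<otimes> x) = c * f y"
    and y: "y \<in> carrier A" "f y \<noteq> 0"
  shows "cmod c = 1"
proof -
  have N: "order A > 0" using fin by (simp add: order_gt_0_iff_finite)
  obtain s where s: "cmod s = 1" "(tt x ^^ order A) (trunc f) = (\<lambda>y. s * trunc f y)"
    using tt_pow_scalar[OF x] by (metis trunc_trunc)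
  have 1: "tt x (trunc f) = (\<lambda>y. c * trunc f y)"
    using c x by (auto simp: tt_def trunc_def fun_eq_iff)
  have "(tt x ^^ j) (trunc f) = (\<lambda>y. c ^ j * trunc f y)" for j
    by (induction j) (simp_all add: tt_scale 1 mult_ac)
  from fun_cong[OF this, of "order A" y] have "c ^ order A = s"
    using y unfolding s(2) by simp
  then have "cmod c ^ order A = 1" using s(1) by (metis norm_power)
  then show ?thesis using N power_eq_iff_eq_base[of "order A" "cmod c" 1] by simp
qed

text \<open>A joint eigenvector that is nonzero somewhere on the carrier would trivialise \<omega>
  by its eigenvalues. If \<omega> were not a coboundary, all joint eigenvectors, hence all
  functions, would therefore vanish on the carrier, and the constant 1 does not.\<close>

lemma coboundary:
  "\<exists>c. (\<forall>a\<in>carrier A. cmod (c a) = 1) \<and>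
     (\<forall>a\<in>carrier A. \<forall>b\<in>carrier A. \<omega> (a, b) = c a * c b * inverse (c (a \<otimes> b)))"
proof (rule ccontr)
  assume contra: "\<not> ?thesis"
  have "\<forall>y\<in>carrier A. f y = 0" for f :: "'a \<Rightarrow> complex"
  proof (rule joint_eigenvector_induct[where Q="\<lambda>f. \<forall>y\<in>carrier A. f y = 0"])
    fix f :: "'a \<Rightarrow> complex"
    assume "\<And>x. x \<in> carrier A \<Longrightarrow> \<exists>c. \<forall>y\<in>carrier A. \<omega> (y, x) * f (y \<otimes> x) = c * f y"
    then obtain c where c: "\<And>x y. x \<in> carrier A \<Longrightarrow> y \<in> carrier A \<Longrightarrow> \<omega> (y, x) * f (y \<otimes> x) = c x * f y"
      by metis
    show "\<forall>y\<in>carrier A. f y = 0"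
    proof (rule ccontr)
      assume "\<not> (\<forall>y\<in>carrier A. f y = 0)"
      then obtain y0 where y0: "y0 \<in> carrier A" "f y0 \<noteq> 0" by blast
      have c1: "cmod (c x) = 1" if "x \<in> carrier A" for x
        by (rule eigenvalue_norm[OF that c[OF that] y0])
      then have c0: "c x \<noteq> 0" if "x \<in> carrier A" for x using that by fastforce
      \<comment> \<open>The eigenvector equation translates a single nonzero value to every
        point.\<close>
      have f0: "f y \<noteq> 0" if y: "y \<in> carrier A" for y
      proof
        assume "f y = 0"
        moreover have "y0 \<otimes> (inv y0 \<otimes> y) = y" using y y0 by (simp add: m_assoc[symmetric])
        ultimately show False
          using c[of "inv y0 \<otimes> y" y0] c0[of "inv y0 \<otimes> y"] y y0 by simp
      qed
      \<comment> \<open>So \<open>f\<close> is a constant multiple of the eigenvalue function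
        \<open>c\<close>. The constant cancels in the next computation, leaving \<open>c\<close> as
        the trivialising cochain.\<close>
      have fx: "f x = c x * (f \<one> / \<omega> (\<one>, \<one>))" if "x \<in> carrier A" for x
        using c[of x \<one>] that sym[of \<one> x] one_right[of x] nz[of \<one> \<one>] by (simp add: field_simps)
      have "\<omega> (a, b) = c a * c b * inverse (c (a \<otimes> b))" if a: "a \<in> carrier A" and b: "b \<in> carrier A" for a b
      proof -
        have "\<omega> (a, b) * (c (a \<otimes> b) * (f \<one> / \<omega> (\<one>, \<one>))) = c b * (c a * (f \<one> / \<omega> (\<one>, \<one>)))"
          using c[OF b a] fx[OF a] fx[of "a \<otimes> b"] a b by simp
        moreover have "f \<one> / \<omega> (\<one>, \<one>) \<noteq> 0" using f0[of \<one>] nz[of \<one> \<one>] by simp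
        ultimately have "\<omega> (a, b) * c (a \<otimes> b) = c b * c a"
          by (metis mult.assoc mult_right_cancel)
        then show ?thesis using c0[of "a \<otimes> b"] a b by (simp add: field_simps)
      qed
      then show False using contra c1 by blast
    qed
  qed auto
  from this[of "\<lambda>_. 1"] show False by auto
qed

end

text \<open>For the cocycle 1 a joint eigenvector is its value at the unit times a character. If all
  characters were 1 at \<open>a\<close>, every function would agree at \<open>a\<close> and at the
  unit, but the indicator of the unit does not.\<close>

lemma (in comm_group) characters_separate:
  assumes fin: "finite (carrier G)" and a: "a \<in> carrier G" "a \<noteq> \<one>"
  shows "\<exists>\<xi>\<in>hom G circle_group \<inter> extensional (carrier G). \<xi> a \<noteq> 1"
proof (rule ccontr)
  assume "\<not> ?thesis"
  then have contra: "\<forall>\<xi>\<in>hom G circle_group \<inter> extensional (carrier G). \<xi> a = 1" by simp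
  interpret finite_sym_cocycle G "\<lambda>_. 1"
    by unfold_locales (auto simp: fin)
  have "f a = f \<one>" for f :: "'a \<Rightarrow> complex"
  proof (rule joint_eigenvector_induct[where Q="\<lambda>f. f a = f \<one>"])
    fix f :: "'a \<Rightarrow> complex"
    assume "\<And>x. x \<in> carrier G \<Longrightarrow> \<exists>c. \<forall>y\<in>carrier G. 1 * f (y \<otimes> x) = c * f y"
    then obtain c where c: "\<And>x y. x \<in> carrier G \<Longrightarrow> y \<in> carrier G \<Longrightarrow> f (y \<otimes> x) = c x * f y"
      by (metis mult_1)
    have fx: "f x = c x * f \<one>" if "x \<in> carrier G" for x using c[of x \<one>] that by simp
    show "f a = f \<one>"
    proof (cases "f \<one> = 0")
      case False
      have "c (x \<otimes> y) = c x * c y" if "x \<in> carrier G" "y \<in> carrier G" for x y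
      proof -
        have "c (x \<otimes> y) * f \<one> = c y * (c x * f \<one>)"
          using c[of y x] fx[of x] fx[of "x \<otimes> y"] that by simp
        then show ?thesis using False by simp
      qed
      moreover have "cmod (c x) = 1" if "x \<in> carrier G" for x
        by (rule eigenvalue_norm[of x f "c x" \<one>]) (use c that False in auto)
      ultimately have "restrict c (carrier G) \<in> hom G circle_group \<inter> extensional (carrier G)"
        by (auto simp: hom_def)
      from bspec[OF contra this] have "c a = 1" using a(1) by simp
      then show ?thesis using fx[OF a(1)] by simp
    qed (use fx[OF a(1)] in simp)
  qed (use a in auto)
  from this[of "\<lambda>x. of_bool (x = \<one>)"] show False using a(2) by simp
qed

section \<open>The dual group and orthogonality of characters\<close>

context comm_group
begin

abbreviation "dual \<equiv> pontryagin_dual G"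

lemma dual_simps:
  "carrier dual = hom G circle_group \<inter> extensional (carrier G)"
  "\<xi> \<otimes>\<^bsub>dual\<^esub> \<eta> = (\<lambda>g\<in>carrier G. \<xi> g * \<eta> g)" "\<one>\<^bsub>dual\<^esub> = (\<lambda>g\<in>carrier G. 1)"
  by (simp_all add: pontryagin_dual_def)

lemma
  assumes "\<xi> \<in> carrier dual"
  shows character_norm: "g \<in> carrier G \<Longrightarrow> cmod (\<xi> g) = 1"
    and character_mult: "g \<in> carrier G \<Longrightarrow> h \<in> carrier G \<Longrightarrow> \<xi> (g \<otimes> h) = \<xi> g * \<xi> h"
    and character_ext: "\<xi> \<in> extensional (carrier G)"
  using assms by (auto simp: dual_simps hom_def Pi_def)

lemma character_one: "\<xi> \<in> carrier dual \<Longrightarrow> \<xi> \<one> = 1"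
  using character_mult[of \<xi> \<one> \<one>] character_norm[of \<xi> \<one>] by auto

lemma character_inv:
  assumes "\<xi> \<in> carrier dual" "g \<in> carrier G"
  shows "\<xi> (inv g) = cnj (\<xi> g)"
proof -
  have "\<xi> g * \<xi> (inv g) = 1"
    using assms by (simp add: character_mult[symmetric] character_one)
  moreover have "\<xi> g * cnj (\<xi> g) = 1"
    using character_norm[OF assms] by (simp add: complex_norm_square[symmetric])
  ultimately show ?thesis by (metis mult_left_cancel mult_zero_left zero_neq_one)
qed

lemma dual_comm_group: "comm_group dual"
proof (rule comm_groupI)
  fix \<xi> \<eta> assume *: "\<xi> \<in> carrier dual" "\<eta> \<in> carrier dual"
  then show "\<xi> \<otimes>\<^bsub>dual\<^esub> \<eta> \<in> carrier dual"
    by (auto simp: dual_simps hom_def Pi_def norm_mult)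
  show "\<xi> \<otimes>\<^bsub>dual\<^esub> \<eta> = \<eta> \<otimes>\<^bsub>dual\<^esub> \<xi>" by (auto simp: dual_simps mult.commute)
  fix \<zeta> assume "\<zeta> \<in> carrier dual"
  show "\<xi> \<otimes>\<^bsub>dual\<^esub> \<eta> \<otimes>\<^bsub>dual\<^esub> \<zeta> = \<xi> \<otimes>\<^bsub>dual\<^esub> (\<eta> \<otimes>\<^bsub>dual\<^esub> \<zeta>)" by (auto simp: dual_simps)
next
  fix \<xi> assume \<xi>: "\<xi> \<in> carrier dual"
  show "\<one>\<^bsub>dual\<^esub> \<otimes>\<^bsub>dual\<^esub> \<xi> = \<xi>"
    using character_ext[OF \<xi>] by (auto simp: dual_simps intro!: extensionalityI[of _ "carrier G"])
  have "(\<lambda>g\<in>carrier G. cnj (\<xi> g)) \<in> carrier dual"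
    using \<xi> by (auto simp: dual_simps hom_def Pi_def)
  moreover have "(\<lambda>g\<in>carrier G. cnj (\<xi> g)) \<otimes>\<^bsub>dual\<^esub> \<xi> = \<one>\<^bsub>dual\<^esub>"
    using character_norm[OF \<xi>]
    by (auto simp: dual_simps complex_norm_square[symmetric] mult.commute intro!: restrict_ext)
  ultimately show "\<exists>\<eta>\<in>carrier dual. \<eta> \<otimes>\<^bsub>dual\<^esub> \<xi> = \<one>\<^bsub>dual\<^esub>" by blast
qed (auto simp: dual_simps hom_def)

text \<open>Characters take values in the roots of unity whose order is that of the group.\<close>

lemma finite_dual:
  assumes fin: "finite (carrier G)"
  shows "finite (carrier dual)"
proof (rule finite_subset)
  have N: "order G > 0" using fin by (simp add: order_gt_0_iff_finite)
  have pow: "\<xi> (x [^] n) = \<xi> x ^ n" if "\<xi> \<in> carrier dual" "x \<in> carrier G" for \<xi> x and n :: nat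
    using that by (induction n) (simp_all add: character_one character_mult)
  show "carrier dual \<subseteq> PiE (carrier G) (\<lambda>_. {z. z ^ order G = 1})"
  proof
    fix \<xi> assume \<xi>: "\<xi> \<in> carrier dual"
    have "\<xi> x ^ order G = 1" if "x \<in> carrier G" for x
      using pow[OF \<xi> that, of "order G"] pow_order_eq_1[OF that] character_one[OF \<xi>] by simp
    then show "\<xi> \<in> PiE (carrier G) (\<lambda>_. {z. z ^ order G = 1})"
      using character_ext[OF \<xi>] by (auto simp: PiE_def)
  qed
  show "finite (PiE (carrier G) (\<lambda>_. {z :: complex. z ^ order G = 1}))"
    by (intro finite_PiE fin finite_roots_unity) (use N in simp)
qed

text \<open>Translating the sum by \<open>a\<close> multiplies it by \<open>\<psi> a\<close>. Only
  multiplicativity of \<psi> enters, so the lemma also applies on the dual, to evaluation at a group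
  element.\<close>

lemma sum_character_zero:
  fixes \<psi> :: "'a \<Rightarrow> complex"
  assumes "\<And>g h. g \<in> carrier G \<Longrightarrow> h \<in> carrier G \<Longrightarrow> \<psi> (g \<otimes> h) = \<psi> g * \<psi> h"
    and a: "a \<in> carrier G" "\<psi> a \<noteq> 1"
  shows "(\<Sum>g\<in>carrier G. \<psi> g) = 0"
proof -
  have "(\<Sum>g\<in>carrier G. \<psi> g) = (\<Sum>g\<in>carrier G. \<psi> (a \<otimes> g))"
    by (rule sum.reindex_bij_witness[where i="\<lambda>g. a \<otimes> g" and j="\<lambda>g. inv a \<otimes> g"])
      (use a in \<open>auto simp: m_assoc[symmetric]\<close>)
  also have "\<dots> = \<psi> a * (\<Sum>g\<in>carrier G. \<psi> g)"
    using assms by (simp add: sum_distrib_left)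
  finally show ?thesis using a(2) by simp
qed

lemma character_orthogonality:
  assumes fin: "finite (carrier G)" and \<xi>: "\<xi> \<in> carrier dual" and \<eta>: "\<eta> \<in> carrier dual"
  shows "(\<Sum>g\<in>carrier G. cnj (\<xi> g) * \<eta> g) = (if \<xi> = \<eta> then of_nat (card (carrier G)) else 0)"
proof (cases "\<xi> = \<eta>")
  case True
  have "cnj (\<eta> g) * \<eta> g = 1" if "g \<in> carrier G" for g
    using character_norm[OF \<eta> that] by (simp add: complex_norm_square[symmetric] mult.commute)
  then show ?thesis using True by simp
next
  case False
  then obtain a where a: "a \<in> carrier G" "\<xi> a \<noteq> \<eta> a"
    using character_ext[OF \<xi>] character_ext[OF \<eta>] by (metis extensionalityI)
  have *: "\<xi> a * (cnj (\<xi> a) * \<eta> a) = \<eta> a"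
    using character_norm[OF \<xi> a(1)] by (simp add: mult.assoc[symmetric] complex_norm_square[symmetric])
  have "cnj (\<xi> a) * \<eta> a \<noteq> 1"
  proof
    assume "cnj (\<xi> a) * \<eta> a = 1"
    with * have "\<xi> a * 1 = \<eta> a" by (simp only:)
    then show False using a(2) by simp
  qed
  then have "(\<Sum>g\<in>carrier G. cnj (\<xi> g) * \<eta> g) = 0"
    by (intro sum_character_zero[OF _ a(1)]) (simp_all add: character_mult \<xi> \<eta> mult_ac)
  then show ?thesis using False by simp
qed

text \<open>Away from the unit, evaluation is a multiplicative function on the dual that is
  nontrivial because characters separate points. At the unit the sum is the size of the dual, found
  by summing all values of all characters in both orders.\<close>

lemma sum_characters:
  assumes fin: "finite (carrier G)" and g: "g \<in> carrier G"
  shows "(\<Sum>\<xi>\<in>carrier dual. \<xi> g) = (if g = \<one> then of_nat (card (carrier G)) else 0)"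
proof -
  interpret D: comm_group dual by (rule dual_comm_group)
  have 1: "(\<Sum>\<xi>\<in>carrier dual. \<xi> g) = 0" if g: "g \<in> carrier G" "g \<noteq> \<one>" for g
  proof -
    obtain \<eta> where \<eta>: "\<eta> \<in> carrier dual" "\<eta> g \<noteq> 1"
      using characters_separate[OF fin g] by (auto simp: dual_simps)
    show ?thesis
      by (rule D.sum_character_zero[where \<psi>="\<lambda>\<xi>. \<xi> g", OF _ \<eta>]) (use g in \<open>simp add: dual_simps\<close>)
  qed
  have "(\<Sum>\<xi>\<in>carrier dual. \<Sum>g\<in>carrier G. \<xi> g) = (\<Sum>\<xi>\<in>carrier dual. if \<xi> = \<one>\<^bsub>dual\<^esub> then of_nat (card (carrier G)) else 0)"
  proof (rule sum.cong[OF refl])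
    fix \<xi> assume "\<xi> \<in> carrier dual"
    from character_orthogonality[OF fin D.one_closed this]
    show "(\<Sum>g\<in>carrier G. \<xi> g) = (if \<xi> = \<one>\<^bsub>dual\<^esub> then of_nat (card (carrier G)) else 0)"
      by (simp add: dual_simps eq_commute[of \<xi>])
  qed
  also have "\<dots> = of_nat (card (carrier G))"
    using finite_dual[OF fin] D.one_closed by simp
  finally have "of_nat (card (carrier G)) = (\<Sum>g\<in>carrier G. \<Sum>\<xi>\<in>carrier dual. \<xi> g)"
    by (subst sum.swap) simp
  also have "\<dots> = (\<Sum>g\<in>{\<one>}. \<Sum>\<xi>\<in>carrier dual. \<xi> g)"
    by (rule sum.mono_neutral_right) (use fin 1 in auto)
  finally have "(\<Sum>\<xi>\<in>carrier dual. \<xi> \<one>) = of_nat (card (carrier G))" by simp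
  then show ?thesis using 1[OF g] by auto
qed

end

section \<open>Second cohomology with circle coefficients\<close>

lemma two_coboundaries_circle:
  assumes "group D"
  shows "two_coboundaries D circle_group =
    {(\<lambda>(a, b)\<in>carrier D \<times> carrier D. f a * f b * inverse (f (a \<otimes>\<^bsub>D\<^esub> b))) | f. \<forall>a\<in>carrier D. cmod (f a) = 1}"
proof -
  interpret group D by fact
  have "(\<lambda>(a, b)\<in>carrier D \<times> carrier D. f a \<otimes>\<^bsub>circle_group\<^esub> f b \<otimes>\<^bsub>circle_group\<^esub> inv\<^bsub>circle_group\<^esub> f (a \<otimes>\<^bsub>D\<^esub> b))
      = (\<lambda>(a, b)\<in>carrier D \<times> carrier D. f a * f b * inverse (f (a \<otimes>\<^bsub>D\<^esub> b)))"
    if "\<forall>a\<in>carrier D. cmod (f a) = 1" for f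
    by (rule restrict_ext) (use that in \<open>auto simp: inv_circle\<close>)
  then show ?thesis
    unfolding two_coboundaries_def Pi_def circle_group_simps(1) mem_Collect_eq
    by (intro Collect_cong iff_exI) auto
qed

text \<open>If every cocycle were a coboundary, every coset of the coboundaries would be that set
  itself, the unit of the quotient. The coset equality is verified on cochains, with pointwise
  products and quotients as witnesses.\<close>

lemma H2_nontrivialD:
  assumes D: "group D" and nt: "carrier (H2 D circle_group) \<noteq> {\<one>\<^bsub>H2 D circle_group\<^esub>}"
  shows "\<exists>\<omega>\<in>carrier (two_cocycles D circle_group). \<omega> \<notin> two_coboundaries D circle_group"
proof (rule ccontr)
  assume "\<not> ?thesis"
  then have all: "\<omega> \<in> two_coboundaries D circle_group" if "\<omega> \<in> carrier (two_cocycles D circle_group)" for \<omega>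
    using that by blast
  interpret group D by fact
  let ?Z = "two_cocycles D circle_group" and ?B = "two_coboundaries D circle_group"
  let ?cob = "\<lambda>f :: 'a \<Rightarrow> complex. (\<lambda>(a, b)\<in>carrier D \<times> carrier D. f a * f b * inverse (f (a \<otimes>\<^bsub>D\<^esub> b)))"
  have cob: "?cob f \<in> ?B" if "\<And>a. a \<in> carrier D \<Longrightarrow> cmod (f a) = 1" for f
    unfolding two_coboundaries_circle[OF D] using that by blast
  have mult: "?cob f \<otimes>\<^bsub>?Z\<^esub> ?cob f' = ?cob (\<lambda>a. f a * f' a)" for f f'
    by (auto simp: two_cocycles_def intro!: restrict_ext)
  have coset: "?B #>\<^bsub>?Z\<^esub> \<omega> = ?B" if \<omega>: "\<omega> \<in> carrier ?Z" for \<omega>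
  proof -
    obtain f where f: "\<omega> = ?cob f" "\<And>a. a \<in> carrier D \<Longrightarrow> cmod (f a) = 1"
      using all[OF \<omega>] unfolding two_coboundaries_circle[OF D] by blast
    show ?thesis
    proof
      show "?B #>\<^bsub>?Z\<^esub> \<omega> \<subseteq> ?B"
      proof
        fix b assume "b \<in> ?B #>\<^bsub>?Z\<^esub> \<omega>"
        then obtain f' where b: "b = ?cob f' \<otimes>\<^bsub>?Z\<^esub> \<omega>" and f': "\<And>a. a \<in> carrier D \<Longrightarrow> cmod (f' a) = 1"
          unfolding r_coset_def two_coboundaries_circle[OF D] by blast
        show "b \<in> ?B" unfolding b f(1) mult by (rule cob) (simp add: norm_mult f(2) f')
      qed
      show "?B \<subseteq> ?B #>\<^bsub>?Z\<^esub> \<omega>"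
      proof
        fix b assume "b \<in> ?B"
        then obtain f' where b: "b = ?cob f'" and f': "\<And>a. a \<in> carrier D \<Longrightarrow> cmod (f' a) = 1"
          unfolding two_coboundaries_circle[OF D] by blast
        have f0: "f a \<noteq> 0" if "a \<in> carrier D" for a using f(2)[OF that] by auto
        have "b = ?cob (\<lambda>a. f' a / f a) \<otimes>\<^bsub>?Z\<^esub> \<omega>"
          unfolding f(1) mult[of "\<lambda>a. f' a / f a" f] b by (rule restrict_ext) (auto simp: f0)
        moreover have "?cob (\<lambda>a. f' a / f a) \<in> ?B" by (rule cob) (simp add: norm_divide f f')
        ultimately show "b \<in> ?B #>\<^bsub>?Z\<^esub> \<omega>" unfolding r_coset_def by blast
      qed
    qed
  qed
  \<comment> \<open>A cocycle must exist, for otherwise the set of cosets would be empty and not a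
    singleton.\<close>
  have "(\<lambda>p\<in>carrier D \<times> carrier D. 1) \<in> carrier ?Z"
    by (auto simp: two_cocycles_def)
  then have "carrier ?Z \<noteq> {}" by blast
  then have "carrier (H2 D circle_group) = {?B}"
    unfolding H2_def FactGroup_def RCOSETS_def using coset by auto
  then show False using nt by (simp add: H2_def FactGroup_def)
qed

subsection \<open>The twist attached to a 2-cocycle on the dual of a finite abelian subgroup\<close>

locale dual_twist = group G for G (structure) +
  fixes G0 :: "'a set" and \<omega> :: "('a \<Rightarrow> complex) \<times> ('a \<Rightarrow> complex) \<Rightarrow> complex"
  assumes sub: "subgroup G0 G" and fin: "finite G0" and comm: "comm_group (G\<lparr>carrier := G0\<rparr>)"
    and \<omega>: "\<omega> \<in> carrier (two_cocycles (pontryagin_dual (G\<lparr>carrier := G0\<rparr>)) circle_group)"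
begin

text \<open>After the rewrites facts about the subgroup speak of \<open>G0\<close> and the
  operations of \<open>G\<close>. Inverses are not rewritten, which is why
  \<open>character_inv\<close> is restated below.\<close>

sublocale A: comm_group "G\<lparr>carrier := G0\<rparr>"
  rewrites "carrier (G\<lparr>carrier := G0\<rparr>) = G0"
    and "mult (G\<lparr>carrier := G0\<rparr>) = mult G"
    and "one (G\<lparr>carrier := G0\<rparr>) = one G"
  by (rule comm) simp_all

abbreviation "\<Gamma> \<equiv> carrier (pontryagin_dual (G\<lparr>carrier := G0\<rparr>))"
abbreviation "n \<equiv> of_nat (card G0) :: complex"
abbreviation "u \<equiv> left_regular G"
abbreviation "E \<equiv> left_regular G \<one>"

lemmas car = subgroup.mem_carrier[OF sub]

lemma ub [simp]: "g \<in> G0 \<Longrightarrow> u g \<in> bounded_ops"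
  using car by simp

lemma Eb [simp]: "E \<in> bounded_ops" by simp

lemma invG0: "g \<in> G0 \<Longrightarrow> inv g \<in> G0" by (rule subgroup.m_inv_closed[OF sub])

lemma n0: "n \<noteq> 0" using fin subgroup.one_closed[OF sub] by auto

lemma fin\<Gamma>: "finite \<Gamma>" by (rule A.finite_dual[OF fin])

text \<open>The Fourier projection onto the vectors on which each \<open>u h\<close> with
  \<open>h \<in> G0\<close> acts as the scalar \<open>\<xi> h\<close>; dividing by the order of
  \<open>G0\<close> makes it idempotent.\<close>

definition P :: "('a \<Rightarrow> complex) \<Rightarrow> 'a oper" where
  "P \<xi> = opsum G0 (\<lambda>g. cnj (\<xi> g) / n) u"

lemma P_sub: "P \<xi> \<in> sub_vn G0"
  unfolding P_def by (rule opsum_in_subspace[OF vna_subspace[OF sub_vn_vna[OF sub]] fin left_regular_in_sub_vn])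

lemma Pb [simp]: "P \<xi> \<in> bounded_ops"
  by (rule vna_bops[OF sub_vn_vna[OF sub] P_sub])

lemma P_unit: "E \<circ> P \<xi> = P \<xi>" "P \<xi> \<circ> E = P \<xi>"
proof -
  have "P \<xi> \<in> group_vn G" using P_sub sub_vn_subset[OF sub] by auto
  then show "E \<circ> P \<xi> = P \<xi>" "P \<xi> \<circ> E = P \<xi>"
    using vna_star_monoid[OF group_vn_vna] by (auto simp: star_monoid_def group_vn_unit)
qed

lemma character_inv: "\<xi> \<in> \<Gamma> \<Longrightarrow> g \<in> G0 \<Longrightarrow> \<xi> (inv g) = cnj (\<xi> g)"
  using A.character_inv[of \<xi> g] sub by (simp add: m_inv_consistent)

lemma u_P:
  assumes \<xi>: "\<xi> \<in> \<Gamma>" and h: "h \<in> G0"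
  shows "u h \<circ> P \<xi> = op_scale (\<xi> h) (P \<xi>)"
proof -
  have "u h \<circ> P \<xi> = opsum G0 (\<lambda>g. cnj (\<xi> g) / n) (\<lambda>g. u h \<circ> u g)"
    unfolding P_def by (rule normal_lin_opsum[OF normal_lin_mult_left fin]) (simp_all add: h)
  also have "\<dots> = op_scale (\<xi> h) (P \<xi>)"
  proof (intro ext)
    fix z i
    have "(\<Sum>g\<in>G0. cnj (\<xi> g) / n * (u h \<circ> u g) z i) = (\<Sum>g\<in>G0. cnj (\<xi> (inv h \<otimes> g)) / n * u g z i)"
      by (rule sum.reindex_bij_witness[where i="\<lambda>g. inv h \<otimes> g" and j="\<lambda>g. h \<otimes> g"])
        (use h car sub in \<open>auto simp: left_regular_mult m_assoc[symmetric] subgroup.m_closed invG0\<close>)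
    also have "\<dots> = \<xi> h * (\<Sum>g\<in>G0. cnj (\<xi> g) / n * u g z i)"
      by (simp add: A.character_mult[OF \<xi>] invG0 h character_inv[OF \<xi>] sum_distrib_left mult_ac)
    finally show "opsum G0 (\<lambda>g. cnj (\<xi> g) / n) (\<lambda>g. u h \<circ> u g) z i = op_scale (\<xi> h) (P \<xi>) z i"
      by (simp add: opsum_apply op_scale_apply P_def)
  qed
  finally show ?thesis .
qed

lemma P_P:
  assumes \<xi>: "\<xi> \<in> \<Gamma>" and \<eta>: "\<eta> \<in> \<Gamma>"
  shows "P \<eta> \<circ> P \<xi> = op_scale (of_bool (\<eta> = \<xi>)) (P \<xi>)"
proof -
  have "P \<eta> \<circ> P \<xi> = opsum G0 (\<lambda>g. cnj (\<eta> g) / n) (\<lambda>g. u g \<circ> P \<xi>)"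
    unfolding P_def[of \<eta>] by (rule normal_lin_opsum[OF normal_lin_mult_right fin]) simp_all
  also have "\<dots> = opsum G0 (\<lambda>g. cnj (\<eta> g) / n) (\<lambda>g. op_scale (\<xi> g) (P \<xi>))"
    by (rule opsum_cong) (simp_all add: u_P \<xi>)
  also have "\<dots> = op_scale ((\<Sum>g\<in>G0. cnj (\<eta> g) * \<xi> g) / n) (P \<xi>)"
    by (simp add: opsum_def op_scale_def sum_distrib_right sum_divide_distrib mult.assoc)
  also have "(\<Sum>g\<in>G0. cnj (\<eta> g) * \<xi> g) / n = of_bool (\<eta> = \<xi>)"
    using A.character_orthogonality[OF fin \<eta> \<xi>] n0 by simp
  finally show ?thesis .
qed

lemma P_adj:
  assumes \<xi>: "\<xi> \<in> \<Gamma>"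
  shows "op_adj (P \<xi>) = P \<xi>"
proof (rule op_adj_eqI)
  fix i j
  have "cnj (P \<xi> (delta i) j) = (\<Sum>g\<in>G0. \<xi> g / n * cnj (u g (delta i) j))"
    by (simp add: P_def opsum_apply)
  also have "\<dots> = (\<Sum>g\<in>G0. \<xi> g / n * u (inv g) (delta j) i)"
    by (rule sum.cong) (use car in \<open>simp_all add: left_regular_adj[symmetric] op_adj_matrix\<close>)
  also have "\<dots> = (\<Sum>g\<in>G0. cnj (\<xi> g) / n * u g (delta j) i)"
    by (rule sum.reindex_bij_witness[where i="\<lambda>g. inv g" and j="\<lambda>g. inv g"])
      (use car in \<open>simp_all add: invG0 character_inv[OF \<xi>]\<close>)
  finally show "P \<xi> (delta j) i = cnj (P \<xi> (delta i) j)" by (simp add: P_def opsum_apply)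
qed simp_all

text \<open>Completeness of the projections is orthogonality in the other variable: the sum over all
  characters vanishes away from the unit.\<close>

lemma P_sum: "E = opsum \<Gamma> (\<lambda>_. 1) P"
proof (intro ext)
  fix z i
  have "opsum \<Gamma> (\<lambda>_. 1) P z i = (\<Sum>g\<in>G0. \<Sum>\<xi>\<in>\<Gamma>. cnj (\<xi> g) / n * u g z i)"
    unfolding opsum_apply P_def by (simp, rule sum.swap)
  also have "\<dots> = (\<Sum>g\<in>G0. cnj (\<Sum>\<xi>\<in>\<Gamma>. \<xi> g) / n * u g z i)"
    by (simp add: sum_distrib_right sum_divide_distrib)
  also have "\<dots> = (\<Sum>g\<in>G0. if g = \<one> then E z i else 0)"
    by (rule sum.cong) (use n0 in \<open>simp_all add: A.sum_characters[OF fin]\<close>)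
  also have "\<dots> = E z i" using fin subgroup.one_closed[OF sub] by simp
  finally show "E z i = opsum \<Gamma> (\<lambda>_. 1) P z i" ..
qed

text \<open>Tests normal linear maps on the eigenprojections of \<open>L(G0)\<close>. Used once for
  each leg, it reduces identities on tensor powers to their joint eigenblocks.\<close>

lemma P_resolution:
  assumes "normal_lin \<Phi>" "normal_lin \<Psi>" "\<And>\<xi>. \<xi> \<in> \<Gamma> \<Longrightarrow> \<Phi> (P \<xi>) = \<Psi> (P \<xi>)"
  shows "\<Phi> E = \<Psi> E"
proof -
  have "opsum \<Gamma> (\<lambda>_. 1) P \<in> {a \<in> bounded_ops. \<Phi> a = \<Psi> a}"
    by (rule opsum_in_subspace[OF uw_subspace_equalizer[OF assms(1,2)] fin\<Gamma>]) (simp add: assms(3))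
  then show ?thesis unfolding P_sum[symmetric] by simp
qed

text \<open>The coefficient at the unit is the inverse order of \<open>G0\<close>. It allows scalars
  in front of P \<xi> \<otimes> P \<eta> to be compared.\<close>

lemma P_nonzero: "\<xi> \<in> \<Gamma> \<Longrightarrow> P \<xi> (delta \<one>) \<one> \<noteq> 0"
proof -
  assume \<xi>: "\<xi> \<in> \<Gamma>"
  have "P \<xi> (delta \<one>) \<one> = (\<Sum>g\<in>G0. if g = \<one> then cnj (\<xi> g) / n else 0)"
    unfolding P_def opsum_apply
    by (rule sum.cong) (use car in \<open>auto simp: left_regular_delta delta_apply\<close>)
  also have "\<dots> = 1 / n"
    using fin subgroup.one_closed[OF sub] A.character_one[OF \<xi>] by simp
  finally show ?thesis using n0 by simp
qed

lemma \<omega>_norm: "\<xi> \<in> \<Gamma> \<Longrightarrow> \<eta> \<in> \<Gamma> \<Longrightarrow> cmod (\<omega> (\<xi>, \<eta>)) = 1"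
  using \<omega> by (auto simp: two_cocycles_def PiE_def Pi_def)

abbreviation dmult (infixl "\<star>" 70) where "\<xi> \<star> \<eta> \<equiv> \<xi> \<otimes>\<^bsub>pontryagin_dual (G\<lparr>carrier := G0\<rparr>)\<^esub> \<eta>"

lemma \<omega>_cocycle:
  "\<xi> \<in> \<Gamma> \<Longrightarrow> \<eta> \<in> \<Gamma> \<Longrightarrow> \<zeta> \<in> \<Gamma> \<Longrightarrow> \<omega> (\<xi>, \<eta>) * \<omega> (\<xi> \<star> \<eta>, \<zeta>) = \<omega> (\<eta>, \<zeta>) * \<omega> (\<xi>, \<eta> \<star> \<zeta>)"
  using \<omega> by (simp add: two_cocycles_def)

sublocale D: comm_group "pontryagin_dual (G\<lparr>carrier := G0\<rparr>)"
  by (rule A.dual_comm_group)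

section \<open>The unitary cocycle and its eigenblocks\<close>

definition \<Omega> :: "('a \<times> 'a) oper" where
  "\<Omega> = opsum (\<Gamma> \<times> \<Gamma>) \<omega> (\<lambda>k. op_tensor (P (fst k)) (P (snd k)))"

lemma \<Omega>b [simp]: "\<Omega> \<in> bounded_ops"
  unfolding \<Omega>_def by (rule opsum_bops) (simp_all add: fin\<Gamma>)

text \<open>The projections P \<xi> \<otimes> P \<eta> are mutually orthogonal, so such a sum acts
  on each block by its coefficient there. The coefficients are arbitrary in order to cover \<Omega>
  and its adjoint.\<close>

lemma opsum_tensor_collapse:
  assumes \<xi>: "\<xi> \<in> \<Gamma>" and \<eta>: "\<eta> \<in> \<Gamma>"
  shows "opsum (\<Gamma> \<times> \<Gamma>) c (\<lambda>k. op_tensor (P (fst k)) (P (snd k))) \<circ> op_tensor (P \<xi>) (P \<eta>)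
    = op_scale (c (\<xi>, \<eta>)) (op_tensor (P \<xi>) (P \<eta>))"
proof -
  have b: "op_tensor (P \<xi>) (P \<eta>) \<in> bounded_ops" by simp
  have "opsum (\<Gamma> \<times> \<Gamma>) c (\<lambda>k. op_tensor (P (fst k)) (P (snd k))) \<circ> op_tensor (P \<xi>) (P \<eta>)
    = opsum (\<Gamma> \<times> \<Gamma>) c (\<lambda>k. op_tensor (P (fst k)) (P (snd k)) \<circ> op_tensor (P \<xi>) (P \<eta>))"
    by (rule normal_lin_opsum[OF normal_lin_mult_right[OF b]]) (simp_all add: fin\<Gamma>)
  also have "\<dots> = opsum (\<Gamma> \<times> \<Gamma>) c (\<lambda>k. op_scale (of_bool (k = (\<xi>, \<eta>))) (op_tensor (P \<xi>) (P \<eta>)))"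
    by (rule opsum_cong)
      (auto simp: op_tensor_comp P_P \<xi> \<eta> op_tensor_scale(3) of_bool_conj)
  also have "\<dots> = op_scale (c (\<xi>, \<eta>)) (op_tensor (P \<xi>) (P \<eta>))"
    by (rule opsum_collapse) (simp_all add: fin\<Gamma> \<xi> \<eta>)
  finally show ?thesis .
qed

lemma \<Omega>_P: "\<xi> \<in> \<Gamma> \<Longrightarrow> \<eta> \<in> \<Gamma> \<Longrightarrow> \<Omega> \<circ> op_tensor (P \<xi>) (P \<eta>) = op_scale (\<omega> (\<xi>, \<eta>)) (op_tensor (P \<xi>) (P \<eta>))"
  unfolding \<Omega>_def by (rule opsum_tensor_collapse)

lemma \<Omega>_adj: "op_adj \<Omega> = opsum (\<Gamma> \<times> \<Gamma>) (\<lambda>k. cnj (\<omega> k)) (\<lambda>k. op_tensor (P (fst k)) (P (snd k)))"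
proof -
  have "op_adj \<Omega> = opsum (\<Gamma> \<times> \<Gamma>) (\<lambda>k. cnj (\<omega> k)) (\<lambda>k. op_adj (op_tensor (P (fst k)) (P (snd k))))"
    unfolding \<Omega>_def by (rule opsum_adj) (simp_all add: fin\<Gamma>)
  also have "\<dots> = opsum (\<Gamma> \<times> \<Gamma>) (\<lambda>k. cnj (\<omega> k)) (\<lambda>k. op_tensor (P (fst k)) (P (snd k)))"
    by (rule opsum_cong) (auto simp: op_tensor_adj P_adj)
  finally show ?thesis .
qed

lemma \<Omega>_adj_P: "\<xi> \<in> \<Gamma> \<Longrightarrow> \<eta> \<in> \<Gamma> \<Longrightarrow>
    op_adj \<Omega> \<circ> op_tensor (P \<xi>) (P \<eta>) = op_scale (cnj (\<omega> (\<xi>, \<eta>))) (op_tensor (P \<xi>) (P \<eta>))"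
  unfolding \<Omega>_adj by (rule opsum_tensor_collapse)

text \<open>The tensor E \<otimes> E is the sum of all blocks, so operators absorbing it on the
  right are determined by their restrictions to the blocks. The version with three legs is proved
  alike.\<close>

lemma P2_eqI:
  assumes S: "S \<in> bounded_ops" and T: "T \<in> bounded_ops"
    and "S \<circ> op_tensor E E = S" "T \<circ> op_tensor E E = T"
    and eq: "\<And>\<xi> \<eta>. \<xi> \<in> \<Gamma> \<Longrightarrow> \<eta> \<in> \<Gamma> \<Longrightarrow> S \<circ> op_tensor (P \<xi>) (P \<eta>) = T \<circ> op_tensor (P \<xi>) (P \<eta>)"
  shows "S = T"
proof -
  note l = normal_lin_compose[OF normal_lin_tensor_left[OF Eb] normal_lin_mult_left]
    and r = normal_lin_compose[OF normal_lin_tensor_right[OF Pb] normal_lin_mult_left]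
  have "S \<circ> op_tensor E E = T \<circ> op_tensor E E"
    by (rule P_resolution[OF l[OF S] l[OF T]], rule P_resolution[OF r[OF S] r[OF T]]) (rule eq)
  then show ?thesis using assms(3,4) by simp
qed

lemma P3_eqI:
  assumes S: "S \<in> bounded_ops" and T: "T \<in> bounded_ops"
    and "S \<circ> op_tensor E (op_tensor E E) = S" "T \<circ> op_tensor E (op_tensor E E) = T"
    and eq: "\<And>\<xi> \<eta> \<zeta>. \<xi> \<in> \<Gamma> \<Longrightarrow> \<eta> \<in> \<Gamma> \<Longrightarrow> \<zeta> \<in> \<Gamma> \<Longrightarrow>
      S \<circ> op_tensor (P \<xi>) (op_tensor (P \<eta>) (P \<zeta>)) = T \<circ> op_tensor (P \<xi>) (op_tensor (P \<eta>) (P \<zeta>))"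
  shows "S = T"
proof -
  note l = normal_lin_compose[OF normal_lin_tensor_left[OF op_tensor_bops[OF Eb Eb]] normal_lin_mult_left]
    and r = normal_lin_compose[OF normal_lin_tensor_right[OF Pb] normal_lin_mult_left]
  note rl = normal_lin_compose[OF normal_lin_tensor_left[OF Eb] r]
    and rr = normal_lin_compose[OF normal_lin_tensor_right[OF Pb] r]
  have "S \<circ> op_tensor E (op_tensor E E) = T \<circ> op_tensor E (op_tensor E E)"
    by (rule P_resolution[OF l[OF S] l[OF T]], rule P_resolution[OF rl[OF S] rl[OF T]],
        rule P_resolution[OF rr[OF S] rr[OF T]]) (rule eq)
  then show ?thesis using assms(3,4) by simp
qed

lemma EE [simp]: "E \<circ> E = E" by (simp add: left_regular_mult)

lemma \<Omega>_E: "\<Omega> \<circ> op_tensor E E = \<Omega>" "op_adj \<Omega> \<circ> op_tensor E E = op_adj \<Omega>"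
proof -
  have b: "op_tensor E E \<in> bounded_ops" by simp
  have *: "opsum (\<Gamma> \<times> \<Gamma>) c (\<lambda>k. op_tensor (P (fst k)) (P (snd k))) \<circ> op_tensor E E
     = opsum (\<Gamma> \<times> \<Gamma>) c (\<lambda>k. op_tensor (P (fst k)) (P (snd k)))" for c
  proof -
    have "opsum (\<Gamma> \<times> \<Gamma>) c (\<lambda>k. op_tensor (P (fst k)) (P (snd k))) \<circ> op_tensor E E
       = opsum (\<Gamma> \<times> \<Gamma>) c (\<lambda>k. op_tensor (P (fst k)) (P (snd k)) \<circ> op_tensor E E)"
      by (rule normal_lin_opsum[OF normal_lin_mult_right[OF b]]) (simp_all add: fin\<Gamma>)
    then show ?thesis by (simp add: op_tensor_comp P_unit)
  qed
  show "\<Omega> \<circ> op_tensor E E = \<Omega>" "op_adj \<Omega> \<circ> op_tensor E E = op_adj \<Omega>"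
    unfolding \<Omega>_adj unfolding \<Omega>_def by (rule *)+
qed

lemma \<Omega>_unitary: "\<Omega> \<circ> op_adj \<Omega> = op_tensor E E" "op_adj \<Omega> \<circ> \<Omega> = op_tensor E E"
proof -
  have c: "\<omega> (\<xi>, \<eta>) * cnj (\<omega> (\<xi>, \<eta>)) = 1" if "\<xi> \<in> \<Gamma>" "\<eta> \<in> \<Gamma>" for \<xi> \<eta>
    using \<omega>_norm[OF that] by (simp add: complex_norm_square[symmetric])
  have 1: "op_tensor E E \<circ> op_tensor (P \<xi>) (P \<eta>) = op_tensor (P \<xi>) (P \<eta>)" for \<xi> \<eta>
    by (simp add: op_tensor_comp P_unit)
  show "\<Omega> \<circ> op_adj \<Omega> = op_tensor E E"
  proof (rule P2_eqI)
    show "\<Omega> \<circ> op_adj \<Omega> \<circ> op_tensor (P \<xi>) (P \<eta>) = op_tensor E E \<circ> op_tensor (P \<xi>) (P \<eta>)"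
      if "\<xi> \<in> \<Gamma>" "\<eta> \<in> \<Gamma>" for \<xi> \<eta>
      using c[OF that] by (simp add: comp_assoc \<Omega>_adj_P that comp_op_scale_right \<Omega>_P op_scale_scale op_scale_one 1 mult.commute)
  qed (simp_all add: bops_comp comp_assoc \<Omega>_E op_tensor_comp)
  show "op_adj \<Omega> \<circ> \<Omega> = op_tensor E E"
  proof (rule P2_eqI)
    show "op_adj \<Omega> \<circ> \<Omega> \<circ> op_tensor (P \<xi>) (P \<eta>) = op_tensor E E \<circ> op_tensor (P \<xi>) (P \<eta>)"
      if "\<xi> \<in> \<Gamma>" "\<eta> \<in> \<Gamma>" for \<xi> \<eta>
      using c[OF that] by (simp add: comp_assoc \<Omega>_adj_P that comp_op_scale_right \<Omega>_P op_scale_scale op_scale_one 1)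
  qed (simp_all add: bops_comp comp_assoc \<Omega>_E op_tensor_comp)
qed

text \<open>Under the Fourier transform the comultiplication of \<open>L(G0)\<close> is the
  transpose of the product of characters: on the block of (\<xi>, \<eta>) every coproduct of
  \<open>u g\<close> is the scalar \<open>(\<xi> \<star> \<eta>) g\<close>, and orthogonality
  selects \<mu>.\<close>

lemma comult_P:
  assumes \<mu>: "\<mu> \<in> \<Gamma>" and \<xi>: "\<xi> \<in> \<Gamma>" and \<eta>: "\<eta> \<in> \<Gamma>"
  shows "comult (P \<mu>) \<circ> op_tensor (P \<xi>) (P \<eta>) = op_scale (of_bool (\<mu> = \<xi> \<star> \<eta>)) (op_tensor (P \<xi>) (P \<eta>))"
proof -
  let ?T = "op_tensor (P \<xi>) (P \<eta>)"
  have b: "?T \<in> bounded_ops" by simp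
  have "comult (P \<mu>) \<circ> ?T = opsum G0 (\<lambda>g. cnj (\<mu> g) / n) (\<lambda>g. comult (u g) \<circ> ?T)"
    unfolding P_def[of \<mu>]
    by (rule normal_lin_opsum[OF normal_lin_compose[OF normal_lin_comult normal_lin_mult_right[OF b]] fin]) simp
  also have "\<dots> = opsum G0 (\<lambda>g. cnj (\<mu> g) / n) (\<lambda>g. op_scale ((\<xi> \<star> \<eta>) g) ?T)"
    by (rule opsum_cong)
      (simp_all add: comult_left_regular car op_tensor_comp u_P \<xi> \<eta> op_tensor_scale(3) A.dual_simps(2))
  also have "\<dots> = op_scale ((\<Sum>g\<in>G0. cnj (\<mu> g) * (\<xi> \<star> \<eta>) g) / n) ?T"
    by (simp add: opsum_def op_scale_def sum_distrib_right sum_divide_distrib mult.assoc)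
  also have "(\<Sum>g\<in>G0. cnj (\<mu> g) * (\<xi> \<star> \<eta>) g) / n = of_bool (\<mu> = \<xi> \<star> \<eta>)"
    using A.character_orthogonality[OF fin \<mu> D.m_closed[OF \<xi> \<eta>]] n0 by simp
  finally show ?thesis .
qed

lemma comult_Pb [simp]: "comult (P \<mu>) \<in> bounded_ops"
  by (rule normal_lin_bops[OF normal_lin_comult Pb])

lemma comult_left_\<Omega>:
  assumes \<xi>: "\<xi> \<in> \<Gamma>" and \<eta>: "\<eta> \<in> \<Gamma>" and \<zeta>: "\<zeta> \<in> \<Gamma>"
  shows "comult_left \<Omega> \<circ> op_tensor (op_tensor (P \<xi>) (P \<eta>)) (P \<zeta>)
    = op_scale (\<omega> (\<xi> \<star> \<eta>, \<zeta>)) (op_tensor (op_tensor (P \<xi>) (P \<eta>)) (P \<zeta>))" (is "_ \<circ> ?T = _")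
proof -
  have b: "?T \<in> bounded_ops" by simp
  have "comult_left \<Omega> \<circ> ?T = opsum (\<Gamma> \<times> \<Gamma>) \<omega> (\<lambda>k. comult_left (op_tensor (P (fst k)) (P (snd k))) \<circ> ?T)"
    unfolding \<Omega>_def
    by (rule normal_lin_opsum[OF normal_lin_compose[OF normal_lin_comult_left normal_lin_mult_right[OF b]]]) (simp_all add: fin\<Gamma>)
  also have "\<dots> = opsum (\<Gamma> \<times> \<Gamma>) \<omega> (\<lambda>k. op_scale (of_bool (k = (\<xi> \<star> \<eta>, \<zeta>))) ?T)"
    by (rule opsum_cong)
      (auto simp: comult_left_tensor op_tensor_comp comult_P P_P \<xi> \<eta> \<zeta> op_tensor_scale(3) of_bool_conj)
  also have "\<dots> = op_scale (\<omega> (\<xi> \<star> \<eta>, \<zeta>)) ?T"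
    by (rule opsum_collapse) (simp_all add: fin\<Gamma> \<xi> \<eta> \<zeta>)
  finally show ?thesis .
qed

lemma comult_right_\<Omega>:
  assumes \<xi>: "\<xi> \<in> \<Gamma>" and \<eta>: "\<eta> \<in> \<Gamma>" and \<zeta>: "\<zeta> \<in> \<Gamma>"
  shows "comult_right \<Omega> \<circ> op_tensor (P \<xi>) (op_tensor (P \<eta>) (P \<zeta>))
    = op_scale (\<omega> (\<xi>, \<eta> \<star> \<zeta>)) (op_tensor (P \<xi>) (op_tensor (P \<eta>) (P \<zeta>)))" (is "_ \<circ> ?T = _")
proof -
  have b: "?T \<in> bounded_ops" by simp
  have "comult_right \<Omega> \<circ> ?T = opsum (\<Gamma> \<times> \<Gamma>) \<omega> (\<lambda>k. comult_right (op_tensor (P (fst k)) (P (snd k))) \<circ> ?T)"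
    unfolding \<Omega>_def
    by (rule normal_lin_opsum[OF normal_lin_compose[OF normal_lin_comult_right normal_lin_mult_right[OF b]]]) (simp_all add: fin\<Gamma>)
  also have "\<dots> = opsum (\<Gamma> \<times> \<Gamma>) \<omega> (\<lambda>k. op_scale (of_bool (k = (\<xi>, \<eta> \<star> \<zeta>))) ?T)"
    by (rule opsum_cong)
      (auto simp: comult_right_tensor op_tensor_comp comult_P P_P \<xi> \<eta> \<zeta> op_tensor_scale(3) of_bool_conj)
  also have "\<dots> = op_scale (\<omega> (\<xi>, \<eta> \<star> \<zeta>)) ?T"
    by (rule opsum_collapse) (simp_all add: fin\<Gamma> \<xi> \<eta> \<zeta>)
  finally show ?thesis .
qed

text \<open>On the block of (\<xi>, \<eta>, \<zeta>) the left side is the scalar \<open>\<omega>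
  (\<xi>, \<eta>) * \<omega> (\<xi> \<star> \<eta>, \<zeta>)\<close> and the right side is
  \<open>\<omega> (\<eta>, \<zeta>) * \<omega> (\<xi>, \<eta> \<star> \<zeta>)\<close>.\<close>

lemma \<Omega>_cocycle:
  "op_assoc (op_tensor \<Omega> E \<circ> comult_left \<Omega>) = op_tensor E \<Omega> \<circ> comult_right \<Omega>"
proof (rule P3_eqI)
  have cb: "comult_left \<Omega> \<in> bounded_ops" "comult_right \<Omega> \<in> bounded_ops"
    by (simp_all add: normal_lin_bops[OF normal_lin_comult_left] normal_lin_bops[OF normal_lin_comult_right])
  have tb: "op_tensor \<Omega> E \<in> bounded_ops" "op_tensor E \<Omega> \<in> bounded_ops" by simp_all
  have Xb: "op_tensor \<Omega> E \<circ> comult_left \<Omega> \<in> bounded_ops" by (rule bops_comp[OF tb(1) cb(1)])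
  show "op_assoc (op_tensor \<Omega> E \<circ> comult_left \<Omega>) \<in> bounded_ops"
    by (rule normal_lin_bops[OF normal_lin_assoc Xb])
  show "op_tensor E \<Omega> \<circ> comult_right \<Omega> \<in> bounded_ops" by (rule bops_comp[OF tb(2) cb(2)])
  have comE: "comult E = op_tensor E E" by (simp add: comult_left_regular)
  \<comment> \<open>The block test needs the unit to be absorbed; this is \<Delta> \<otimes> id
    applied to \<Omega>(E \<otimes> E) = \<Omega>, as \<Delta>(E) = E \<otimes> E.\<close>
  have cl: "comult_left \<Omega> \<circ> op_tensor (op_tensor E E) E = comult_left \<Omega>"
  proof -
    have "comult_left \<Omega> \<circ> comult_left (op_tensor E E) = comult_left (\<Omega> \<circ> op_tensor E E)"
      unfolding comult_left_def by (rule amp_comp[OF inj_extend_left[OF inj_comult_idx], symmetric]) simp_all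
    then show ?thesis by (simp add: comult_left_tensor comE \<Omega>_E)
  qed
  have cr: "comult_right \<Omega> \<circ> op_tensor E (op_tensor E E) = comult_right \<Omega>"
  proof -
    have "comult_right \<Omega> \<circ> comult_right (op_tensor E E) = comult_right (\<Omega> \<circ> op_tensor E E)"
      unfolding comult_right_def by (rule amp_comp[OF inj_extend_right[OF inj_comult_idx], symmetric]) simp_all
    then show ?thesis by (simp add: comult_right_tensor comE \<Omega>_E)
  qed
  have "op_assoc (op_tensor \<Omega> E \<circ> comult_left \<Omega>) \<circ> op_assoc (op_tensor (op_tensor E E) E)
      = op_assoc (op_tensor \<Omega> E \<circ> (comult_left \<Omega> \<circ> op_tensor (op_tensor E E) E))"
    using Xb by (simp add: op_assoc_comp[symmetric] comp_assoc)
  then show "op_assoc (op_tensor \<Omega> E \<circ> comult_left \<Omega>) \<circ> op_tensor E (op_tensor E E)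
      = op_assoc (op_tensor \<Omega> E \<circ> comult_left \<Omega>)"
    by (simp add: op_assoc_tensor cl)
  show "op_tensor E \<Omega> \<circ> comult_right \<Omega> \<circ> op_tensor E (op_tensor E E) = op_tensor E \<Omega> \<circ> comult_right \<Omega>"
    by (simp add: comp_assoc cr)
  fix \<xi> \<eta> \<zeta> assume \<xi>: "\<xi> \<in> \<Gamma>" and \<eta>: "\<eta> \<in> \<Gamma>" and \<zeta>: "\<zeta> \<in> \<Gamma>"
  let ?T = "op_tensor (op_tensor (P \<xi>) (P \<eta>)) (P \<zeta>)" and ?T' = "op_tensor (P \<xi>) (op_tensor (P \<eta>) (P \<zeta>))"
  have TT: "op_assoc ?T = ?T'" by (simp add: op_assoc_tensor)
  have Tb: "?T \<in> bounded_ops" by simp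
  have "op_tensor \<Omega> E \<circ> comult_left \<Omega> \<circ> ?T = op_scale (\<omega> (\<xi> \<star> \<eta>, \<zeta>)) (op_tensor \<Omega> E \<circ> ?T)"
    by (simp add: comp_assoc comult_left_\<Omega> \<xi> \<eta> \<zeta> comp_op_scale_right)
  also have "op_tensor \<Omega> E \<circ> ?T = op_scale (\<omega> (\<xi>, \<eta>)) ?T"
    by (simp add: op_tensor_comp \<Omega>_P \<xi> \<eta> P_unit op_tensor_scale)
  finally have 1: "op_tensor \<Omega> E \<circ> comult_left \<Omega> \<circ> ?T = op_scale (\<omega> (\<xi>, \<eta>) * \<omega> (\<xi> \<star> \<eta>, \<zeta>)) ?T"
    unfolding op_scale_scale mult.commute[of "\<omega> (\<xi> \<star> \<eta>, \<zeta>)"] .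
  have "op_assoc (op_tensor \<Omega> E \<circ> comult_left \<Omega>) \<circ> ?T' = op_assoc (op_tensor \<Omega> E \<circ> comult_left \<Omega> \<circ> ?T)"
    unfolding TT[symmetric] by (rule op_assoc_comp[OF Xb Tb, symmetric])
  also have "\<dots> = op_scale (\<omega> (\<xi>, \<eta>) * \<omega> (\<xi> \<star> \<eta>, \<zeta>)) ?T'"
    unfolding 1 TT[symmetric] by (rule normal_lin_scale[OF normal_lin_assoc Tb])
  also have "\<omega> (\<xi>, \<eta>) * \<omega> (\<xi> \<star> \<eta>, \<zeta>) = \<omega> (\<eta>, \<zeta>) * \<omega> (\<xi>, \<eta> \<star> \<zeta>)"
    by (rule \<omega>_cocycle[OF \<xi> \<eta> \<zeta>])
  also have "op_scale (\<omega> (\<eta>, \<zeta>) * \<omega> (\<xi>, \<eta> \<star> \<zeta>)) ?T' = op_tensor E \<Omega> \<circ> comult_right \<Omega> \<circ> ?T'"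
  proof -
    have "op_tensor E \<Omega> \<circ> comult_right \<Omega> \<circ> ?T' = op_scale (\<omega> (\<xi>, \<eta> \<star> \<zeta>)) (op_tensor E \<Omega> \<circ> ?T')"
      by (simp add: comp_assoc comult_right_\<Omega> \<xi> \<eta> \<zeta> comp_op_scale_right)
    also have "op_tensor E \<Omega> \<circ> ?T' = op_scale (\<omega> (\<eta>, \<zeta>)) ?T'"
      by (simp add: op_tensor_comp \<Omega>_P \<eta> \<zeta> P_unit op_tensor_scale)
    finally show ?thesis unfolding op_scale_scale mult.commute[of "\<omega> (\<xi>, \<eta> \<star> \<zeta>)"] by (rule sym)
  qed
  finally show "op_assoc (op_tensor \<Omega> E \<circ> comult_left \<Omega>) \<circ> ?T' = op_tensor E \<Omega> \<circ> comult_right \<Omega> \<circ> ?T'" .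
qed

sublocale T: twist G G0 "\<Gamma> \<times> \<Gamma>" \<omega> "\<lambda>k. P (fst k)" "\<lambda>k. P (snd k)" \<Omega>
proof
  show "s \<otimes> t = t \<otimes> s" if "s \<in> G0" "t \<in> G0" for s t
    using A.m_comm that by simp
qed (simp_all add: subgroup.subset[OF sub] invG0 sub fin fin\<Gamma> P_sub \<Omega>_def[symmetric] \<Omega>_unitary \<Omega>_cocycle)

section \<open>From an isomorphism to the triviality of the cocycle\<close>

lemma iso_imp_coboundary:
  assumes "icc G" and "cqg_isomorphic (group_vn G) T.tw (group_vn G) (group_comult G)"
  shows "\<omega> \<in> two_coboundaries (pontryagin_dual (G\<lparr>carrier := G0\<rparr>)) circle_group"
proof -
  obtain c where c: "\<Omega> = op_scale c (op_flip \<Omega>)" using T.iso_imp_symmetric[OF assms] by blast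
  have fb: "op_flip \<Omega> \<in> bounded_ops" by (rule normal_lin_bops[OF normal_lin_flip \<Omega>b])
  have 1: "\<omega> (\<xi>, \<eta>) = c * \<omega> (\<eta>, \<xi>)" if \<xi>: "\<xi> \<in> \<Gamma>" and \<eta>: "\<eta> \<in> \<Gamma>" for \<xi> \<eta>
  proof -
    let ?T = "op_tensor (P \<xi>) (P \<eta>)"
    have "op_flip \<Omega> \<circ> ?T = op_flip (\<Omega> \<circ> op_tensor (P \<eta>) (P \<xi>))"
      by (simp add: op_flip_comp op_flip_tensor)
    also have "\<dots> = op_scale (\<omega> (\<eta>, \<xi>)) ?T"
      by (simp add: \<Omega>_P \<xi> \<eta> normal_lin_scale[OF normal_lin_flip] op_flip_tensor)
    finally have "op_scale (\<omega> (\<xi>, \<eta>)) ?T = op_scale (c * \<omega> (\<eta>, \<xi>)) ?T"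
      using \<Omega>_P[OF \<xi> \<eta>] arg_cong[OF c, of "\<lambda>S. S \<circ> ?T"] by (simp add: comp_op_scale_left op_scale_scale)
    \<comment> \<open>The entry at the unit of P \<xi> \<otimes> P \<eta> is nonzero, so the two
      scalars must agree.\<close>
    then have "op_scale (\<omega> (\<xi>, \<eta>)) ?T (delta (\<one>, \<one>)) (\<one>, \<one>) = op_scale (c * \<omega> (\<eta>, \<xi>)) ?T (delta (\<one>, \<one>)) (\<one>, \<one>)"
      by simp
    then show ?thesis using P_nonzero[OF \<xi>] P_nonzero[OF \<eta>]
      by (simp add: op_scale_apply op_tensor_matrix)
  qed
  \<comment> \<open>At the trivial character in both arguments the relation compares a nonzero
    number with \<open>c\<close> times itself.\<close>
  have "c = 1"
    using 1[OF D.one_closed D.one_closed] \<omega>_norm[OF D.one_closed D.one_closed] by auto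
  then have sym: "\<omega> (\<xi>, \<eta>) = \<omega> (\<eta>, \<xi>)" if "\<xi> \<in> \<Gamma>" "\<eta> \<in> \<Gamma>" for \<xi> \<eta>
    using 1[OF that] by simp
  interpret S: finite_sym_cocycle "pontryagin_dual (G\<lparr>carrier := G0\<rparr>)" \<omega>
    by unfold_locales (use fin\<Gamma> \<omega>_norm \<omega>_cocycle sym in auto)
  obtain f where f: "\<forall>a\<in>\<Gamma>. cmod (f a) = 1"
    "\<forall>a\<in>\<Gamma>. \<forall>b\<in>\<Gamma>. \<omega> (a, b) = f a * f b * inverse (f (a \<star> b))"
    using S.coboundary by blast
  have "\<omega> \<in> extensional (\<Gamma> \<times> \<Gamma>)" using \<omega> by (auto simp: two_cocycles_def PiE_def)
  then have "\<omega> = (\<lambda>(a, b)\<in>\<Gamma> \<times> \<Gamma>. f a * f b * inverse (f (a \<star> b)))"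
    by (rule extensionalityI[of _ "\<Gamma> \<times> \<Gamma>"]) (use f(2) in auto)
  then show ?thesis
    unfolding two_coboundaries_circle[OF D.group_axioms] using f(1) by blast
qed

end

theorem corollary2p14:
  fixes G :: "('g, 'm) monoid_scheme" and G0 :: "'g set"
  assumes "group G" and "icc G"
    and "subgroup G0 G" and "finite G0" and "comm_group (G\<lparr>carrier := G0\<rparr>)"
    and "carrier (H2 (pontryagin_dual (G\<lparr>carrier := G0\<rparr>)) circle_group)
           \<noteq> {\<one>\<^bsub>H2 (pontryagin_dual (G\<lparr>carrier := G0\<rparr>)) circle_group\<^esub>}"
  shows "\<not> quantum_Wstar_superrigid G \<and>
    (\<exists>(B :: 'g oper set) \<Delta>. compact_quantum_group B \<Delta> \<and> kac_type B \<Delta> \<and>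
       vn_isomorphic B (group_vn G) \<and>
       \<not> cqg_isomorphic B \<Delta> (group_vn G) (group_comult G))"
proof -
  have "group (pontryagin_dual (G\<lparr>carrier := G0\<rparr>))"
    using comm_group.dual_comm_group[OF assms(5)] by (rule comm_group.axioms(2))
  then obtain \<omega> where w: "\<omega> \<in> carrier (two_cocycles (pontryagin_dual (G\<lparr>carrier := G0\<rparr>)) circle_group)"
    "\<omega> \<notin> two_coboundaries (pontryagin_dual (G\<lparr>carrier := G0\<rparr>)) circle_group"
    using H2_nontrivialD[OF _ assms(6)] by blast
  interpret dual_twist G G0 \<omega>
    using assms w(1) by (simp add: dual_twist_def dual_twist_axioms_def)
  have cqg: "compact_quantum_group (group_vn G) T.tw" and kac: "kac_type (group_vn G) T.tw"
    by (rule T.tw_compact_quantum_group, rule T.tw_kac_type)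
  \<comment> \<open>The witness \<open>B\<close> is \<open>L(G)\<close> itself with its
    comultiplication twisted, so the identity is the isomorphism of algebras.\<close>
  have vn: "vn_isomorphic (group_vn G) (group_vn G)"
    unfolding vn_isomorphic_def star_iso_def star_hom_def linear_map_def
    by (intro exI[of _ id]) auto
  have non: "\<not> cqg_isomorphic (group_vn G) T.tw (group_vn G) (group_comult G)"
    using iso_imp_coboundary[OF assms(2)] w(2) by blast
  show ?thesis
    unfolding quantum_Wstar_superrigid_def using cqg kac vn non by blast
qed

end
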